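(* Let $\alpha$ be a composition and $\lambda$ a partition, and write ${\mathfrak S}_\alpha{\mathfrak S}_\lambda=\sum_\beta c^\beta_{\alpha,\lambda}{\mathfrak S}_\beta$ (sum over compositions $\beta$). Then each $c^\beta_{\alpha,\lambda}$ is a non-negative integer; specifically, $c^\beta_{\alpha,\lambda}$ equals the number of skew immaculate tableaux of shape $\beta/\!/\alpha$ whose reading word is a Yamanouchi word of content $\lambda$.
   Context: Work over $\mathbb{Q}$. A composition is a finite sequence of positive integers; a partition is a weakly decreasing one. $\mathsf{NSym}$ is the free associative $\mathbb{Q}$-algebra on $H_1,H_2,\dots$ ($\deg H_i=i$); $H_{(a_1,\dots,a_m)}=H_{a_1}\cdots H_{a_m}$, $H_0=1$, $H_{-r}=0$. $\mathsf{QSym}$ has monomial basis $M_\alpha=\sum_{i_1<\dots<i_m}x_{i_1}^{\alpha_1}\cdots x_{i_m}^{\alpha_m}$, paired with $\mathsf{NSym}$ by $\langle H_\alpha,M_\beta\rangle=\delta_{\alpha,\beta}$; $F^\perp$ is defined by $\langle F^\perp H,G\rangle=\langle H,FG\rangle$. With $D(\alpha)=\{\alpha_1,\dots,\alpha_1+\dots+\alpha_{m-1}\}$ and $\alpha\le\beta$ iff $D(\beta)\subseteq D(\alpha)$, $F_\alpha=\sum_{\beta\le\alpha}M_\beta$, $F_{1^i}=F_{(1,\dots,1)}$ ($i$ ones, $F_{1^0}=1$). $\mathbb{B}_m=\sum_{i\ge0}(-1)^iH_{m+i}F_{1^i}^\perp$ and ${\mathfrak S}_\alpha=\mathbb{B}_{\alpha_1}\cdots\mathbb{B}_{\alpha_m}(1)$;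 the ${\mathfrak S}_\beta$ over compositions $\beta$ of $n$ form a basis of the degree-$n$ part of $\mathsf{NSym}$. For compositions $\alpha,\beta$ with $\ell(\alpha)\le\ell(\beta)$ and $\alpha_i\le\beta_i$ for $i\le\ell(\alpha)$, the skew shape $\beta/\!/\alpha$ is the set of cells $(i,j)$ with $1\le i\le\ell(\beta)$, $1\le j\le\beta_i$, excluding those with $i\le\ell(\alpha)$ and $j\le\alpha_i$ (row $i$ is the $i$-th row from the top, $j$ the column). A skew immaculate tableau of shape $\beta/\!/\alpha$ is a filling of these cells with positive integers, weakly increasing left to right along each row, and strictly increasing from top to bottom along the cells of the first column. Its reading word is obtained by reading the entries of each row from right to left, taking rows in order $1,2,3,\dots$ (top to bottom). A word is Yamanouchi if every prefix contains at least as many occurrences of $i$ as of $i+1$ for all $i\ge1$; its content is the sequence whose $i$-th entry is the number of occurrences of $i$. *)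

theory Defs
  imports Complex_Main "HOL-Library.Poly_Mapping" "HOL-Library.FuncSet"
begin

section \<open>Compositions\<close>

typedef composition = "{xs :: nat list. \<forall>x\<in>set xs. 0 < x}"
  morphisms parts Composition
  by (rule exI[of _ "[]"]) simp

setup_lifting type_definition_composition

text \<open>
  Concatenation turns compositions into the free monoid on the positive integers, written
  additively so that \<^typ>\<open>composition \<Rightarrow>\<^sub>0 rat\<close> carries the convolution product.
\<close>

instantiation composition :: monoid_add
begin

lift_definition zero_composition :: composition is "[]" by simp

lift_definition plus_composition :: "composition \<Rightarrow> composition \<Rightarrow> composition" is "(@)"
  by auto

instance by standard (transfer; simp)+

end

definition num_parts :: "composition \<Rightarrow> nat" where
  "num_parts \<alpha> = length (parts \<alpha>)"

definition weight :: "composition \<Rightarrow> nat" where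
  "weight \<alpha> = sum_list (parts \<alpha>)"

text \<open>The \<open>i\<close>-th part, counted from 1; it is 0 beyond the last part.\<close>

definition part :: "composition \<Rightarrow> nat \<Rightarrow> nat" where
  "part \<alpha> i = (if 1 \<le> i \<and> i \<le> num_parts \<alpha> then parts \<alpha> ! (i - 1) else 0)"

definition is_partition :: "composition \<Rightarrow> bool" where
  "is_partition \<mu> \<longleftrightarrow> sorted_wrt (\<ge>) (parts \<mu>)"

definition descents :: "composition \<Rightarrow> nat set" where
  "descents \<alpha> = {sum_list (take k (parts \<alpha>)) | k. 1 \<le> k \<and> k < num_parts \<alpha>}"

text \<open>The order \<open>\<alpha> \<le> \<beta>\<close> compares compositions of the same integer.\<close>

definition comp_le :: "composition \<Rightarrow> composition \<Rightarrow> bool" where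
  "comp_le \<alpha> \<beta> \<longleftrightarrow> weight \<alpha> = weight \<beta> \<and> descents \<beta> \<subseteq> descents \<alpha>"

definition ones :: "nat \<Rightarrow> composition" where
  "ones i = Composition (replicate i 1)"


section \<open>Noncommutative symmetric functions\<close>

text \<open>
  The free associative algebra as the monoid algebra of the free monoid: the coefficient of
  an element at \<open>\<alpha>\<close> is its coefficient at the word \<open>H\<^sub>\<alpha>\<close> (lemma \<open>Hcomp_eq_single\<close>).
\<close>

type_synonym nsym = "composition \<Rightarrow>\<^sub>0 rat"

definition nscale :: "rat \<Rightarrow> nsym \<Rightarrow> nsym" where
  "nscale q A = Poly_Mapping.map ((*) q) A"

definition Hgen :: "int \<Rightarrow> nsym" where
  "Hgen r = (if r < 0 then 0 else if r = 0 then 1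
             else Poly_Mapping.single (Composition [nat r]) 1)"

definition Hcomp :: "composition \<Rightarrow> nsym" where
  "Hcomp \<alpha> = prod_list (map (\<lambda>a. Hgen (int a)) (parts \<alpha>))"

lemma Hcomp_eq_single: "Hcomp \<alpha> = Poly_Mapping.single \<alpha> 1"
proof -
  have "prod_list (map (\<lambda>a. Hgen (int a)) xs) = Poly_Mapping.single (Composition xs) 1"
    if "\<forall>x\<in>set xs. 0 < x" for xs
    using that
  proof (induction xs)
    case Nil
    then show ?case by (simp flip: zero_composition_def)
  next
    case (Cons a xs)
    then have "Composition [a] + Composition xs = Composition (a # xs)"
      by (simp add: plus_composition_def Composition_inverse)
    with Cons show ?case by (simp add: Hgen_def mult_single)
  qed
  from this[of "parts \<alpha>"] show ?thesis
    using parts[of \<alpha>] by (simp add: Hcomp_def parts_inverse)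
qed


section \<open>Quasisymmetric functions\<close>

text \<open>
  Formal power series in commuting variables \<open>x\<^sub>0, x\<^sub>1, \<dots>\<close>, as coefficient functions on
  monomials, a monomial being its finitely supported exponent vector.
\<close>

type_synonym monomial = "nat \<Rightarrow>\<^sub>0 nat"
type_synonym series = "monomial \<Rightarrow> rat"

definition series_mult :: "series \<Rightarrow> series \<Rightarrow> series" where
  "series_mult f g = (\<lambda>m. \<Sum>(a, b)\<in>{(a, b). a + b = m}. f a * g b)"

text \<open>
  The coefficient of \<open>m\<close> counts the index sequences \<open>i\<^sub>1 < \<dots> < i\<^sub>k\<close> whose term in the sum
  defining \<open>M\<^sub>\<alpha>\<close> is the monomial \<open>m\<close>.
\<close>

definition Mqsym :: "composition \<Rightarrow> series" where
  "Mqsym \<alpha> = (\<lambda>m. of_nat (card {is. length is = num_parts \<alpha> \<and> sorted_wrt (<) is \<and>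
      sum_list (map2 Poly_Mapping.single is (parts \<alpha>)) = m}))"

definition Fqsym :: "composition \<Rightarrow> series" where
  "Fqsym \<alpha> = (\<lambda>m. \<Sum>\<beta> | comp_le \<beta> \<alpha>. Mqsym \<beta> m)"

definition qsym_of_coeffs :: "(composition \<Rightarrow>\<^sub>0 rat) \<Rightarrow> series" where
  "qsym_of_coeffs c =
    (\<lambda>m. \<Sum>\<beta>\<in>Poly_Mapping.keys c. Poly_Mapping.lookup c \<beta> * Mqsym \<beta> m)"

definition QSym :: "series set" where
  "QSym = range qsym_of_coeffs"

definition M_coeffs :: "series \<Rightarrow> (composition \<Rightarrow>\<^sub>0 rat)" where
  "M_coeffs G = (THE c. qsym_of_coeffs c = G)"

text \<open>The bilinear pairing with \<open>\<langle>H\<^sub>\<alpha>, M\<^sub>\<beta>\<rangle> = \<delta>\<^sub>\<alpha>\<^sub>\<beta>\<close>; meaningful for \<open>G \<in> QSym\<close>.\<close>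

definition pairing :: "nsym \<Rightarrow> series \<Rightarrow> rat" where
  "pairing A G = (\<Sum>\<alpha>\<in>Poly_Mapping.keys A.
      Poly_Mapping.lookup A \<alpha> * Poly_Mapping.lookup (M_coeffs G) \<alpha>)"

definition perp :: "series \<Rightarrow> nsym \<Rightarrow> nsym" where
  "perp F A = (THE B. \<forall>G\<in>QSym. pairing B G = pairing A (series_mult F G))"


section \<open>The immaculate functions\<close>

text \<open>
  Only finitely many terms of the sum are nonzero for a given \<open>A\<close>, since
  \<open>F\<^sub>1\<^sub>\<dots>\<^sub>1\<^sup>\<bottom>\<close> with \<open>i\<close> ones lowers degrees by \<open>i\<close>.
\<close>

definition creation :: "int \<Rightarrow> nsym \<Rightarrow> nsym" where
  "creation m A =
    Sum_any (\<lambda>i::nat. (- 1) ^ i * Hgen (m + int i) * perp (Fqsym (ones i)) A)"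

definition immaculate :: "composition \<Rightarrow> nsym" where
  "immaculate \<alpha> = foldr (\<lambda>a. creation (int a)) (parts \<alpha>) 1"

definition immaculate_comb :: "(composition \<Rightarrow>\<^sub>0 rat) \<Rightarrow> nsym" where
  "immaculate_comb c =
    (\<Sum>\<beta>\<in>Poly_Mapping.keys c. nscale (Poly_Mapping.lookup c \<beta>) (immaculate \<beta>))"


section \<open>Skew immaculate tableaux\<close>

definition comp_contained :: "composition \<Rightarrow> composition \<Rightarrow> bool" where
  "comp_contained \<alpha> \<beta> \<longleftrightarrow>
    num_parts \<alpha> \<le> num_parts \<beta> \<and> (\<forall>i\<in>{1..num_parts \<alpha>}. part \<alpha> i \<le> part \<beta> i)"

definition skew_shape :: "composition \<Rightarrow> composition \<Rightarrow> (nat \<times> nat) set" where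
  "skew_shape \<beta> \<alpha> = {(i, j). 1 \<le> i \<and> i \<le> num_parts \<beta> \<and> 1 \<le> j \<and> j \<le> part \<beta> i \<and>
      \<not> (i \<le> num_parts \<alpha> \<and> j \<le> part \<alpha> i)}"

text \<open>
  Fillings are extensional functions, so that distinct functions are distinct fillings. There
  are no tableaux when the shape \<open>\<beta> // \<alpha>\<close> is undefined.
\<close>

definition skew_immaculate_tableaux ::
    "composition \<Rightarrow> composition \<Rightarrow> (nat \<times> nat \<Rightarrow> nat) set" where
  "skew_immaculate_tableaux \<beta> \<alpha> = {T. comp_contained \<alpha> \<beta> \<and>
      T \<in> skew_shape \<beta> \<alpha> \<rightarrow>\<^sub>E {1..} \<and>
      (\<forall>i j j'. (i, j) \<in> skew_shape \<beta> \<alpha> \<and> (i, j') \<in> skew_shape \<beta> \<alpha> \<and> j < j'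
          \<longrightarrow> T (i, j) \<le> T (i, j')) \<and>
      (\<forall>i i'. (i, 1) \<in> skew_shape \<beta> \<alpha> \<and> (i', 1) \<in> skew_shape \<beta> \<alpha> \<and> i < i'
          \<longrightarrow> T (i, 1) < T (i', 1))}"

definition reading_word ::
    "composition \<Rightarrow> composition \<Rightarrow> (nat \<times> nat \<Rightarrow> nat) \<Rightarrow> nat list" where
  "reading_word \<beta> \<alpha> T = concat (map
      (\<lambda>i. map (\<lambda>j. T (i, j)) (rev [part \<alpha> i + 1..<part \<beta> i + 1]))
      [1..<num_parts \<beta> + 1])"

definition yamanouchi :: "nat list \<Rightarrow> bool" where
  "yamanouchi w \<longleftrightarrow>
    (\<forall>k \<le> length w. \<forall>i \<ge> 1. count_list (take k w) (i + 1) \<le> count_list (take k w) i)"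

definition has_content :: "nat list \<Rightarrow> composition \<Rightarrow> bool" where
  "has_content w \<mu> \<longleftrightarrow> (\<forall>i \<ge> 1. count_list w i = part \<mu> i)"

definition yamanouchi_tableaux ::
    "composition \<Rightarrow> composition \<Rightarrow> composition \<Rightarrow> (nat \<times> nat \<Rightarrow> nat) set" where
  "yamanouchi_tableaux \<beta> \<alpha> \<mu> = {T \<in> skew_immaculate_tableaux \<beta> \<alpha>.
      yamanouchi (reading_word \<beta> \<alpha> T) \<and> has_content (reading_word \<beta> \<alpha> T) \<mu>}"

end

theory Submission
  imports Defs "HOL-Library.Multiset" "HOL-Library.List_Lexorder"
begin

text \<open>
  Let \<open>D\<^sub>j\<close> be the adjoint of multiplication by the complete homogeneous function \<open>h\<^sub>j\<close>. As it
  inverts the signed operators \<open>F\<^sub>1\<^sub>\<dots>\<^sub>1\<^sup>\<bottom>\<close> in the generating-function sense,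
  \<open>B\<^sub>m(Y) X = \<Sum>\<^sub>j B\<^bsub>m+j\<^esub>(Y (D\<^sub>j X))\<close> and \<open>D\<^sub>j B\<^sub>m = \<Sum>\<^sub>k B\<^bsub>m-k\<^esub> D\<^bsub>j-k\<^esub>\<close>. The first identity moves the rows
  of \<open>\<alpha>\<close> past the second factor one at a time. The element that remains after some of the rows have
  been filled depends only on the content \<open>\<gamma>\<close> of the filling so far: it is \<open>s\<^sub>\<gamma>\<^sup>\<bottom>\<close> applied to
  the immaculate function of \<open>\<mu>\<close>. Filling a weakly increasing row subject to the Yamanouchi condition
  enlarges \<open>\<gamma>\<close> by a horizontal strip, and \<open>D\<^sub>j\<close> acts on these elements by the same Pieri rule. The
  rows below \<open>\<alpha>\<close> come from expanding such an element itself in the immaculate basis: its first row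
  has to contain all the remaining copies of its smallest letter, which is the strictness
  condition in the first column.
\<close>

section \<open>Linear operators on noncommutative symmetric functions\<close>

text \<open>The operators are not introduced by duality. They are coefficients of algebra
  homomorphisms into power series in t: H_x goes to the sum of H_(x-k) t^k for \<open>hperp\<close>,
  and to H_x - H_(x-1) t for \<open>eperp\<close>. Up to a shift of the index these are
  multiplication by 1/(1 - t) and by 1 - t, so every operator identity is checked letter by letter.
  Duality enters once, in \<open>perp_Fqsym_ones\<close>. Schur functions are avoided as well: the
  skewed elements are defined by a recursion over contents. Keeping \<mu>_b in its own position
  makes a step of this recursion the same thing as filling a first row, after which letter b is used
  up and the counts of the larger letters interlace with the old ones. The obstacle is that the
  Pieri rule puts no upper bound on the first entry of a strip, whereas the recursion does. The
  surplus terms vanish because \<mu> is weakly decreasing: \<open>skewimm\<close> is 0 as soon as a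
  content exceeds \<mu>. This makes it possible to discard an exhausted letter, and so to argue by
  induction on the smallest letter.\<close>

lemma lookup_nscale [simp]: "Poly_Mapping.lookup (nscale q A) x = q * Poly_Mapping.lookup A x"
  unfolding nscale_def by (simp add: Poly_Mapping.map.rep_eq when_def)

lemma nscale_single [simp]: "nscale q (Poly_Mapping.single x r) = Poly_Mapping.single x (q * r)"
  by (rule poly_mapping_eqI) (simp add: lookup_single when_def)

lemma nscale_eq_mult: "nscale q A = Poly_Mapping.single 0 q * A"
  unfolding nscale_def by (rule mult_map_scale_conv_mult)

lemma nscale_add: "nscale q (A + B) = nscale q A + nscale q B"
  by (simp add: nscale_eq_mult distrib_left)

lemma nscale_add_left: "nscale (p + q) A = nscale p A + nscale q A"
  by (simp add: nscale_eq_mult single_add distrib_right)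

lemma nscale_nscale [simp]: "nscale p (nscale q A) = nscale (p * q) A"
  by (rule poly_mapping_eqI) simp

lemma nscale_zero [simp]: "nscale q 0 = 0" "nscale 0 A = 0"
  by (rule poly_mapping_eqI; simp)+

lemma nscale_one [simp]: "nscale 1 A = A"
  by (rule poly_mapping_eqI) simp

lemma nscale_minus_one: "nscale (- 1) A = - A"
  by (rule poly_mapping_eqI) simp

lemma nscale_sum: "nscale q (sum f S) = (\<Sum>i\<in>S. nscale q (f i))"
  by (simp add: nscale_eq_mult sum_distrib_left)

lemma nscale_mult_left: "nscale q A * B = nscale q (A * B)"
  by (simp add: nscale_eq_mult mult.assoc)

lemma nsym_induct [case_names zero single add]:
  fixes A :: nsym
  assumes "P 0" "\<And>\<alpha> q. P (Poly_Mapping.single \<alpha> q)" "\<And>A B. P A \<Longrightarrow> P B \<Longrightarrow> P (A + B)"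
  shows "P A"
proof -
  have "P (\<Sum>\<alpha>\<in>S. Poly_Mapping.single \<alpha> (Poly_Mapping.lookup A \<alpha>))" for S
    by (induction S rule: infinite_finite_induct) (simp_all add: assms)
  moreover have "(\<Sum>\<alpha>\<in>Poly_Mapping.keys A. Poly_Mapping.single \<alpha> (Poly_Mapping.lookup A \<alpha>)) = A"
    by (rule poly_mapping_eqI) (simp add: lookup_sum lookup_single when_def in_keys_iff)
  ultimately show ?thesis by metis
qed

lemma single_zero_commute: "Poly_Mapping.single 0 q * (A :: nsym) = A * Poly_Mapping.single 0 q"
  by (induction A rule: nsym_induct) (simp_all add: mult_single mult.commute distrib_left distrib_right)

lemma nscale_mult_right: "A * nscale q B = nscale q (A * B)"
  by (metis nscale_eq_mult mult.assoc single_zero_commute)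

definition nlin :: "(nsym \<Rightarrow> nsym) \<Rightarrow> bool" where
  "nlin f \<longleftrightarrow> (\<forall>A B. f (A + B) = f A + f B) \<and> (\<forall>q A. f (nscale q A) = nscale q (f A))"

lemma nlinI:
  "(\<And>A B. f (A + B) = f A + f B) \<Longrightarrow> (\<And>q A. f (nscale q A) = nscale q (f A)) \<Longrightarrow> nlin f"
  by (simp add: nlin_def)

lemma nlin_add: "nlin f \<Longrightarrow> f (A + B) = f A + f B"
  and nlin_nscale: "nlin f \<Longrightarrow> f (nscale q A) = nscale q (f A)"
  by (simp_all add: nlin_def)

lemma nlin_0: "nlin f \<Longrightarrow> f 0 = 0"
  using nlin_nscale[of f 0 0] by simp

lemma nlin_sum: "nlin f \<Longrightarrow> f (sum g S) = (\<Sum>i\<in>S. f (g i))"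
  by (induction S rule: infinite_finite_induct) (simp_all add: nlin_0 nlin_add)

lemma nlin_id: "nlin (\<lambda>A. A)"
  by (simp add: nlin_def)

lemma nlin_compose: "nlin f \<Longrightarrow> nlin g \<Longrightarrow> nlin (\<lambda>A. f (g A))"
  by (simp add: nlin_def)

lemma nlin_mult_left: "nlin f \<Longrightarrow> nlin (\<lambda>A. B * f A)"
  by (simp add: nlin_def distrib_left nscale_mult_right)

lemma nlin_mult_right: "nlin f \<Longrightarrow> nlin (\<lambda>A. f A * B)"
  by (simp add: nlin_def distrib_right nscale_mult_left)

lemma nlin_sum_fun: "(\<And>i. i \<in> S \<Longrightarrow> nlin (f i)) \<Longrightarrow> nlin (\<lambda>A. \<Sum>i\<in>S. f i A)"
  by (simp add: nlin_def sum.distrib nscale_sum)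

lemma nlin_nscale_fun: "nlin f \<Longrightarrow> nlin (\<lambda>A. nscale q (f A))"
  by (simp add: nlin_def nscale_add mult.commute)

lemmas nlin_intros = nlin_id nlin_mult_left nlin_mult_right nlin_sum_fun nlin_nscale_fun

lemma nlin_eqI:
  assumes "nlin f" "nlin g"
    and "\<And>\<alpha>. f (Poly_Mapping.single \<alpha> 1) = g (Poly_Mapping.single \<alpha> 1)"
  shows "f A = g A"
proof (induction A rule: nsym_induct)
  case zero
  then show ?case by (simp add: nlin_0[OF assms(1)] nlin_0[OF assms(2)])
next
  case (single k v)
  then show ?case
    using nlin_nscale[OF assms(1), of v "Poly_Mapping.single k 1"]
      nlin_nscale[OF assms(2), of v "Poly_Mapping.single k 1"] assms(3)[of k] by simp
next
  case (add A B)
  then show ?case by (simp add: nlin_add[OF assms(1)] nlin_add[OF assms(2)])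
qed

definition lin :: "(composition \<Rightarrow> nsym) \<Rightarrow> nsym \<Rightarrow> nsym" where
  "lin f A = (\<Sum>\<alpha>\<in>Poly_Mapping.keys A. nscale (Poly_Mapping.lookup A \<alpha>) (f \<alpha>))"

lemma lin_superset:
  assumes "finite S" "Poly_Mapping.keys A \<subseteq> S"
  shows "lin f A = (\<Sum>\<alpha>\<in>S. nscale (Poly_Mapping.lookup A \<alpha>) (f \<alpha>))"
  unfolding lin_def
  by (rule sum.mono_neutral_left) (use assms in \<open>auto simp: in_keys_iff\<close>)

lemma nlin_lin: "nlin (lin f)"
proof (rule nlinI)
  fix A B :: nsym and q :: rat
  let ?S = "Poly_Mapping.keys A \<union> Poly_Mapping.keys B"
  show "lin f (A + B) = lin f A + lin f B"
    using Poly_Mapping.keys_add[of A B]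
    by (simp add: lin_superset[of ?S] lookup_add nscale_add_left sum.distrib)
  have "Poly_Mapping.keys (nscale q A) \<subseteq> Poly_Mapping.keys A"
    by (auto simp: in_keys_iff)
  then show "lin f (nscale q A) = nscale q (lin f A)"
    by (simp add: lin_superset[of "Poly_Mapping.keys A"] nscale_sum)
qed

lemma lin_single: "lin f (Poly_Mapping.single \<alpha> q) = nscale q (f \<alpha>)"
  by (simp add: lin_def)

lemma lookup_lin:
  "Poly_Mapping.lookup (lin f A) \<beta> =
    (\<Sum>\<alpha>\<in>Poly_Mapping.keys A. Poly_Mapping.lookup A \<alpha> * Poly_Mapping.lookup (f \<alpha>) \<beta>)"
  by (simp add: lin_def lookup_sum)

lemma sum_triangle_diagonals:
  fixes g :: "nat \<Rightarrow> nat \<Rightarrow> 'a :: comm_monoid_add"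
  shows "(\<Sum>k\<le>n. \<Sum>i\<le>n - k. g k i) = (\<Sum>s\<le>n. \<Sum>k\<le>s. g k (s - k))"
  unfolding sum.triangle_reindex_eq[symmetric]
  by (subst sum.Sigma) (auto intro!: sum.cong)

lemma sum_triangle_swap:
  fixes g :: "nat \<Rightarrow> nat \<Rightarrow> 'a :: comm_monoid_add"
  shows "(\<Sum>k\<le>n. \<Sum>i\<le>n - k. g k i) = (\<Sum>i\<le>n. \<Sum>k\<le>n - i. g k i)"
  by (simp add: sum.Sigma)
    (rule sum.reindex_bij_witness[of _ "\<lambda>(i, l). (l, i)" "\<lambda>(i, l). (l, i)"]; auto)

section \<open>Coefficient operators of homomorphisms from NSym to power series over NSym\<close>

lemma Hgen_0 [simp]: "Hgen 0 = 1" and Hgen_neg: "r < 0 \<Longrightarrow> Hgen r = 0"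
  by (simp_all add: Hgen_def)

definition word :: "nat list \<Rightarrow> nsym" where
  "word xs = prod_list (map (\<lambda>a. Hgen (int a)) xs)"

lemma word_Nil [simp]: "word [] = 1"
  and word_Cons: "word (x # xs) = Hgen (int x) * word xs"
  by (simp_all add: word_def)

lemma word_parts: "word (parts \<alpha>) = Poly_Mapping.single \<alpha> 1"
  using Hcomp_eq_single[of \<alpha>] by (simp add: Hcomp_def word_def)

text \<open>Testing on all lists, zeros included, strengthens the premise, but an induction over the
  list then needs no positivity of the letters.\<close>

lemma nlin_word_eqI:
  assumes "nlin f" "nlin g" and "\<And>xs. f (word xs) = g (word xs)"
  shows "f A = g A"
  by (rule nlin_eqI[OF assms(1,2)]) (metis assms(3) word_parts)

text \<open>\<open>skewop c\<close> is the homomorphism \<open>H\<^sub>x \<mapsto> \<Sum>\<^sub>k c\<^sub>k H\<^bsub>x-k\<^esub> t\<^sup>k\<close>, its index being the exponent of \<open>t\<close>.\<close>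

fun skew_word :: "(nat \<Rightarrow> rat) \<Rightarrow> nat \<Rightarrow> nat list \<Rightarrow> nsym" where
  "skew_word c j [] = (if j = 0 then 1 else 0)"
| "skew_word c j (x # xs) =
    (\<Sum>k\<le>j. nscale (c k) (Hgen (int x - int k) * skew_word c (j - k) xs))"

definition skewop :: "(nat \<Rightarrow> rat) \<Rightarrow> nat \<Rightarrow> nsym \<Rightarrow> nsym" where
  "skewop c j = lin (\<lambda>\<alpha>. skew_word c j (parts \<alpha>))"

lemma nlin_skewop: "nlin (skewop c j)"
  unfolding skewop_def by (rule nlin_lin)

lemma nlin_skewop_fun: "nlin f \<Longrightarrow> nlin (\<lambda>A. skewop c j (f A))"
  using nlin_skewop by (rule nlin_compose)

lemma parts_zero [simp]: "parts 0 = []"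
  by (transfer) simp

lemma parts_plus [simp]: "parts (\<alpha> + \<beta>) = parts \<alpha> @ parts \<beta>"
  by (transfer) simp

lemma parts_pos: "x \<in> set (parts \<alpha>) \<Longrightarrow> 0 < x"
  using parts[of \<alpha>] by auto

lemma parts_Composition: "\<forall>x\<in>set xs. 0 < x \<Longrightarrow> parts (Composition xs) = xs"
  by (simp add: Composition_inverse)

lemma skewop_word_Cons_pos:
  assumes "0 < x"
  shows "skewop c j (Hgen (int x) * Poly_Mapping.single \<alpha> 1) = skew_word c j (x # parts \<alpha>)"
  using assms
  by (simp add: Hgen_def mult_single skewop_def lin_single parts_Composition del: skew_word.simps)

lemma skewop_single: "skewop c j (Poly_Mapping.single \<alpha> 1) = skew_word c j (parts \<alpha>)"
  by (simp add: skewop_def lin_single)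

lemma skewop_one: "skewop c j 1 = (if j = 0 then 1 else 0)"
  using skewop_single[of c j 0] by simp

text \<open>For m > 0 this is the recursion of \<open>skew_word\<close>. Indices m \<le> 0 do not
  occur as letters and are checked separately: H_0 = 1 has to map to 1, which is where
  \<open>c 0 = 1\<close> enters.\<close>

lemma skewop_Hgen_mult:
  assumes "c 0 = 1"
  shows "skewop c j (Hgen m * A) =
    (\<Sum>k\<le>j. nscale (c k) (Hgen (m - int k) * skewop c (j - k) A))"
proof (cases "m > 0")
  case True
  show ?thesis
  proof (rule nlin_eqI[where A = A])
    fix \<alpha>
    show "skewop c j (Hgen m * Poly_Mapping.single \<alpha> 1) =
      (\<Sum>k\<le>j. nscale (c k) (Hgen (m - int k) * skewop c (j - k) (Poly_Mapping.single \<alpha> 1)))"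
      using skewop_word_Cons_pos[of "nat m" c j \<alpha>] True by (simp add: skewop_single)
  qed (intro nlin_intros nlin_skewop_fun)+
next
  case False
  have "Hgen (m - int k) = (if k = 0 then Hgen m else 0)" for k
    using False by (auto simp: Hgen_neg)
  then have "(\<Sum>k\<le>j. nscale (c k) (Hgen (m - int k) * skewop c (j - k) A)) =
    (\<Sum>k\<le>j. if k = 0 then Hgen m * skewop c j A else 0)"
    by (intro sum.cong) (auto simp: assms)
  also have "\<dots> = skewop c j (Hgen m * A)"
    using False by (cases "m = 0") (simp_all add: Hgen_neg nlin_0[OF nlin_skewop])
  finally show ?thesis ..
qed

text \<open>Multiplicativity of the homomorphism, read off at t^j. It follows from the rule for one
  generator by regrouping the exponents contributed by the first letter and by the rest.\<close>

lemma skewop_mult: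
  assumes "c 0 = 1"
  shows "skewop c j (A * B) = (\<Sum>k\<le>j. skewop c k A * skewop c (j - k) B)"
proof (rule nlin_word_eqI[where A = A])
  fix xs
  show "skewop c j (word xs * B) = (\<Sum>k\<le>j. skewop c k (word xs) * skewop c (j - k) B)"
  proof (induction xs arbitrary: j)
    case Nil
    have "(\<Sum>k\<le>j. skewop c k 1 * skewop c (j - k) B) = (\<Sum>k\<le>j. if k = 0 then skewop c j B else 0)"
      by (intro sum.cong) (auto simp: skewop_one)
    then show ?case by simp
  next
    case (Cons x xs)
    have "skewop c j (word (x # xs) * B) =
      (\<Sum>k\<le>j. \<Sum>i\<le>j - k. nscale (c k) (Hgen (int x - int k) * skewop c i (word xs) * skewop c (j - k - i) B))"
      by (simp add: word_Cons mult.assoc skewop_Hgen_mult[of c, OF assms] Cons sum_distrib_left nscale_sum)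
    also have "\<dots> = (\<Sum>s\<le>j. \<Sum>k\<le>s. nscale (c k) (Hgen (int x - int k) * skewop c (s - k) (word xs) * skewop c (j - k - (s - k)) B))"
      by (rule sum_triangle_diagonals)
    also have "\<dots> = (\<Sum>s\<le>j. skewop c s (word (x # xs)) * skewop c (j - s) B)"
      by (intro sum.cong) (auto simp: word_Cons skewop_Hgen_mult[of c, OF assms] sum_distrib_right nscale_mult_left mult.assoc)
    finally show ?case .
  qed
qed (intro nlin_intros nlin_skewop_fun)+

text \<open>Both operators shift the index of each letter, and shifts by k and by l commute.\<close>

lemma skewop_commute:
  assumes "c 0 = 1" "d 0 = 1"
  shows "skewop c i (skewop d j A) = skewop d j (skewop c i A)"
proof (rule nlin_word_eqI[where A = A])
  fix xs
  show "skewop c i (skewop d j (word xs)) = skewop d j (skewop c i (word xs))"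
  proof (induction xs arbitrary: i j)
    case Nil
    show ?case by (simp add: skewop_one nlin_0[OF nlin_skewop])
  next
    case (Cons x xs)
    have "skewop c i (skewop d j (word (x # xs))) =
      (\<Sum>k\<le>j. \<Sum>l\<le>i. nscale (d k * c l) (Hgen (int x - int k - int l) * skewop c (i - l) (skewop d (j - k) (word xs))))"
      by (simp add: word_Cons skewop_Hgen_mult assms nlin_sum[OF nlin_skewop] nlin_nscale[OF nlin_skewop] nscale_sum)
    also have "\<dots> = (\<Sum>l\<le>i. \<Sum>k\<le>j. nscale (c l * d k) (Hgen (int x - int l - int k) * skewop d (j - k) (skewop c (i - l) (word xs))))"
      by (subst sum.swap) (intro sum.cong refl, simp add: Cons mult.commute algebra_simps)
    also have "\<dots> = skewop d j (skewop c i (word (x # xs)))"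
      by (simp add: word_Cons skewop_Hgen_mult assms nlin_sum[OF nlin_skewop] nlin_nscale[OF nlin_skewop] nscale_sum)
    finally show ?case .
  qed
qed (intro nlin_intros nlin_skewop_fun)+

text \<open>The coefficients of 1 - t, the inverse of the series 1 + t + t^2 + ... that underlies
  \<open>hperp\<close>.\<close>

definition elem_coeff :: "nat \<Rightarrow> rat" where
  "elem_coeff k = (if k = 0 then 1 else if k = 1 then - 1 else 0)"

abbreviation eperp :: "nat \<Rightarrow> nsym \<Rightarrow> nsym" where
  "eperp \<equiv> skewop elem_coeff"

abbreviation hperp :: "nat \<Rightarrow> nsym \<Rightarrow> nsym" where
  "hperp \<equiv> skewop (\<lambda>_. 1)"

text \<open>
  Up to the sign \<open>(-1)\<^sup>i\<close>, \<open>eperp i\<close> is \<open>F\<^sub>1\<^sub>\<dots>\<^sub>1\<^sup>\<bottom>\<close> with \<open>i\<close> ones (lemma \<open>perp_Fqsym_ones\<close>); \<open>hperp j\<close> is the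
  adjoint of multiplication by \<open>h\<^sub>j\<close>.
\<close>

lemma elem_coeff_0 [simp]: "elem_coeff 0 = 1"
  by (simp add: elem_coeff_def)

lemma sum_elem_coeff:
  "(\<Sum>k\<le>j. nscale (elem_coeff k) (f k)) = f 0 - (if j = 0 then 0 else f 1)"
proof -
  have "(\<Sum>k\<le>j. nscale (elem_coeff k) (f k)) = (\<Sum>k\<in>{..j} \<inter> {..1}. nscale (elem_coeff k) (f k))"
    by (rule sum.mono_neutral_right) (auto simp: elem_coeff_def)
  also have "\<dots> = f 0 - (if j = 0 then 0 else f 1)"
  proof (cases "j = 0")
    case True
    then have "{..j} \<inter> {..1} = {0}" by auto
    then show ?thesis using True by simp
  next
    case False
    then have "{..j} \<inter> {..1} = {0, 1}" by auto
    then show ?thesis using False by (simp add: elem_coeff_def nscale_minus_one)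
  qed
  finally show ?thesis .
qed

lemma eperp_Hgen_mult:
  "eperp j (Hgen m * A) = Hgen m * eperp j A - (if j = 0 then 0 else Hgen (m - 1) * eperp (j - 1) A)"
  unfolding skewop_Hgen_mult[of elem_coeff, OF elem_coeff_0] by (simp add: sum_elem_coeff)

text \<open>On each letter, 1 - t cancels 1 + t + t^2 + .... In the induction the two terms of
  \<open>eperp\<close> on the first letter lead to the sums \<open>A\<close> and \<open>B\<close>;
  by the induction hypothesis both collapse to \<open>Hgen (int x - int s)\<close> times the
  remaining word, and they cancel for s > 0.\<close>

lemma eperp_hperp:
  "(\<Sum>i\<le>s. eperp i (hperp (s - i) A)) = (if s = 0 then A else 0)"
proof (rule nlin_word_eqI[where A = A and f = "\<lambda>A. \<Sum>i\<le>s. eperp i (hperp (s - i) A)"])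
  show "nlin (\<lambda>A. if s = 0 then A else 0)"
    by (auto simp: nlin_def)
  fix xs
  show "(\<Sum>i\<le>s. eperp i (hperp (s - i) (word xs))) = (if s = 0 then word xs else 0)"
  proof (induction xs arbitrary: s)
    case Nil
    have "(\<Sum>i\<le>s. eperp i (hperp (s - i) 1)) = (\<Sum>i\<le>s. if i = s then eperp s 1 else 0)"
      by (intro sum.cong) (auto simp: skewop_one nlin_0[OF nlin_skewop])
    then show ?case by (simp add: skewop_one)
  next
    case (Cons x xs)
    let ?W = "word xs" and ?H = "\<lambda>k. Hgen (int x - int k)"
    have A: "(\<Sum>i\<le>s. \<Sum>l\<le>s - i. ?H l * eperp i (hperp (s - i - l) ?W)) = ?H s * ?W" for s
    proof -
      have "(\<Sum>i\<le>s. \<Sum>l\<le>s - i. ?H l * eperp i (hperp (s - i - l) ?W)) =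
        (\<Sum>l\<le>s. \<Sum>i\<le>s - l. ?H l * eperp i (hperp (s - i - l) ?W))"
        by (rule sum_triangle_swap)
      also have "\<dots> = (\<Sum>l\<le>s. ?H l * (\<Sum>i\<le>s-l. eperp i (hperp (s - l - i) ?W)))"
        by (intro sum.cong refl) (simp add: sum_distrib_left add.commute)
      also have "\<dots> = (\<Sum>l\<le>s. if l = s then ?H s * ?W else 0)"
        by (intro sum.cong refl) (subst Cons, auto)
      finally show ?thesis by simp
    qed
    have B: "(\<Sum>i\<in>{1..s}. \<Sum>l\<le>s - i. Hgen (int x - int l - 1) * eperp (i - 1) (hperp (s - i - l) ?W))
      = (if s = 0 then 0 else ?H s * ?W)"
    proof (cases s)
      case (Suc t)
      have "(\<Sum>i\<in>{1..s}. \<Sum>l\<le>s - i. Hgen (int x - int l - 1) * eperp (i - 1) (hperp (s - i - l) ?W)) =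
        (\<Sum>i\<le>t. \<Sum>l\<le>t - i. Hgen (int x - int l - 1) * eperp i (hperp (t - i - l) ?W))"
        by (rule sum.reindex_bij_witness[of _ Suc "\<lambda>i. i - 1"]) (auto simp: Suc)
      also have "\<dots> = (\<Sum>l\<le>t. \<Sum>i\<le>t - l. Hgen (int x - int l - 1) * eperp i (hperp (t - i - l) ?W))"
        by (rule sum_triangle_swap)
      also have "\<dots> = (\<Sum>l\<le>t. Hgen (int x - int l - 1) * (\<Sum>i\<le>t-l. eperp i (hperp (t - l - i) ?W)))"
        by (intro sum.cong refl) (simp add: sum_distrib_left add.commute)
      also have "\<dots> = (\<Sum>l\<le>t. if l = t then ?H s * ?W else 0)"
        by (intro sum.cong refl) (subst Cons, auto simp: Suc algebra_simps)
      finally show ?thesis by (simp add: Suc)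
    qed simp
    have "(\<Sum>i\<le>s. eperp i (hperp (s - i) (word (x # xs)))) =
      (\<Sum>i\<le>s. \<Sum>l\<le>s - i. ?H l * eperp i (hperp (s - i - l) ?W)) -
      (\<Sum>i\<le>s. if i = 0 then 0 else \<Sum>l\<le>s - i. Hgen (int x - int l - 1) * eperp (i - 1) (hperp (s - i - l) ?W))"
      unfolding sum_subtractf[symmetric]
    proof (rule sum.cong[OF refl])
      fix i
      have "eperp i (hperp (s - i) (word (x # xs))) = (\<Sum>l\<le>s - i. eperp i (?H l * hperp (s - i - l) ?W))"
        by (simp add: word_Cons skewop_Hgen_mult[of "\<lambda>_. 1"] nlin_sum[OF nlin_skewop])
      also have "\<dots> = (\<Sum>l\<le>s - i. ?H l * eperp i (hperp (s - i - l) ?W)) -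
        (if i = 0 then 0 else \<Sum>l\<le>s - i. Hgen (int x - int l - 1) * eperp (i - 1) (hperp (s - i - l) ?W))"
        by (simp only: eperp_Hgen_mult sum_subtractf) simp
      finally show "eperp i (hperp (s - i) (word (x # xs))) = \<dots>" .
    qed
    also have "(\<Sum>i\<le>s. if i = 0 then 0 else \<Sum>l\<le>s - i. Hgen (int x - int l - 1) * eperp (i - 1) (hperp (s - i - l) ?W)) =
       (\<Sum>i\<in>{1..s}. \<Sum>l\<le>s - i. Hgen (int x - int l - 1) * eperp (i - 1) (hperp (s - i - l) ?W))"
      by (rule sum.mono_neutral_cong_right) auto
    finally show ?case by (simp only: A B) (simp add: word_Cons)
  qed
qed (intro nlin_intros nlin_skewop_fun)+

section \<open>Bernstein operators\<close>

lemma weight_zero [simp]: "weight 0 = 0"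
  and weight_plus [simp]: "weight (\<alpha> + \<beta>) = weight \<alpha> + weight \<beta>"
  by (simp_all add: weight_def)

lemma keys_nscale: "Poly_Mapping.keys (nscale q A) \<subseteq> Poly_Mapping.keys A"
  by (auto simp: in_keys_iff)

lemma keys_sum_subset:
  fixes f :: "'b \<Rightarrow> 'a \<Rightarrow>\<^sub>0 'c :: comm_monoid_add"
  shows "Poly_Mapping.keys (sum f S) \<subseteq> (\<Union>i\<in>S. Poly_Mapping.keys (f i))"
proof (induction S rule: infinite_finite_induct)
  case (insert x F)
  then show ?case using Poly_Mapping.keys_add[of "f x" "sum f F"] by auto
qed auto

lemma keys_Hgen: "\<gamma> \<in> Poly_Mapping.keys (Hgen r) \<Longrightarrow> int (weight \<gamma>) = r"
  by (auto simp: Hgen_def weight_def parts_Composition split: if_splits)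

lemma keys_skew_word:
  "\<gamma> \<in> Poly_Mapping.keys (skew_word c j xs) \<Longrightarrow> weight \<gamma> + j = sum_list xs"
proof (induction xs arbitrary: \<gamma> j)
  case Nil
  then show ?case by (auto split: if_splits)
next
  case (Cons x xs)
  then obtain k where "k \<le> j"
      "\<gamma> \<in> Poly_Mapping.keys (nscale (c k) (Hgen (int x - int k) * skew_word c (j - k) xs))"
    using keys_sum_subset by (fastforce simp del: Poly_Mapping.map_single)
  then obtain \<gamma>1 \<gamma>2 where "\<gamma> = \<gamma>1 + \<gamma>2" "\<gamma>1 \<in> Poly_Mapping.keys (Hgen (int x - int k))"
      "\<gamma>2 \<in> Poly_Mapping.keys (skew_word c (j - k) xs)"
    using keys_nscale keys_mult by blast
  then show ?case
    using Cons.IH[of \<gamma>2 "j - k"] keys_Hgen[of \<gamma>1] \<open>k \<le> j\<close> by fastforce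
qed

lemma keys_skewop:
  assumes "\<beta> \<in> Poly_Mapping.keys (skewop c j A)"
  obtains \<alpha> where "\<alpha> \<in> Poly_Mapping.keys A" "weight \<alpha> = weight \<beta> + j"
proof -
  obtain \<alpha> where "\<alpha> \<in> Poly_Mapping.keys A" "\<beta> \<in> Poly_Mapping.keys (skew_word c j (parts \<alpha>))"
    using assms keys_sum_subset keys_nscale unfolding skewop_def lin_def by fast
  then show thesis
    using that keys_skew_word[of \<beta> c j "parts \<alpha>"] by (simp add: weight_def)
qed

definition deg_le :: "nat \<Rightarrow> nsym \<Rightarrow> bool" where
  "deg_le N A \<longleftrightarrow> (\<forall>\<alpha>\<in>Poly_Mapping.keys A. weight \<alpha> \<le> N)"

lemma deg_le_exists: "\<exists>N. deg_le N A"
  unfolding deg_le_def by (metis finite_keys finite_imageI finite_nat_set_iff_bounded_le imageI)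

lemma deg_le_mono: "deg_le N A \<Longrightarrow> N \<le> M \<Longrightarrow> deg_le M A"
  by (force simp: deg_le_def)

lemma skewop_eq_0: "deg_le N A \<Longrightarrow> N < j \<Longrightarrow> skewop c j A = 0"
proof (rule poly_mapping_eqI, rule ccontr)
  fix \<beta> assume *: "deg_le N A" "N < j" "Poly_Mapping.lookup (skewop c j A) \<beta> \<noteq> Poly_Mapping.lookup 0 \<beta>"
  then have "\<beta> \<in> Poly_Mapping.keys (skewop c j A)" by (simp add: in_keys_iff)
  then show False using * by (elim keys_skewop) (fastforce simp: deg_le_def)
qed

lemma deg_le_skewop: "deg_le N A \<Longrightarrow> deg_le (N - j) (skewop c j A)"
  by (auto simp: deg_le_def elim!: keys_skewop)

lemma skewop_skewop_eq_0: "deg_le N A \<Longrightarrow> N < i + j \<Longrightarrow> skewop c i (skewop d j A) = 0"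
  by (cases "N < j") (auto intro!: skewop_eq_0[of "N - j"] deg_le_skewop
     simp: skewop_eq_0[of N] nlin_0[OF nlin_skewop])

lemma deg_le_mult: "deg_le N A \<Longrightarrow> deg_le M B \<Longrightarrow> deg_le (N + M) (A * B)"
  using keys_mult[of A B] by (fastforce simp: deg_le_def intro: add_mono)

text \<open>The creation operator with the sign and the perp operator merged into
  \<open>eperp\<close>; the two are identified in \<open>creation_eq_bern\<close>.\<close>

definition bern :: "int \<Rightarrow> nsym \<Rightarrow> nsym" where
  "bern m A = Sum_any (\<lambda>i. Hgen (m + int i) * eperp i A)"

lemma bern_eq:
  assumes "\<And>i. N < i \<Longrightarrow> eperp i A = 0"
  shows "bern m A = (\<Sum>i\<le>N. Hgen (m + int i) * eperp i A)"
  unfolding bern_def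
proof (rule Sum_any.expand_superset)
  show "{i. Hgen (m + int i) * eperp i A \<noteq> 0} \<subseteq> {..N}"
    using assms by (metis (mono_tags, lifting) atMost_iff linorder_not_le mem_Collect_eq mult_zero_right subsetI)
qed simp

lemma bern_eq_deg: "deg_le N A \<Longrightarrow> bern m A = (\<Sum>i\<le>N. Hgen (m + int i) * eperp i A)"
  by (rule bern_eq) (rule skewop_eq_0)

lemma nlin_bern: "nlin (bern m)"
proof (rule nlinI)
  fix A B :: nsym and q :: rat
  obtain N M where "deg_le N A" "deg_le M B" using deg_le_exists by metis
  then have A: "eperp i A = 0" and B: "eperp i B = 0" if "max N M < i" for i
    using that by (auto intro: skewop_eq_0)
  show "bern m (A + B) = bern m A + bern m B"
    by (subst (1 2 3) bern_eq[where N = "max N M"])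
      (simp_all add: A B nlin_add[OF nlin_skewop] distrib_left sum.distrib)
  show "bern m (nscale q A) = nscale q (bern m A)"
    by (subst (1 2) bern_eq[where N = "max N M"])
      (simp_all add: A nlin_nscale[OF nlin_skewop] nscale_mult_right nscale_sum)
qed

lemma bern_one: "bern m 1 = Hgen m"
  by (subst bern_eq[where N = 0]) (auto simp: skewop_one)

text \<open>\<open>hperp\<close> splits over each product
  \<open>Hgen (m + int i) * eperp i Y\<close>: on the left factor it lowers the index by k, and past
  \<open>eperp\<close> it commutes, so that the sum over i is a \<open>bern\<close> again.\<close>

lemma hperp_bern: "hperp j (bern m Y) = (\<Sum>k\<le>j. bern (m - int k) (hperp (j - k) Y))"
proof -
  obtain N where N: "deg_le N Y" using deg_le_exists by metis
  have "hperp j (bern m Y) =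
      (\<Sum>i\<le>N. \<Sum>k\<le>j. Hgen (m + int i - int k) * eperp i (hperp (j - k) Y))"
    by (simp add: bern_eq_deg[OF N] nlin_sum[OF nlin_skewop] skewop_Hgen_mult
        skewop_commute[of "\<lambda>_. 1" elem_coeff])
  also have "\<dots> = (\<Sum>k\<le>j. \<Sum>i\<le>N. Hgen (m + int i - int k) * eperp i (hperp (j - k) Y))"
    by (rule sum.swap)
  also have "\<dots> = (\<Sum>k\<le>j. bern (m - int k) (hperp (j - k) Y))"
  proof (rule sum.cong[OF refl])
    fix k
    have "eperp i (hperp (j - k) Y) = 0" if "N < i" for i
      using N that by (intro skewop_skewop_eq_0) auto
    then show "(\<Sum>i\<le>N. Hgen (m + int i - int k) * eperp i (hperp (j - k) Y)) =
        bern (m - int k) (hperp (j - k) Y)"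
      by (subst bern_eq[where N = N]) (auto simp: algebra_simps)
  qed
  finally show ?thesis .
qed

text \<open>Proved from right to left. Multiplicativity of \<open>eperp\<close> splits a term into a
  factor \<open>eperp l Y\<close> and a factor \<open>eperp k (hperp j X)\<close>, with a generator
  whose index depends on j and k only through j + k. Collecting by j + k leaves only j = k = 0, by
  \<open>eperp_hperp\<close>.\<close>

lemma bern_mult:
  assumes "deg_le N X"
  shows "bern m Y * X = (\<Sum>j\<le>N. bern (m + int j) (Y * hperp j X))"
proof -
  obtain K where K: "deg_le K Y" using deg_le_exists by metis
  \<comment> \<open>Bounds the degree of \<open>Y * hperp j X\<close> for every j, so that all the
    sums can be cut at the same place.\<close>
  let ?M = "K + N"
  let ?g = "\<lambda>l j k. Hgen (m + int l + int (j + k)) * (eperp l Y * eperp k (hperp j X))"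
  have "(\<Sum>j\<le>N. bern (m + int j) (Y * hperp j X)) = (\<Sum>j\<le>N. \<Sum>l\<le>?M. \<Sum>k\<le>?M - l. ?g l j k)"
  proof (rule sum.cong[OF refl])
    fix j
    have "deg_le (K + (N - j)) (Y * hperp j X)"
      by (intro deg_le_mult K deg_le_skewop assms)
    then have "deg_le ?M (Y * hperp j X)"
      by (rule deg_le_mono) auto
    then have "bern (m + int j) (Y * hperp j X) =
       (\<Sum>i\<le>?M. \<Sum>l\<le>i. Hgen (m + int j + int i) * (eperp l Y * eperp (i - l) (hperp j X)))"
      by (simp only: bern_eq_deg skewop_mult elem_coeff_0 sum_distrib_left)
    also have "\<dots> = (\<Sum>i\<le>?M. \<Sum>l\<le>i. ?g l j (i - l))"
    proof (intro sum.cong refl)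
      fix i l :: nat assume "l \<in> {..i}"
      then have "m + int j + int i = m + int l + int (j + (i - l))" by auto
      then show "Hgen (m + int j + int i) * (eperp l Y * eperp (i - l) (hperp j X)) = ?g l j (i - l)"
        by (simp only:)
    qed
    also have "\<dots> = (\<Sum>l\<le>?M. \<Sum>k\<le>?M - l. ?g l j k)"
      by (rule sum_triangle_diagonals[symmetric])
    finally show "bern (m + int j) (Y * hperp j X) = \<dots>" .
  qed
  also have "\<dots> = (\<Sum>l\<le>?M. \<Sum>j\<le>N. \<Sum>k\<le>?M - l. ?g l j k)"
    by (rule sum.swap)
  also have "\<dots> = (\<Sum>l\<le>?M. Hgen (m + int l) * eperp l Y * X)"
  proof (rule sum.cong[OF refl])
    fix l
    show "(\<Sum>j\<le>N. \<Sum>k\<le>?M - l. ?g l j k) = Hgen (m + int l) * eperp l Y * X"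
    proof (cases "l \<le> K")
      case False
      then show ?thesis using skewop_eq_0[OF K] by simp
    next
      case True
      \<comment> \<open>Terms with j + k > N vanish by degree; dropping them leaves a full triangle,
        which can be summed along its diagonals.\<close>
      have "(\<Sum>j\<le>N. \<Sum>k\<le>?M - l. ?g l j k) = (\<Sum>j\<le>N. \<Sum>k\<le>N - j. ?g l j k)"
      proof (rule sum.cong[OF refl], rule sum.mono_neutral_right)
        fix j assume "j \<in> {..N}"
        show "\<forall>k\<in>{..?M - l} - {..N - j}. ?g l j k = 0"
        proof
          fix k assume "k \<in> {..?M - l} - {..N - j}"
          then have "N < k + j" by auto
          then show "?g l j k = 0" by (simp add: skewop_skewop_eq_0[OF assms])
        qed
      qed (use True in auto)
      also have "\<dots> = (\<Sum>s\<le>N. \<Sum>j\<le>s. ?g l j (s - j))"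
        by (rule sum_triangle_diagonals)
      also have "\<dots> = (\<Sum>s\<le>N. Hgen (m + int l + int s) * (eperp l Y * (\<Sum>j\<le>s. eperp (s - j) (hperp j X))))"
        by (simp add: sum_distrib_left)
      also have "\<dots> = (\<Sum>s\<le>N. if s = 0 then Hgen (m + int l) * (eperp l Y * X) else 0)"
      proof (intro sum.cong refl)
        fix s
        have "(\<Sum>j\<le>s. eperp (s - j) (hperp j X)) = (\<Sum>i\<le>s. eperp i (hperp (s - i) X))"
          by (rule sum.reindex_bij_witness[of _ "\<lambda>i. s - i" "\<lambda>i. s - i"]) auto
        then show "Hgen (m + int l + int s) * (eperp l Y * (\<Sum>j\<le>s. eperp (s - j) (hperp j X))) =
          (if s = 0 then Hgen (m + int l) * (eperp l Y * X) else 0)"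
          by (simp add: eperp_hperp)
      qed
      finally show ?thesis by (simp add: mult.assoc)
    qed
  qed
  also have "\<dots> = bern m Y * X"
    using deg_le_mono[OF K le_add1[of K N]] by (simp only: bern_eq_deg sum_distrib_right)
  finally show ?thesis ..
qed

text \<open>The case Y = 1. It turns multiplication by a generator into a sum of the kind that
  defines \<open>skewimm\<close>, for use in \<open>skewimm_first_full_aux\<close>.\<close>

corollary Hgen_mult_bern:
  "deg_le N X \<Longrightarrow> Hgen m * X = (\<Sum>j\<le>N. bern (m + int j) (hperp j X))"
  using bern_mult[of N X m 1] by (simp add: bern_one)

section \<open>Skewed immaculate functions\<close>

lemma finite_functions_box:
  assumes "finite A" "\<And>r. r \<in> A \<Longrightarrow> finite (B r)"
  shows "finite {f. (\<forall>r\<in>A. f r \<in> B r) \<and> (\<forall>r. r \<notin> A \<longrightarrow> f r = g r)}"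
proof (rule finite_subset)
  show "{f. (\<forall>r\<in>A. f r \<in> B r) \<and> (\<forall>r. r \<notin> A \<longrightarrow> f r = g r)} \<subseteq>
      (\<lambda>h r. if r \<in> A then h r else g r) ` (\<Pi>\<^sub>E r\<in>A. B r)"
  proof
    fix f assume f: "f \<in> {f. (\<forall>r\<in>A. f r \<in> B r) \<and> (\<forall>r. r \<notin> A \<longrightarrow> f r = g r)}"
    then have "f = (\<lambda>r. if r \<in> A then restrict f A r else g r)" by auto
    moreover have "restrict f A \<in> (\<Pi>\<^sub>E r\<in>A. B r)" using f by auto
    ultimately show "f \<in> (\<lambda>h r. if r \<in> A then h r else g r) ` (\<Pi>\<^sub>E r\<in>A. B r)" by blast
  qed
  show "finite ((\<lambda>h r. if r \<in> A then h r else g r) ` (\<Pi>\<^sub>E r\<in>A. B r))"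
    using assms by (intro finite_imageI finite_PiE) auto
qed

definition bern_word :: "nat list \<Rightarrow> nsym" where
  "bern_word xs = foldr (\<lambda>a. bern (int a)) xs 1"

lemma bern_word_Nil [simp]: "bern_word [] = 1"
  and bern_word_Cons [simp]: "bern_word (x # xs) = bern (int x) (bern_word xs)"
  by (simp_all add: bern_word_def)

context
  fixes \<mu> :: "nat \<Rightarrow> nat" and n :: nat
begin

text \<open>If \<gamma> b \<le> \<mu> b, these are the contents reached from \<gamma> by a weakly
  increasing row that uses up the letter b; the inequalities are the Yamanouchi condition for such a
  row.\<close>

definition box :: "nat \<Rightarrow> (nat \<Rightarrow> nat) \<Rightarrow> (nat \<Rightarrow> nat) set" where
  "box b \<gamma> = {\<delta>. \<delta> b = \<mu> b \<and> (\<forall>r\<in>{b<..n}. \<gamma> r \<le> \<delta> r \<and> \<delta> r \<le> \<gamma> (r - 1)) \<and>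
      (\<forall>r. r \<notin> {b..n} \<longrightarrow> \<delta> r = \<gamma> r)}"

text \<open>Horizontal strips of size j within the rows b to n; the first entry is bounded above
  only through the size. The guard \<open>b \<le> n\<close> is for b = n + 1, where just \<gamma>
  itself remains, with j = 0.\<close>

definition strips :: "nat \<Rightarrow> (nat \<Rightarrow> nat) \<Rightarrow> nat \<Rightarrow> (nat \<Rightarrow> nat) set" where
  "strips b \<gamma> j = {\<delta>. (b \<le> n \<longrightarrow> \<gamma> b \<le> \<delta> b) \<and> (\<forall>r\<in>{b<..n}. \<gamma> r \<le> \<delta> r \<and> \<delta> r \<le> \<gamma> (r - 1)) \<and>
      (\<forall>r. r \<notin> {b..n} \<longrightarrow> \<delta> r = \<gamma> r) \<and> sum \<delta> {b..n} = sum \<gamma> {b..n} + j}"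

text \<open>
  \<open>skewimm b \<gamma>\<close> is \<open>s\<^sub>\<gamma>\<^sup>\<bottom>\<close> applied to the immaculate function of \<open>(\<mu>\<^sub>b, \<dots>, \<mu>\<^sub>n)\<close>, with \<open>\<gamma>\<close> read as the
  partition \<open>(\<gamma>\<^sub>b, \<dots>, \<gamma>\<^sub>n)\<close>. The recursion is \<open>s\<^sub>\<gamma>\<^sup>\<bottom> B\<^sub>m = \<Sum>\<^sub>\<kappa> B\<^bsub>m-|\<gamma>/\<kappa>|\<^esub> s\<^sub>\<kappa>\<^sup>\<bottom>\<close>, summed over the \<open>\<kappa>\<close>
  such that \<open>\<gamma>/\<kappa>\<close> is a horizontal strip; \<open>\<delta>\<close> is \<open>\<kappa>\<close> with \<open>\<mu>\<^sub>b\<close> put in front.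
\<close>

function skewimm :: "nat \<Rightarrow> (nat \<Rightarrow> nat) \<Rightarrow> nsym" where
  "skewimm b \<gamma> = (if n < b then 1 else
    \<Sum>\<delta>\<in>box b \<gamma>. bern (int (sum \<delta> {b..n}) - int (sum \<gamma> {b..n})) (skewimm (Suc b) \<delta>))"
  by auto
termination by (relation "measure (\<lambda>(b, _). Suc n - b)") auto

declare skewimm.simps [simp del]

lemma skewimm_base: "n < b \<Longrightarrow> skewimm b \<gamma> = 1"
  by (simp add: skewimm.simps)

lemma skewimm_step: "b \<le> n \<Longrightarrow> skewimm b \<gamma> =
    (\<Sum>\<delta>\<in>box b \<gamma>. bern (int (sum \<delta> {b..n}) - int (sum \<gamma> {b..n})) (skewimm (Suc b) \<delta>))"
  by (simp add: skewimm.simps[of b])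

lemma finite_box: "b \<le> n \<Longrightarrow> finite (box b \<gamma>)"
  by (rule finite_subset[OF _ finite_functions_box
      [of "{b..n}" "\<lambda>r. if r = b then {\<mu> b} else {..\<gamma> (r - 1)}" \<gamma>]])
    (auto simp: box_def)

lemma finite_strips: "finite (strips b \<gamma> j)"
proof (rule finite_subset[OF _ finite_functions_box[of "{b..n}" "\<lambda>r. {..sum \<gamma> {b..n} + j}" \<gamma>]])
  show "strips b \<gamma> j \<subseteq> {f. (\<forall>r\<in>{b..n}. f r \<in> {..sum \<gamma> {b..n} + j}) \<and> (\<forall>r. r \<notin> {b..n} \<longrightarrow> f r = \<gamma> r)}"
  proof (clarsimp simp: strips_def)
    fix \<delta> r assume "sum \<delta> {b..n} = sum \<gamma> {b..n} + j" "b \<le> r" "r \<le> n"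
    then show "\<delta> r \<le> sum \<gamma> {b..n} + j"
      using member_le_sum[of r "{b..n}" \<delta>] by simp
  qed
qed auto

text \<open>The lower end of the interval at r and the upper end of the interval at r + 1 are the
  maximum and the minimum of the same pair, so together they contribute \<gamma> r + \<epsilon> (r +
  1).\<close>

lemma sum_max_min:
  fixes \<gamma> \<epsilon> :: "nat \<Rightarrow> nat"
  assumes "b \<le> m"
  shows "(\<Sum>r\<in>{b<..m}. max (\<gamma> r) (\<epsilon> (Suc r)) + min (\<gamma> (r - 1)) (\<epsilon> r)) +
      max (\<gamma> b) (\<epsilon> (Suc b)) + min (\<gamma> m) (\<epsilon> (Suc m)) =
    sum \<gamma> {b..m} + sum \<epsilon> {b<..m} + \<epsilon> (Suc m)"
  using assms
proof (induction m rule: nat_induct_at_least)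
  case base
  then show ?case by (simp add: max_def min_def)
next
  case (Suc m)
  have *: "{b<..Suc m} = insert (Suc m) {b<..m}" "{b..Suc m} = insert (Suc m) {b..m}"
    using Suc.hyps by auto
  have "max x y + min x y = x + y" for x y :: nat
    by simp
  note this[of "\<gamma> (Suc m)" "\<epsilon> (Suc (Suc m))"]
  then show ?case using Suc.IH by (simp add: *)
qed

text \<open>Reflecting the middle term of a pair of strips: \<open>\<delta> r\<close> and \<open>\<delta>' r\<close> run over the same interval
  \<open>[max (\<gamma> r) (\<epsilon> (r + 1)), min (\<gamma> (r - 1)) (\<epsilon> r)]\<close>.\<close>

lemma hperp_skewimm:
  assumes "\<And>r. n < r \<Longrightarrow> \<gamma> r = 0" and "b \<le> Suc n"
  shows "hperp j (skewimm b \<gamma>) = (\<Sum>\<delta>\<in>strips b \<gamma> j. skewimm b \<delta>)"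
  using assms(2,1)
proof (induction b arbitrary: \<gamma> j rule: inc_induct)
  case base
  have "strips (Suc n) \<gamma> j = (if j = 0 then {\<gamma>} else {})"
    by (auto simp: strips_def)
  then show ?case by (simp add: skewimm_base skewop_one)
next
  case (step b)
  let ?A = "{b<..n}"
  let ?lo = "\<lambda>\<epsilon> r. max (\<gamma> r) (\<epsilon> (Suc r))" and ?hi = "\<lambda>\<epsilon> r. min (\<gamma> (r - 1)) (\<epsilon> r)"
  let ?lh = "\<lambda>\<epsilon> r. ?lo \<epsilon> r + ?hi \<epsilon> r"
  have bn: "b \<le> n" and ins: "{b..n} = insert b ?A" using step.hyps by auto
  have ins': "{Suc b..n} = ?A" by auto
  \<comment> \<open>After expansion, the summands on both sides depend only on the last term
    \<epsilon>. What has to be matched, for fixed \<epsilon>, are the possible middle terms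
    \<delta>.\<close>
  let ?f = "\<lambda>\<epsilon>. bern (int (sum \<epsilon> {b..n}) - int (sum \<gamma> {b..n}) - int j) (skewimm (Suc b) \<epsilon>)"
  let ?P = "SIGMA \<delta>:box b \<gamma>. SIGMA k:{..j}. strips (Suc b) \<delta> (j - k)"
  let ?Q = "SIGMA \<delta>:strips b \<gamma> j. box b \<delta>"
  have "hperp j (skewimm b \<gamma>) =
     (\<Sum>\<delta>\<in>box b \<gamma>. \<Sum>k\<le>j. \<Sum>\<epsilon>\<in>strips (Suc b) \<delta> (j - k). ?f \<epsilon>)"
    unfolding skewimm_step[OF bn] nlin_sum[OF nlin_skewop]
  proof (rule sum.cong[OF refl])
    fix \<delta> assume \<delta>: "\<delta> \<in> box b \<gamma>"
    then have "hperp i (skewimm (Suc b) \<delta>) = (\<Sum>\<epsilon>\<in>strips (Suc b) \<delta> i. skewimm (Suc b) \<epsilon>)" for i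
      by (intro step.IH) (use step.prems bn in \<open>auto simp: box_def\<close>)
    then have "hperp j (bern (int (sum \<delta> {b..n}) - int (sum \<gamma> {b..n})) (skewimm (Suc b) \<delta>)) =
       (\<Sum>k\<le>j. \<Sum>\<epsilon>\<in>strips (Suc b) \<delta> (j - k). bern (int (sum \<delta> {b..n}) - int (sum \<gamma> {b..n}) - int k) (skewimm (Suc b) \<epsilon>))"
      by (simp add: hperp_bern nlin_sum[OF nlin_bern])
    also have "\<dots> = (\<Sum>k\<le>j. \<Sum>\<epsilon>\<in>strips (Suc b) \<delta> (j - k). ?f \<epsilon>)"
    proof (intro sum.cong refl)
      fix k \<epsilon> assume "k \<in> {..j}" "\<epsilon> \<in> strips (Suc b) \<delta> (j - k)"
      then have "int (sum \<delta> {b..n}) - int (sum \<gamma> {b..n}) - int k =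
          int (sum \<epsilon> {b..n}) - int (sum \<gamma> {b..n}) - int j"
        by (auto simp: strips_def ins ins')
      then show "bern (int (sum \<delta> {b..n}) - int (sum \<gamma> {b..n}) - int k) (skewimm (Suc b) \<epsilon>) = ?f \<epsilon>"
        by (simp only:)
    qed
    finally show "hperp j (bern (int (sum \<delta> {b..n}) - int (sum \<gamma> {b..n})) (skewimm (Suc b) \<delta>)) = \<dots>" .
  qed
  also have "\<dots> = (\<Sum>(\<delta>, k, \<epsilon>)\<in>?P. ?f \<epsilon>)"
    by (simp add: sum.Sigma finite_box[OF bn] finite_strips)
  also have "\<dots> = (\<Sum>(\<delta>, \<epsilon>)\<in>?Q. ?f \<epsilon>)"
  proof -
    \<comment> \<open>Reflects the entries after b and puts x at b. The 0 in
      \<open>rf \<epsilon> \<delta> 0\<close> is a dummy, since the sums formed from it run over the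
      entries after b.\<close>
    define rf where "rf \<epsilon> \<delta> x = (\<lambda>r. if r \<in> ?A then ?lh \<epsilon> r - \<delta> r else if r = b then x else \<gamma> r)"
      for \<epsilon> \<delta> :: "nat \<Rightarrow> nat" and x
    \<comment> \<open>The prescribed size of the strip forces the new entry at b. By
      \<open>tot\<close> it equals max (\<gamma> b) (\<epsilon> (Suc b)) + k, so k survives as the
      excess over the least admissible value.\<close>
    define up where
      "up = (\<lambda>(\<delta>, k :: nat, \<epsilon>). (rf \<epsilon> \<delta> (sum \<gamma> {b..n} + j - sum (rf \<epsilon> \<delta> 0) ?A), \<epsilon>))"
    \<comment> \<open>Here k is recovered from the size condition
      \<open>sum \<epsilon> ?A = sum \<delta> ?A + (j - k)\<close> for the reflected
      \<delta>.\<close>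
    define down where
      "down = (\<lambda>(\<delta>, \<epsilon>). (rf \<epsilon> \<delta> (\<mu> b), j - (sum \<epsilon> ?A - sum (rf \<epsilon> \<delta> 0) ?A), \<epsilon>))"
    \<comment> \<open>Both interlacing conditions together confine each \<delta> r to one interval.
      At r = n its lower end involves \<epsilon> (Suc n), which is 0 because \<epsilon> agrees with
      \<gamma> outside \<open>{b..n}\<close>.\<close>
    have P: "(\<delta>, k, \<epsilon>) \<in> ?P \<longleftrightarrow> \<delta> b = \<mu> b \<and> \<epsilon> b = \<mu> b \<and> k \<le> j \<and> (\<forall>r\<in>?A. ?lo \<epsilon> r \<le> \<delta> r \<and> \<delta> r \<le> ?hi \<epsilon> r) \<and>
       (\<forall>r. r \<notin> {b..n} \<longrightarrow> \<delta> r = \<gamma> r \<and> \<epsilon> r = \<gamma> r) \<and> sum \<epsilon> ?A = sum \<delta> ?A + (j - k)" for \<delta> k \<epsilon>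
    proof -
      have "(\<forall>r\<in>{Suc b<..n}. \<delta> r \<le> \<epsilon> r \<and> \<epsilon> r \<le> \<delta> (r - 1)) \<and> (Suc b \<le> n \<longrightarrow> \<delta> (Suc b) \<le> \<epsilon> (Suc b)) \<longleftrightarrow>
        (\<forall>r\<in>?A. \<delta> r \<le> \<epsilon> r \<and> \<epsilon> (Suc r) \<le> \<delta> r)" (is "?l \<longleftrightarrow> ?r") if 0: "\<epsilon> (Suc n) = 0"
      proof
        assume l: ?l
        show ?r
        proof
          fix r assume r: "r \<in> ?A"
          have "\<delta> r \<le> \<epsilon> r" using l r by (cases "r = Suc b") auto
          moreover have "\<epsilon> (Suc r) \<le> \<delta> r"
            using l[THEN conjunct1, rule_format, of "Suc r"] r 0 by (cases "r = n") auto
          ultimately show "\<delta> r \<le> \<epsilon> r \<and> \<epsilon> (Suc r) \<le> \<delta> r" ..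
        qed
      next
        assume r: ?r
        show ?l
        proof (intro conjI ballI impI)
          fix s assume "s \<in> {Suc b<..n}"
          then have "s \<in> ?A" "s - 1 \<in> ?A" "Suc (s - 1) = s" by auto
          then show "\<delta> s \<le> \<epsilon> s" "\<epsilon> s \<le> \<delta> (s - 1)"
            using r by metis+
        qed (use r in auto)
      qed
      note eq = this
      have m: "r \<notin> ?A \<longleftrightarrow> r = b \<or> r \<notin> {b..n}" for r
        using bn by auto
      have out: "(\<forall>r. r = b \<or> r \<notin> {b..n} \<longrightarrow> \<epsilon> r = \<delta> r) \<and> (\<forall>r. r \<notin> {b..n} \<longrightarrow> \<delta> r = \<gamma> r) \<longleftrightarrow>
         \<epsilon> b = \<delta> b \<and> (\<forall>r. r \<notin> {b..n} \<longrightarrow> \<delta> r = \<gamma> r \<and> \<epsilon> r = \<gamma> r)"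
        by metis
      show ?thesis
      proof (cases "\<epsilon> (Suc n) = 0")
        case True
        then show ?thesis
          using eq[OF True] out
          unfolding mem_Sigma_iff box_def strips_def mem_Collect_eq ins' m max.bounded_iff min.bounded_iff atMost_iff ball_conj_distrib
          by argo
      next
        case False
        then show ?thesis
          using step.prems[of "Suc n"] bn by (force simp: box_def strips_def)
      qed
    qed
    have Q: "(\<delta>, \<epsilon>) \<in> ?Q \<longleftrightarrow> \<gamma> b \<le> \<delta> b \<and> \<epsilon> (Suc b) \<le> \<delta> b \<and> \<epsilon> b = \<mu> b \<and>
      (\<forall>r\<in>?A. ?lo \<epsilon> r \<le> \<delta> r \<and> \<delta> r \<le> ?hi \<epsilon> r) \<and> (\<forall>r. r \<notin> {b..n} \<longrightarrow> \<delta> r = \<gamma> r \<and> \<epsilon> r = \<gamma> r) \<and>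
       sum \<delta> {b..n} = sum \<gamma> {b..n} + j" for \<delta> \<epsilon>
    proof -
      have "(\<forall>r\<in>?A. \<delta> r \<le> \<epsilon> r \<and> \<epsilon> r \<le> \<delta> (r - 1)) \<longleftrightarrow>
        \<epsilon> (Suc b) \<le> \<delta> b \<and> (\<forall>r\<in>?A. \<delta> r \<le> \<epsilon> r \<and> \<epsilon> (Suc r) \<le> \<delta> r)" (is "?l \<longleftrightarrow> ?r") if 0: "\<epsilon> (Suc n) = 0"
      proof
        assume l: ?l
        show ?r
        proof (intro conjI ballI)
          show "\<epsilon> (Suc b) \<le> \<delta> b" using l[rule_format, of "Suc b"] 0 bn by (cases "b = n") auto
          fix r assume r: "r \<in> ?A"
          show "\<delta> r \<le> \<epsilon> r" using l r by auto
          show "\<epsilon> (Suc r) \<le> \<delta> r"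
            using l[rule_format, of "Suc r"] r 0 by (cases "r = n") auto
        qed
      next
        assume r: ?r
        show ?l
        proof (intro conjI ballI impI)
          fix s assume s: "s \<in> ?A"
          then show "\<delta> s \<le> \<epsilon> s" using r by blast
          show "\<epsilon> s \<le> \<delta> (s - 1)"
          proof (cases "s = Suc b")
            case False
            then have "s - 1 \<in> ?A" "Suc (s - 1) = s" using s by auto
            then show ?thesis using r by metis
          qed (use r in simp)
        qed
      qed
      then show ?thesis
        using step.prems[of "Suc n"] bn by (auto simp: box_def strips_def)
    qed
    have tot: "(\<Sum>r\<in>?A. ?lh \<epsilon> r) + max (\<gamma> b) (\<epsilon> (Suc b)) = sum \<gamma> {b..n} + sum \<epsilon> ?A"
      if "\<epsilon> (Suc n) = 0" for \<epsilon>
      using sum_max_min[OF bn, of \<gamma> \<epsilon>] that by simp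
    have \<epsilon>0: "\<epsilon> (Suc n) = 0" if "\<forall>r. r \<notin> {b..n} \<longrightarrow> \<delta> r = \<gamma> r \<and> \<epsilon> r = \<gamma> r" for \<delta> \<epsilon> :: "nat \<Rightarrow> nat"
      using that step.prems[of "Suc n"] by simp
    define mid where "mid \<epsilon> \<delta> \<longleftrightarrow> (\<forall>r\<in>?A. ?lo \<epsilon> r \<le> \<delta> r \<and> \<delta> r \<le> ?hi \<epsilon> r)"
      for \<epsilon> \<delta> :: "nat \<Rightarrow> nat"
    have le_lh: "\<delta> r \<le> ?lh \<epsilon> r" if "mid \<epsilon> \<delta>" "r \<in> ?A" for \<epsilon> \<delta> r
      using that unfolding mid_def by (blast intro: trans_le_add2)
    have rf_b: "rf \<epsilon> \<delta> x b = x" for \<epsilon> \<delta> x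
      by (simp add: rf_def)
    have rf_out: "r \<notin> {b..n} \<Longrightarrow> rf \<epsilon> \<delta> x r = \<gamma> r" for \<epsilon> \<delta> x r
      using bn by (auto simp: rf_def)
    have rf_sum: "sum (rf \<epsilon> \<delta> x) ?A + sum \<delta> ?A = (\<Sum>r\<in>?A. ?lh \<epsilon> r)" if "mid \<epsilon> \<delta>" for \<epsilon> \<delta> x
      unfolding sum.distrib[symmetric]
      by (rule sum.cong[OF refl]) (use le_lh[OF that] in \<open>simp add: rf_def\<close>)
    have rf_mid: "mid \<epsilon> (rf \<epsilon> \<delta> x)" if "mid \<epsilon> \<delta>" for \<epsilon> \<delta> x
      unfolding mid_def
    proof
      fix r assume r: "r \<in> ?A"
      with that have "?lo \<epsilon> r \<le> \<delta> r \<and> \<delta> r \<le> ?hi \<epsilon> r" unfolding mid_def by blast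
      then have "?lo \<epsilon> r \<le> ?lh \<epsilon> r - \<delta> r \<and> ?lh \<epsilon> r - \<delta> r \<le> ?hi \<epsilon> r" by linarith
      then show "?lo \<epsilon> r \<le> rf \<epsilon> \<delta> x r \<and> rf \<epsilon> \<delta> x r \<le> ?hi \<epsilon> r"
        using r by (simp only: rf_def if_True)
    qed
    have rf_rf: "rf \<epsilon> (rf \<epsilon> \<delta> x) y = \<delta>"
      if "mid \<epsilon> \<delta>" "\<delta> b = y" "\<And>r. r \<notin> {b..n} \<Longrightarrow> \<delta> r = \<gamma> r" for \<epsilon> \<delta> x y
    proof
      fix r
      consider "r \<in> ?A" | "r = b" | "r \<notin> {b..n}" using bn by force
      then show "rf \<epsilon> (rf \<epsilon> \<delta> x) y r = \<delta> r"
      proof cases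
        case 1
        then show ?thesis using le_lh[OF that(1) 1] by (simp only: rf_def if_True diff_diff_cancel)
      qed (use that rf_b rf_out in auto)
    qed
    have rf_sum_cong: "sum (rf \<epsilon> \<delta> x) ?A = sum (rf \<epsilon> \<delta> 0) ?A" for \<epsilon> \<delta> x
      by (rule sum.cong) (auto simp: rf_def)
    note P = P[folded mid_def] and Q = Q[folded mid_def]
    have up: "down (up (\<delta>, k, \<epsilon>)) = (\<delta>, k, \<epsilon>)" "up (\<delta>, k, \<epsilon>) \<in> ?Q" if "(\<delta>, k, \<epsilon>) \<in> ?P" for \<delta> k \<epsilon>
    proof -
      note p = that[unfolded P]
      have m: "mid \<epsilon> \<delta>" and e0: "\<epsilon> (Suc n) = 0" using p \<epsilon>0 by blast+
      let ?x = "sum \<gamma> {b..n} + j - sum (rf \<epsilon> \<delta> 0) ?A"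
      have "sum \<epsilon> ?A = sum \<delta> ?A + (j - k)" using p by blast
      then have "sum (rf \<epsilon> \<delta> 0) ?A + max (\<gamma> b) (\<epsilon> (Suc b)) = sum \<gamma> {b..n} + (j - k)"
        using rf_sum[OF m, of 0] tot[where \<epsilon> = \<epsilon>, OF e0] by linarith
      then have le: "sum (rf \<epsilon> \<delta> 0) ?A + max (\<gamma> b) (\<epsilon> (Suc b)) \<le> sum \<gamma> {b..n} + j" by linarith
      have rfi: "rf \<epsilon> (rf \<epsilon> \<delta> x) (\<mu> b) = \<delta>" for x
        by (rule rf_rf[OF m]) (use p in auto)
      have "sum (rf \<epsilon> (rf \<epsilon> \<delta> x) 0) ?A = sum \<delta> ?A" for x
        unfolding rf_sum_cong[of \<epsilon> "rf \<epsilon> \<delta> x" "\<mu> b", symmetric] rfi ..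
      then show "down (up (\<delta>, k, \<epsilon>)) = (\<delta>, k, \<epsilon>)"
        using p by (simp add: up_def down_def rfi)
      show "up (\<delta>, k, \<epsilon>) \<in> ?Q"
      proof -
        have "\<gamma> b \<le> ?x" "\<epsilon> (Suc b) \<le> ?x" using le by linarith+
        moreover have "sum (rf \<epsilon> \<delta> x) {b..n} = x + sum (rf \<epsilon> \<delta> 0) ?A" for x
          unfolding ins using rf_sum_cong[of \<epsilon> \<delta> x] by (simp add: rf_b)
        from this[of ?x] have "sum (rf \<epsilon> \<delta> ?x) {b..n} = sum \<gamma> {b..n} + j" using le by linarith
        ultimately show ?thesis
          using p rf_mid[OF m] by (simp add: up_def Q rf_b rf_out del: mem_Sigma_iff)
      qed
    qed
    have down: "up (down (\<delta>, \<epsilon>)) = (\<delta>, \<epsilon>)" "down (\<delta>, \<epsilon>) \<in> ?P" if "(\<delta>, \<epsilon>) \<in> ?Q" for \<delta> \<epsilon>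
    proof -
      note q = that[unfolded Q]
      have m: "mid \<epsilon> \<delta>" and e0: "\<epsilon> (Suc n) = 0" and q0: "\<gamma> b \<le> \<delta> b" "\<epsilon> (Suc b) \<le> \<delta> b"
        using q \<epsilon>0 by blast+
      have le1: "sum (rf \<epsilon> \<delta> 0) ?A \<le> sum \<epsilon> ?A"
        by (rule sum_mono) (use rf_mid[OF m, of 0] in \<open>auto simp: mid_def\<close>)
      have sb: "\<delta> b + sum \<delta> ?A = sum \<gamma> {b..n} + j" using q by (simp add: ins)
      have le2: "sum \<epsilon> ?A \<le> sum (rf \<epsilon> \<delta> 0) ?A + j"
        using rf_sum[OF m, of 0] tot[where \<epsilon> = \<epsilon>, OF e0] sb q0 by linarith
      have rfi: "rf \<epsilon> (rf \<epsilon> \<delta> x) (\<delta> b) = \<delta>" for x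
        by (rule rf_rf[OF m]) (use q in auto)
      have "sum (rf \<epsilon> (rf \<epsilon> \<delta> x) 0) ?A = sum \<delta> ?A" for x
        unfolding rf_sum_cong[of \<epsilon> "rf \<epsilon> \<delta> x" "\<delta> b", symmetric] rfi ..
      moreover have "sum \<gamma> {b..n} + j - sum \<delta> ?A = \<delta> b" using sb by linarith
      ultimately show "up (down (\<delta>, \<epsilon>)) = (\<delta>, \<epsilon>)"
        by (simp add: up_def down_def rfi)
      show "down (\<delta>, \<epsilon>) \<in> ?P"
        using q rf_mid[OF m] le1 le2
        by (simp add: down_def P rf_b rf_out rf_sum_cong[of _ _ "\<mu> b"] del: mem_Sigma_iff)
    qed
    show ?thesis
    proof (rule sum.reindex_bij_witness[of _ down up])
      fix a assume "a \<in> ?P"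
      then show "down (up a) = a" "up a \<in> ?Q"
        using up by (cases a; blast)+
      show "(case up a of (\<delta>, \<epsilon>) \<Rightarrow> ?f \<epsilon>) = (case a of (\<delta>, k, \<epsilon>) \<Rightarrow> ?f \<epsilon>)"
        by (simp add: up_def split: prod.split)
    next
      fix a assume "a \<in> ?Q"
      then show "up (down a) = a" "down a \<in> ?P"
        using down by (cases a; blast)+
    qed
  qed
  also have "\<dots> = (\<Sum>\<delta>\<in>strips b \<gamma> j. \<Sum>\<epsilon>\<in>box b \<delta>. ?f \<epsilon>)"
    by (simp add: sum.Sigma finite_box[OF bn] finite_strips)
  also have "\<dots> = (\<Sum>\<delta>\<in>strips b \<gamma> j. skewimm b \<delta>)"
    by (rule sum.cong[OF refl]) (auto simp: skewimm_step[OF bn] strips_def algebra_simps intro!: sum.cong)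
  finally show ?case .
qed

text \<open>Interlacing with zeros leaves a single \<delta>, whose only new entry \<mu> b lies below
  the range of the next step; the recursion becomes plain iteration of \<open>bern\<close>.\<close>

lemma skewimm_zero:
  "(\<And>r. b \<le> r \<Longrightarrow> \<gamma> r = 0) \<Longrightarrow> skewimm b \<gamma> = bern_word (map \<mu> [b..<Suc n])"
proof (induction b \<gamma> rule: skewimm.induct)
  case (1 b \<gamma>)
  show ?case
  proof (cases "n < b")
    case True
    then show ?thesis by (simp add: skewimm_base)
  next
    case False
    then have ins: "{b..n} = insert b {b<..n}" by auto
    let ?\<delta> = "\<gamma>(b := \<mu> b)"
    have "\<delta> = ?\<delta>" if "\<delta> \<in> box b \<gamma>" for \<delta>
    proof
      fix r
      show "\<delta> r = ?\<delta> r"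
      proof (cases "r \<in> {b<..n}")
        case True
        then have "\<delta> r \<le> \<gamma> (r - 1)" "b \<le> r - 1" "b \<le> r" "r \<noteq> b"
          using that by (auto simp: box_def)
        then show ?thesis using 1(2)[of r] 1(2)[of "r - 1"] by simp
      qed (use that in \<open>auto simp: box_def\<close>)
    qed
    moreover have "?\<delta> \<in> box b \<gamma>"
      using 1(2) False by (auto simp: box_def)
    ultimately have box: "box b \<gamma> = {?\<delta>}" by blast
    have sums: "sum ?\<delta> {b..n} = \<mu> b" "sum \<gamma> {b..n} = 0"
      using 1(2) False by (simp_all add: ins)
    have "skewimm (Suc b) ?\<delta> = bern_word (map \<mu> [Suc b..<Suc n])"
      by (rule 1(1)[OF False]) (use 1(2) box in auto)
    moreover have "skewimm b \<gamma> = bern (int (\<mu> b)) (skewimm (Suc b) ?\<delta>)"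
      using False sums by (simp add: skewimm_step box)
    moreover have "[b..<Suc n] = b # [Suc b..<Suc n]"
      using False by (intro upt_conv_Cons) simp
    ultimately show ?thesis
      by (simp del: upt_Suc)
  qed
qed

section \<open>Vanishing and removal of exhausted letters when \<mu> is a partition\<close>

context
  assumes mono: "\<And>r s. 1 \<le> r \<Longrightarrow> r \<le> s \<Longrightarrow> \<mu> s \<le> \<mu> r"
begin

text \<open>\<open>Hgen_mult_bern\<close> and the Pieri rule expand the right side over strips,
  whereas \<open>box\<close> also requires \<epsilon> (Suc b) \<le> \<gamma> b. A surplus term has
  \<epsilon> (Suc b) > \<gamma> b \<ge> \<mu> b \<ge> \<mu> (Suc b) and vanishes by
  \<open>van\<close>. This is a hypothesis because the vanishing is itself proved from the present
  lemma, by induction.\<close>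

lemma skewimm_first_full_aux:
  assumes \<gamma>: "\<And>r. n < r \<Longrightarrow> \<gamma> r = 0" and b: "1 \<le> b" "b \<le> n" and ge: "\<mu> b \<le> \<gamma> b"
    and van: "\<And>\<epsilon>. (\<And>r. n < r \<Longrightarrow> \<epsilon> r = 0) \<Longrightarrow> Suc b \<le> n \<Longrightarrow> \<mu> (Suc b) < \<epsilon> (Suc b) \<Longrightarrow>
      skewimm (Suc b) \<epsilon> = 0"
  shows "skewimm b \<gamma> = Hgen (int (\<mu> b) - int (\<gamma> b)) * skewimm (Suc b) (\<gamma>(b := \<mu> b))"
proof -
  let ?\<gamma> = "\<gamma>(b := \<mu> b)" and ?c = "int (\<mu> b) - int (\<gamma> b)" and ?A = "{b<..n}"
  have A: "{Suc b..n} = ?A" and ins: "{b..n} = insert b ?A" using b by auto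
  have s\<gamma>: "sum ?\<gamma> ?A = sum \<gamma> ?A" by (rule sum.cong) auto
  obtain N where N: "deg_le N (skewimm (Suc b) ?\<gamma>)" using deg_le_exists by metis
  \<comment> \<open>Covers the degree needed by \<open>Hgen_mult_bern\<close> and also every strip
    size that occurs in \<open>box b \<gamma>\<close>.\<close>
  let ?N = "N + (\<Sum>r\<in>?A. \<gamma> (r - 1))"
  let ?f = "\<lambda>\<epsilon>. bern (int (sum \<epsilon> {b..n}) - int (sum \<gamma> {b..n})) (skewimm (Suc b) \<epsilon>)"
  have "deg_le ?N (skewimm (Suc b) ?\<gamma>)"
    using N by (rule deg_le_mono) simp
  then have "Hgen ?c * skewimm (Suc b) ?\<gamma> = (\<Sum>i\<le>?N. bern (?c + int i) (hperp i (skewimm (Suc b) ?\<gamma>)))"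
    by (rule Hgen_mult_bern)
  also have "\<dots> = (\<Sum>i\<le>?N. \<Sum>\<epsilon>\<in>strips (Suc b) ?\<gamma> i. ?f \<epsilon>)"
  proof (rule sum.cong[OF refl])
    fix i
    have "hperp i (skewimm (Suc b) ?\<gamma>) = (\<Sum>\<epsilon>\<in>strips (Suc b) ?\<gamma> i. skewimm (Suc b) \<epsilon>)"
      by (rule hperp_skewimm) (use \<gamma> b in auto)
    then have "bern (?c + int i) (hperp i (skewimm (Suc b) ?\<gamma>)) =
      (\<Sum>\<epsilon>\<in>strips (Suc b) ?\<gamma> i. bern (?c + int i) (skewimm (Suc b) \<epsilon>))"
      by (simp add: nlin_sum[OF nlin_bern])
    also have "\<dots> = (\<Sum>\<epsilon>\<in>strips (Suc b) ?\<gamma> i. ?f \<epsilon>)"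
    proof (rule sum.cong[OF refl])
      fix \<epsilon> assume "\<epsilon> \<in> strips (Suc b) ?\<gamma> i"
      then have "\<epsilon> b = \<mu> b" "sum \<epsilon> ?A = sum \<gamma> ?A + i"
        by (simp_all add: strips_def A s\<gamma>)
      then have "?c + int i = int (sum \<epsilon> {b..n}) - int (sum \<gamma> {b..n})"
        by (simp add: ins)
      then show "bern (?c + int i) (skewimm (Suc b) \<epsilon>) = ?f \<epsilon>"
        by (simp only:)
    qed
    finally show "bern (?c + int i) (hperp i (skewimm (Suc b) ?\<gamma>)) = \<dots>" .
  qed
  also have "\<dots> = (\<Sum>\<epsilon>\<in>(\<Union>i\<le>?N. strips (Suc b) ?\<gamma> i). ?f \<epsilon>)"
    by (rule sum.UNION_disjoint[symmetric]) (auto simp: finite_strips, auto simp: strips_def)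
  also have "\<dots> = (\<Sum>\<epsilon>\<in>box b \<gamma>. ?f \<epsilon>)"
  proof (rule sum.mono_neutral_right)
    show "finite (\<Union>i\<le>?N. strips (Suc b) ?\<gamma> i)" by (simp add: finite_strips)
    show "box b \<gamma> \<subseteq> (\<Union>i\<le>?N. strips (Suc b) ?\<gamma> i)"
    proof
      fix \<epsilon> assume e: "\<epsilon> \<in> box b \<gamma>"
      have le1: "sum \<gamma> ?A \<le> sum \<epsilon> ?A" using e by (intro sum_mono) (auto simp: box_def)
      have le2: "sum \<epsilon> ?A \<le> (\<Sum>r\<in>?A. \<gamma> (r - 1))" using e by (intro sum_mono) (auto simp: box_def)
      have "\<epsilon> \<in> strips (Suc b) ?\<gamma> (sum \<epsilon> ?A - sum \<gamma> ?A)"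
        using e le1 by (auto simp: box_def strips_def A s\<gamma>)
      then show "\<epsilon> \<in> (\<Union>i\<le>?N. strips (Suc b) ?\<gamma> i)"
        using le2 by force
    qed
    show "\<forall>\<epsilon>\<in>(\<Union>i\<le>?N. strips (Suc b) ?\<gamma> i) - box b \<gamma>. ?f \<epsilon> = 0"
    proof
      fix \<epsilon> assume "\<epsilon> \<in> (\<Union>i\<le>?N. strips (Suc b) ?\<gamma> i) - box b \<gamma>"
      then obtain i where e: "\<epsilon> \<in> strips (Suc b) ?\<gamma> i" "\<epsilon> \<notin> box b \<gamma>" by auto
      have lo: "\<gamma> r \<le> \<epsilon> r" if "r \<in> ?A" for r
        using e(1) that by (cases "r = Suc b") (auto simp: strips_def)
      have hi: "\<epsilon> r \<le> \<gamma> (r - 1)" if "r \<in> ?A" "r \<noteq> Suc b" for r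
      proof -
        have "r - 1 \<noteq> b" "r \<in> {Suc b<..n}" using that by auto
        moreover from this have "\<epsilon> r \<le> ?\<gamma> (r - 1)" using e(1) unfolding strips_def by blast
        ultimately show ?thesis by simp
      qed
      have out: "\<epsilon> b = \<mu> b" "\<forall>r. r \<notin> {b..n} \<longrightarrow> \<epsilon> r = \<gamma> r"
        using e(1) b by (auto simp: strips_def)
      have "\<not> (Suc b \<le> n \<longrightarrow> \<epsilon> (Suc b) \<le> \<gamma> b)"
      proof
        assume *: "Suc b \<le> n \<longrightarrow> \<epsilon> (Suc b) \<le> \<gamma> b"
        have "\<epsilon> r \<le> \<gamma> (r - 1)" if "r \<in> ?A" for r
          using hi[OF that] * that by (cases "r = Suc b") auto
        then show False using e(2) lo out by (simp add: box_def)
      qed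
      then have "Suc b \<le> n" "\<gamma> b < \<epsilon> (Suc b)" by auto
      then have "skewimm (Suc b) \<epsilon> = 0"
        using ge mono[of b "Suc b"] b e(1) \<gamma> by (intro van) (auto simp: strips_def)
      then show "?f \<epsilon> = 0" by (simp add: nlin_0[OF nlin_bern])
    qed
  qed
  finally show ?thesis
    using b by (simp add: skewimm_step)
qed

text \<open>Skewing by \<gamma> kills the immaculate function of a partition that does not contain
  \<gamma>. If the row sticking out is the first one, a factor H with negative index appears;
  otherwise each member of \<open>box\<close> is at least as long in that row, and the induction
  applies.\<close>

lemma skewimm_eq_0:
  assumes "1 \<le> b" "b \<le> r" "r \<le> n" "\<mu> r < \<gamma> r" "\<And>r. n < r \<Longrightarrow> \<gamma> r = 0"
  shows "skewimm b \<gamma> = 0"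
proof -
  have "b \<le> Suc n" using assms by simp
  then show ?thesis using assms
  proof (induction b arbitrary: \<gamma> r rule: inc_induct)
    case base
    then show ?case by simp
  next
    case (step b)
    show ?case
    proof (cases "r = b")
      case True
      have "skewimm b \<gamma> = Hgen (int (\<mu> b) - int (\<gamma> b)) * skewimm (Suc b) (\<gamma>(b := \<mu> b))"
      proof (rule skewimm_first_full_aux)
        fix \<epsilon> assume "Suc b \<le> n" "\<mu> (Suc b) < \<epsilon> (Suc b)" "\<And>r. n < r \<Longrightarrow> \<epsilon> r = 0"
        then show "skewimm (Suc b) \<epsilon> = 0" by (intro step.IH[of "Suc b"]) auto
      qed (use step.prems step.hyps True in auto)
      moreover have "\<mu> b < \<gamma> b" using step.prems(4) True by simp
      ultimately show ?thesis by (simp add: Hgen_neg)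
    next
      case False
      have "skewimm (Suc b) \<delta> = 0" if "\<delta> \<in> box b \<gamma>" for \<delta>
      proof (rule step.IH)
        have "\<forall>r\<in>{b<..n}. \<gamma> r \<le> \<delta> r" "\<forall>r. r \<notin> {b..n} \<longrightarrow> \<delta> r = \<gamma> r"
          using that by (simp_all add: box_def)
        moreover have "r \<in> {b<..n}" using step.prems(2,3) False by simp
        ultimately have "\<gamma> r \<le> \<delta> r" and out: "\<And>r. r \<notin> {b..n} \<Longrightarrow> \<delta> r = \<gamma> r" by blast+
        then show "\<mu> r < \<delta> r" using order_less_le_trans[OF step.prems(4)] by blast
        show "\<delta> s = 0" if "n < s" for s
          using out[of s] step.prems(5)[OF that] that by simp
      qed (use step.prems(2,3) False in simp_all)
      moreover have "b \<le> n" using step.prems(2,3) by simp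
      ultimately show ?thesis
        by (simp add: skewimm_step nlin_0[OF nlin_bern])
    qed
  qed
qed

text \<open>An exhausted letter can be discarded, as the factor H has index 0. The counterpart for
  tableaux is \<open>straight_tableaux_full\<close>.\<close>

lemma skewimm_first_full:
  assumes "\<And>r. n < r \<Longrightarrow> \<gamma> r = 0" "1 \<le> b" "b \<le> n" "\<gamma> b = \<mu> b"
  shows "skewimm b \<gamma> = skewimm (Suc b) \<gamma>"
proof -
  have "skewimm b \<gamma> = Hgen (int (\<mu> b) - int (\<gamma> b)) * skewimm (Suc b) (\<gamma>(b := \<mu> b))"
    by (rule skewimm_first_full_aux) (use assms skewimm_eq_0[of "Suc b" "Suc b"] in auto)
  moreover have "\<gamma>(b := \<mu> b) = \<gamma>"
    using assms(4) by auto
  ultimately show ?thesis using assms(4) by simp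
qed

end

end

section \<open>Expansion into tableaux given by their rows\<close>

definition add_content :: "(nat \<Rightarrow> nat) \<Rightarrow> nat list \<Rightarrow> nat \<Rightarrow> nat" where
  "add_content \<gamma> w = (\<lambda>i. \<gamma> i + count_list w i)"

text \<open>The empty prefix counts, so \<gamma> itself must be weakly decreasing from b on. The
  parameter b allows comparisons with smaller, already exhausted letters to be dropped.\<close>

definition yam_from :: "nat \<Rightarrow> (nat \<Rightarrow> nat) \<Rightarrow> nat list \<Rightarrow> bool" where
  "yam_from b \<gamma> w \<longleftrightarrow> (\<forall>u v. w = u @ v \<longrightarrow>
    (\<forall>i\<ge>b. add_content \<gamma> u (Suc i) \<le> add_content \<gamma> u i))"

definition reading :: "nat list list \<Rightarrow> nat list" where
  "reading R = concat (map rev R)"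

lemma reading_Nil [simp]: "reading [] = []"
  and reading_Cons [simp]: "reading (r # R) = rev r @ reading R"
  by (simp_all add: reading_def)

lemma set_reading: "set (reading R) = (\<Union>r\<in>set R. set r)"
  by (simp add: reading_def)

lemma add_content_Nil [simp]: "add_content \<gamma> [] = \<gamma>"
  by (simp add: add_content_def)

lemma add_content_append: "add_content \<gamma> (u @ v) = add_content (add_content \<gamma> u) v"
  by (auto simp: add_content_def)

lemma count_list_rev [simp]: "count_list (rev w) i = count_list w i"
  by (induction w) auto

lemma add_content_rev [simp]: "add_content \<gamma> (rev w) = add_content \<gamma> w"
  by (simp add: add_content_def)

lemma yam_from_append:
  "yam_from b \<gamma> (u @ v) \<longleftrightarrow> yam_from b \<gamma> u \<and> yam_from b (add_content \<gamma> u) v"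
proof
  assume l: "yam_from b \<gamma> (u @ v)"
  show "yam_from b \<gamma> u \<and> yam_from b (add_content \<gamma> u) v"
  proof
    show "yam_from b \<gamma> u"
      unfolding yam_from_def
    proof (intro allI impI)
      fix x y i assume "u = x @ y" "b \<le> i"
      then show "add_content \<gamma> x (Suc i) \<le> add_content \<gamma> x i"
        using l[unfolded yam_from_def, rule_format, of x "y @ v" i] by simp
    qed
    show "yam_from b (add_content \<gamma> u) v"
      unfolding yam_from_def
    proof (intro allI impI)
      fix x y i assume "v = x @ y" "b \<le> i"
      then show "add_content (add_content \<gamma> u) x (Suc i) \<le> add_content (add_content \<gamma> u) x i"
        using l[unfolded yam_from_def, rule_format, of "u @ x" y i] by (simp add: add_content_append)
    qed
  qed
next
  assume r: "yam_from b \<gamma> u \<and> yam_from b (add_content \<gamma> u) v"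
  show "yam_from b \<gamma> (u @ v)"
    unfolding yam_from_def
  proof (intro allI impI)
    fix x y i assume eq: "u @ v = x @ y" and i: "b \<le> i"
    from eq obtain z where "u = x @ z \<or> x = u @ z \<and> v = z @ y"
      unfolding append_eq_append_conv2 by blast
    then show "add_content \<gamma> x (Suc i) \<le> add_content \<gamma> x i"
      using r i unfolding yam_from_def by (auto simp: add_content_append)
  qed
qed

lemma yam_from_Nil: "yam_from b \<gamma> [] \<longleftrightarrow> (\<forall>i\<ge>b. \<gamma> (Suc i) \<le> \<gamma> i)"
  by (simp add: yam_from_def)

lemma yam_from_decreasing: "yam_from b \<gamma> w \<Longrightarrow> b \<le> i \<Longrightarrow> \<gamma> (Suc i) \<le> \<gamma> i"
  using yam_from_append[of b \<gamma> "[]" w] by (simp add: yam_from_Nil)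

lemma count_list_filter: "count_list (filter P w) i = (if P i then count_list w i else 0)"
  by (induction w) auto

lemma sorted_filter_split:
  "sorted r \<Longrightarrow> r = filter (\<lambda>x. x \<le> i) r @ filter (\<lambda>x. \<not> x \<le> i) (r :: nat list)"
proof (induction r)
  case (Cons a r)
  show ?case
  proof (cases "a \<le> i")
    case False
    then have "filter (\<lambda>x. x \<le> i) r = []" "filter (\<lambda>x. \<not> x \<le> i) r = r"
      using Cons.prems by (auto simp: filter_empty_conv filter_id_conv)
    then show ?thesis using False by simp
  qed (use Cons in auto)
qed simp

text \<open>A weakly increasing row is read in decreasing order, so letters \<open>i + 1\<close> come before letters \<open>i\<close>.\<close>

lemma yam_from_row:
  assumes "sorted r"
  shows "yam_from b \<gamma> (rev r) \<longleftrightarrow> (\<forall>i\<ge>b. \<gamma> (Suc i) \<le> \<gamma> i \<and> add_content \<gamma> r (Suc i) \<le> \<gamma> i)"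
proof (intro iffI allI impI conjI)
  fix i assume y: "yam_from b \<gamma> (rev r)" and i: "b \<le> i"
  show "\<gamma> (Suc i) \<le> \<gamma> i" using yam_from_decreasing[OF y i] .
  let ?u = "rev (filter (\<lambda>x. \<not> x \<le> i) r)"
  have "rev r = ?u @ rev (filter (\<lambda>x. x \<le> i) r)"
    unfolding rev_append[symmetric] using sorted_filter_split[OF assms] by simp
  then have "add_content \<gamma> ?u (Suc i) \<le> add_content \<gamma> ?u i"
    using y i unfolding yam_from_def by blast
  then show "add_content \<gamma> r (Suc i) \<le> \<gamma> i"
    unfolding add_content_def count_list_rev count_list_filter by simp
next
  assume r: "\<forall>i\<ge>b. \<gamma> (Suc i) \<le> \<gamma> i \<and> add_content \<gamma> r (Suc i) \<le> \<gamma> i"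
  show "yam_from b \<gamma> (rev r)"
    unfolding yam_from_def
  proof (intro allI impI)
    fix u v i assume "rev r = u @ v" "b \<le> i"
    then have "count_list r (Suc i) = count_list u (Suc i) + count_list v (Suc i)"
      by (metis count_list_append count_list_rev)
    then show "add_content \<gamma> u (Suc i) \<le> add_content \<gamma> u i"
      using r[rule_format, OF \<open>b \<le> i\<close>] by (auto simp: add_content_def)
  qed
qed

lemma sorted_eqI_count_list:
  assumes "sorted r" "sorted s" "\<And>i. count_list r i = count_list s i"
  shows "r = (s :: nat list)"
proof -
  have "mset r = mset s" by (rule multiset_eqI) (simp add: count_mset assms)
  then show ?thesis using assms(1,2) by (metis properties_for_sort)
qed

lemma ex_sorted_count_list:
  assumes "finite {i. f i \<noteq> 0}"
  shows "\<exists>r :: nat list. sorted r \<and> (\<forall>i. count_list r i = f i)"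
proof -
  have "count (Abs_multiset f) = f"
    using assms by (intro count_Abs_multiset) simp
  then have "sorted (sorted_list_of_multiset (Abs_multiset f)) \<and>
      (\<forall>i. count_list (sorted_list_of_multiset (Abs_multiset f)) i = f i)"
    by (simp add: count_mset[symmetric])
  then show ?thesis by blast
qed

lemma add_content_pos_iff: "i \<in> set w \<longleftrightarrow> \<gamma> i < add_content \<gamma> w i"
  using count_list_0_iff[of w i] by (auto simp: add_content_def)

section \<open>Tableaux as lists of rows, and the expansion indexed by them\<close>

fun outer_shape :: "nat list \<Rightarrow> nat list list \<Rightarrow> nat list" where
  "outer_shape (a # as) (r # R) = (a + length r) # outer_shape as R"
| "outer_shape as R = map length R"

context
  fixes \<mu> :: "nat \<Rightarrow> nat" and n :: nat
begin

text \<open>Fillings of the rows below \<alpha>, where \<gamma> is the content of all rows above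
  them and b the smallest letter still in play.\<close>

definition straight_tableaux :: "nat \<Rightarrow> (nat \<Rightarrow> nat) \<Rightarrow> nat list list set" where
  "straight_tableaux b \<gamma> = {R. (\<forall>r\<in>set R. r \<noteq> [] \<and> sorted r \<and> (\<forall>x\<in>set r. b \<le> x)) \<and>
     sorted_wrt (<) (map hd R) \<and> yam_from b \<gamma> (reading R) \<and>
     (\<forall>i\<ge>b. add_content \<gamma> (reading R) i = \<mu> i)}"

text \<open>A row that extends a row of \<alpha> may be empty and has no cell in the first column;
  the strictness condition is therefore left to the rows below.\<close>

fun skew_tableau :: "nat list \<Rightarrow> (nat \<Rightarrow> nat) \<Rightarrow> nat list list \<Rightarrow> bool" where
  "skew_tableau [] \<gamma> R \<longleftrightarrow> R \<in> straight_tableaux 1 \<gamma>"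
| "skew_tableau (a # as) \<gamma> [] \<longleftrightarrow> False"
| "skew_tableau (a # as) \<gamma> (r # R) \<longleftrightarrow> sorted r \<and> 0 \<notin> set r \<and> yam_from 1 \<gamma> (rev r) \<and>
    skew_tableau as (add_content \<gamma> r) R"

lemma skew_tableau_content:
  "skew_tableau as \<gamma> R \<Longrightarrow> 1 \<le> i \<Longrightarrow> add_content \<gamma> (reading R) i = \<mu> i"
  by (induction as \<gamma> R rule: skew_tableau.induct)
    (auto simp: straight_tableaux_def add_content_append)

context
  assumes mono: "\<And>r s. 1 \<le> r \<Longrightarrow> r \<le> s \<Longrightarrow> \<mu> s \<le> \<mu> r"
    and supp: "\<And>r. n < r \<Longrightarrow> \<mu> r = 0"
begin

lemma straight_tableaux_base:
  assumes "\<And>r. n < r \<Longrightarrow> \<gamma> r = 0"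
  shows "straight_tableaux (Suc n) \<gamma> = {[]}"
proof (rule equalityI; rule subsetI)
  fix R assume R: "R \<in> straight_tableaux (Suc n) \<gamma>"
  have "set (reading R) = {}"
  proof (rule ccontr)
    assume "set (reading R) \<noteq> {}"
    then obtain x where x: "x \<in> set (reading R)" by (metis ex_in_conv)
    then obtain r where "r \<in> set R" "x \<in> set r" by (auto simp: set_reading)
    then have "Suc n \<le> x" using R unfolding straight_tableaux_def by blast
    then have "n < x" by simp
    then have "add_content \<gamma> (reading R) x = 0" using R supp by (simp add: straight_tableaux_def)
    then show False using x add_content_pos_iff[of x "reading R" \<gamma>] by simp
  qed
  moreover have "\<forall>r\<in>set R. r \<noteq> []" using R by (simp add: straight_tableaux_def)
  ultimately show "R \<in> {[]}" by (cases R) (auto simp: set_reading)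
qed (use assms supp in \<open>auto simp: straight_tableaux_def yam_from_Nil\<close>)

text \<open>No copy of b remains to be placed. In the converse direction the comparison of b + 1
  with b holds for every prefix, since b + 1 never occurs more than \<mu> (Suc b) \<le> \<mu> b =
  \<gamma> b times.\<close>

lemma straight_tableaux_full:
  assumes "\<gamma> b = \<mu> b" "1 \<le> b" "\<gamma> (Suc b) \<le> \<gamma> b"
  shows "straight_tableaux b \<gamma> = straight_tableaux (Suc b) \<gamma>"
proof (rule equalityI; rule subsetI)
  fix R assume R: "R \<in> straight_tableaux b \<gamma>"
  then have "add_content \<gamma> (reading R) b = \<gamma> b" using assms by (simp add: straight_tableaux_def)
  then have "b \<notin> set (reading R)" by (simp add: add_content_pos_iff[of _ _ \<gamma>])
  then have "\<forall>r\<in>set R. \<forall>x\<in>set r. Suc b \<le> x"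
    using R by (force simp: straight_tableaux_def set_reading le_less)
  then show "R \<in> straight_tableaux (Suc b) \<gamma>"
    using R by (auto simp: straight_tableaux_def yam_from_def)
next
  fix R assume R: "R \<in> straight_tableaux (Suc b) \<gamma>"
  have ge: "Suc b \<le> x" if "x \<in> set (reading R)" for x
    using R that by (auto simp: straight_tableaux_def set_reading)
  then have nb: "b \<notin> set (reading R)" by (metis not_less_eq_eq order_refl)
  have "yam_from b \<gamma> (reading R)"
    unfolding yam_from_def
  proof (intro allI impI)
    fix u v i assume uv: "reading R = u @ v" and i: "b \<le> i"
    show "add_content \<gamma> u (Suc i) \<le> add_content \<gamma> u i"
    proof (cases "i = b")
      case True
      have "add_content \<gamma> u (Suc b) \<le> add_content \<gamma> (reading R) (Suc b)"
        by (simp add: uv add_content_def)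
      also have "\<dots> = \<mu> (Suc b)" using R by (simp add: straight_tableaux_def)
      also have "\<dots> \<le> \<gamma> b" using mono[of b "Suc b"] assms by simp
      finally show ?thesis using True by (simp add: add_content_def)
    next
      case False
      then show ?thesis using R i uv by (auto simp: straight_tableaux_def yam_from_def)
    qed
  qed
  moreover have "add_content \<gamma> (reading R) i = \<mu> i" if "b \<le> i" for i
  proof (cases "i = b")
    case True
    then show ?thesis using nb assms by (simp add: add_content_def)
  qed (use R that in \<open>simp add: straight_tableaux_def\<close>)
  moreover have "\<forall>r\<in>set R. r \<noteq> [] \<and> sorted r \<and> (\<forall>x\<in>set r. b \<le> x)"
    using R by (force simp: straight_tableaux_def)
  ultimately show "R \<in> straight_tableaux b \<gamma>"
    using R by (simp add: straight_tableaux_def)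
qed

lemma length_eq_sum_diff:
  assumes "\<And>x. x \<in> set r \<Longrightarrow> x \<in> A" "finite A"
  shows "sum (add_content \<gamma> r) A = sum \<gamma> A + length r"
  using sum_count_set[of r A] assms by (auto simp: add_content_def sum.distrib)

text \<open>Some b remains to be placed. Every letter in a lower row exceeds the head of the first
  row, so this head is b and all copies of b lie in the first row. Its content \<delta> thus reaches
  \<mu> b at b, and \<open>yam_from_row\<close> supplies the interlacing. Conversely, being weakly
  increasing, the row is determined by the differences \<delta> i - \<gamma> i.\<close>

lemma straight_tableaux_bij:
  assumes \<gamma>0: "\<And>r. n < r \<Longrightarrow> \<gamma> r = 0" and b: "1 \<le> b" "b \<le> n" and lt: "\<gamma> b < \<mu> b"
    and dec: "\<And>i. b \<le> i \<Longrightarrow> \<gamma> (Suc i) \<le> \<gamma> i"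
  shows "bij_betw (\<lambda>R. (add_content \<gamma> (hd R), tl R)) (straight_tableaux b \<gamma>)
    (SIGMA \<delta>:box \<mu> n b \<gamma>. straight_tableaux (Suc b) \<delta>)" (is "bij_betw ?f ?T ?S")
    and "\<And>R. R \<in> straight_tableaux b \<gamma> \<Longrightarrow>
      R \<noteq> [] \<and> sum (add_content \<gamma> (hd R)) {b..n} = sum \<gamma> {b..n} + length (hd R)"
proof -
  have \<delta>0: "\<delta> r = 0" if "\<delta> \<in> box \<mu> n b \<gamma>" "n < r" for \<delta> r
    using that \<gamma>0 by (auto simp: box_def)
  have dest: "\<exists>r R'. R = r # R' \<and> sorted r \<and> (\<forall>x\<in>set r. b \<le> x \<and> x \<le> n) \<and> add_content \<gamma> r \<in> box \<mu> n b \<gamma> \<and>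
      R' \<in> straight_tableaux (Suc b) (add_content \<gamma> r)" if R: "R \<in> ?T" for R
  proof -
    have b_in: "b \<in> set (reading R)"
      using R lt by (simp add: straight_tableaux_def add_content_pos_iff[of _ _ \<gamma>])
    then obtain r R' where Rr: "R = r # R'" by (cases R) auto
    have r: "r \<noteq> []" "sorted r" "\<forall>x\<in>set r. b \<le> x"
      and R': "\<forall>r'\<in>set R'. hd r < hd r' \<and> r' \<noteq> [] \<and> sorted r'" "sorted_wrt (<) (map hd R')"
      using R by (auto simp: straight_tableaux_def Rr)
    have hd_le: "hd s \<le> x" if "x \<in> set s" "sorted s" for x and s :: "nat list"
      using that by (cases s) auto
    have ge: "hd r < x" if "r' \<in> set R'" "x \<in> set r'" for r' x
      using R'(1) hd_le[of x r'] that by (meson order_less_le_trans)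
    have "hd r = b"
    proof (rule ccontr)
      assume "hd r \<noteq> b"
      then have "b < hd r" using r by (metis hd_in_set le_neq_implies_less)
      then show False
        using b_in ge hd_le[OF _ r(2), of b] unfolding Rr by (fastforce simp: set_reading)
    qed
    let ?\<delta> = "add_content \<gamma> r"
    have ge': "Suc b \<le> x" if "r' \<in> set R'" "x \<in> set r'" for r' x
      using ge[OF that] \<open>hd r = b\<close> by simp
    then have nb: "b \<notin> set (reading R')"
      by (fastforce simp: set_reading)
    have yr: "yam_from b \<gamma> (rev r)" and yR: "yam_from b ?\<delta> (reading R')"
      using R by (auto simp: straight_tableaux_def Rr yam_from_append)
    have tot: "add_content ?\<delta> (reading R') i = \<mu> i" if "b \<le> i" for i
      using R that by (auto simp: straight_tableaux_def Rr add_content_append)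
    have \<delta>b: "?\<delta> b = \<mu> b"
      using tot[of b] nb by (simp add: add_content_def)
    have ri: "x \<le> n" if "x \<in> set r" for x
    proof (rule ccontr)
      assume "\<not> x \<le> n"
      then have "add_content ?\<delta> (reading R') x = 0" using tot[of x] supp b by simp
      then show False using that add_content_pos_iff[of x r \<gamma>] by (simp add: add_content_def)
    qed
    have out: "?\<delta> i = \<gamma> i" if "i \<notin> {b..n}" for i
      using that r(3) ri by (auto simp: add_content_def count_list_0_iff)
    have step: "\<gamma> i \<le> ?\<delta> i \<and> ?\<delta> i \<le> \<gamma> (i - 1)" if "i \<in> {b<..n}" for i
    proof -
      have "Suc (i - 1) = i" "b \<le> i - 1" using that by auto
      then have "?\<delta> i \<le> \<gamma> (i - 1)"
        using yr[unfolded yam_from_row[OF r(2)], rule_format, of "i - 1"] by simp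
      then show ?thesis by (simp add: add_content_def)
    qed
    have "?\<delta> \<in> box \<mu> n b \<gamma>"
      using \<delta>b out step by (simp add: box_def)
    moreover have "R' \<in> straight_tableaux (Suc b) ?\<delta>"
      using R' ge' yR tot by (auto simp: straight_tableaux_def yam_from_def)
    ultimately show ?thesis
      using r ri Rr by blast
  qed
  show "R \<noteq> [] \<and> sum (add_content \<gamma> (hd R)) {b..n} = sum \<gamma> {b..n} + length (hd R)" if "R \<in> ?T" for R
    using dest[OF that] length_eq_sum_diff[of "hd R" "{b..n}" \<gamma>] by auto
  show "bij_betw ?f ?T ?S"
    unfolding bij_betw_def
  proof
    show "inj_on ?f ?T"
    proof (rule inj_onI)
      fix R1 R2 assume 1: "R1 \<in> ?T" and 2: "R2 \<in> ?T" and eq: "?f R1 = ?f R2"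
      obtain r1 S1 where R1: "R1 = r1 # S1" "sorted r1" using dest[OF 1] by blast
      obtain r2 S2 where R2: "R2 = r2 # S2" "sorted r2" using dest[OF 2] by blast
      have "count_list r1 i = count_list r2 i" for i
        using eq R1 R2 by (simp add: add_content_def fun_eq_iff)
      then have "r1 = r2" using R1 R2 by (intro sorted_eqI_count_list)
      then show "R1 = R2" using eq R1 R2 by simp
    qed
    show "?f ` ?T = ?S"
    proof (rule equalityI; rule subsetI)
      fix x assume "x \<in> ?f ` ?T"
      then show "x \<in> ?S" using dest by fastforce
    next
      fix x assume "x \<in> ?S"
      then obtain \<delta> R' where x: "x = (\<delta>, R')" and \<delta>: "\<delta> \<in> box \<mu> n b \<gamma>" and R': "R' \<in> straight_tableaux (Suc b) \<delta>"
        by blast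
      have fin: "{i. \<delta> i - \<gamma> i \<noteq> 0} \<subseteq> {b..n}"
      proof
        fix i assume "i \<in> {i. \<delta> i - \<gamma> i \<noteq> 0}"
        moreover have "i \<notin> {b..n} \<Longrightarrow> \<delta> i = \<gamma> i" using \<delta> unfolding box_def by blast
        ultimately show "i \<in> {b..n}" by force
      qed
      then obtain r where r: "sorted r" "\<And>i. count_list r i = \<delta> i - \<gamma> i"
        using ex_sorted_count_list[of "\<lambda>i. \<delta> i - \<gamma> i"] finite_subset[OF fin] by auto
      have "\<gamma> i \<le> \<delta> i" for i
      proof -
        consider "i \<in> {b<..n}" | "i = b" | "i \<notin> {b..n}" using b by force
        then show ?thesis
        proof cases
          case 1
          then show ?thesis using \<delta> unfolding box_def by blast
        next
          case 2
          then show ?thesis using \<delta> lt by (simp add: box_def)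
        next
          case 3
          then show ?thesis using \<delta> unfolding box_def by simp
        qed
      qed
      then have \<delta>r: "add_content \<gamma> r = \<delta>" unfolding add_content_def r by simp
      have set_r: "b \<le> i" if "i \<in> set r" for i
      proof -
        have "\<delta> i - \<gamma> i \<noteq> 0" using that r(2)[of i] count_list_0_iff[of r i] by auto
        then show ?thesis using fin by auto
      qed
      have b_in: "b \<in> set r"
        unfolding add_content_pos_iff[of _ _ \<gamma>] \<delta>r using \<delta> lt by (simp add: box_def)
      then have "r \<noteq> []" by auto
      have hd: "hd r = b"
      proof (rule le_antisym)
        show "hd r \<le> b" using r(1) b_in by (cases r) auto
        show "b \<le> hd r" using set_r \<open>r \<noteq> []\<close> by simp
      qed
      have \<delta>b: "\<delta> b = \<mu> b" using \<delta> by (simp add: box_def)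
      have "\<delta> (Suc i) \<le> \<gamma> i" if "b \<le> i" for i
      proof (cases "Suc i \<le> n")
        case True
        then have "Suc i \<in> {b<..n}" using that by auto
        then have "\<delta> (Suc i) \<le> \<gamma> (Suc i - 1)" using \<delta> unfolding box_def by blast
        then show ?thesis by simp
      qed (simp add: \<delta>0[OF \<delta>])
      then have yr: "yam_from b \<gamma> (rev r)"
        using dec by (simp add: yam_from_row[OF r(1)] \<delta>r)
      have "\<delta> (Suc b) \<le> \<delta> b"
      proof -
        have "\<delta> (Suc b) \<le> add_content \<delta> (reading R') (Suc b)" by (simp add: add_content_def)
        also have "\<dots> = \<mu> (Suc b)" using R' by (simp add: straight_tableaux_def)
        also have "\<dots> \<le> \<delta> b" using mono[of b "Suc b"] b \<delta>b by simp
        finally show ?thesis .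
      qed
      \<comment> \<open>In \<delta> the letter b is exhausted, so passing from Suc b to b adds the
        missing Yamanouchi comparison of b + 1 with b.\<close>
      then have "R' \<in> straight_tableaux b \<delta>"
        using R' straight_tableaux_full[of \<delta> b, OF \<delta>b b(1)] by simp
      moreover have "b < hd r'" if "r' \<in> set R'" for r'
        using R' that by (auto simp: straight_tableaux_def Suc_le_eq)
      ultimately have "r # R' \<in> ?T"
        using r(1) set_r \<open>r \<noteq> []\<close> hd yr
        by (auto simp: straight_tableaux_def yam_from_append add_content_append \<delta>r)
      moreover have "?f (r # R') = x" by (simp add: x \<delta>r)
      ultimately show "x \<in> ?f ` ?T" by blast
    qed
  qed
qed

text \<open>Induction on the smallest letter. If \<gamma> b > \<mu> b, both sides are empty; if
  \<gamma> b = \<mu> b, the letter is discarded on both sides; otherwise the recursion of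
  \<open>skewimm\<close> is the choice of the first row.\<close>

lemma skewimm_straight:
  assumes "1 \<le> b" "b \<le> Suc n" "\<And>r. n < r \<Longrightarrow> \<gamma> r = 0" "\<And>i. b \<le> i \<Longrightarrow> \<gamma> (Suc i) \<le> \<gamma> i"
  shows "finite (straight_tableaux b \<gamma>) \<and>
    skewimm \<mu> n b \<gamma> = (\<Sum>R\<in>straight_tableaux b \<gamma>. bern_word (map length R))"
  using assms(2,1,3,4)
proof (induction b arbitrary: \<gamma> rule: inc_induct)
  case base
  then show ?case by (simp add: straight_tableaux_base skewimm_base)
next
  case (step b)
  have bn: "b \<le> n" using step.hyps by simp
  have dec: "\<gamma> (Suc i) \<le> \<gamma> i" if "b \<le> i" for i
    using step.prems(3) that .
  consider "\<mu> b < \<gamma> b" | "\<gamma> b = \<mu> b" | "\<gamma> b < \<mu> b" by linarith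
  then show ?case
  proof cases
    case 1
    have "\<gamma> b \<le> \<mu> b" if "R \<in> straight_tableaux b \<gamma>" for R
    proof -
      have "\<gamma> b \<le> add_content \<gamma> (reading R) b" by (simp add: add_content_def)
      then show ?thesis using that by (simp add: straight_tableaux_def)
    qed
    then have "straight_tableaux b \<gamma> = {}" using 1 by force
    moreover have "skewimm \<mu> n b \<gamma> = 0"
      by (rule skewimm_eq_0[of \<mu> b b]) (use mono step.prems bn 1 in auto)
    ultimately show ?thesis by simp
  next
    case 2
    have "skewimm \<mu> n b \<gamma> = skewimm \<mu> n (Suc b) \<gamma>"
      by (rule skewimm_first_full) (use mono step.prems bn 2 in auto)
    moreover have "straight_tableaux b \<gamma> = straight_tableaux (Suc b) \<gamma>"
      by (rule straight_tableaux_full[of \<gamma> b, OF 2 step.prems(1) dec]) simp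
    moreover have "finite (straight_tableaux (Suc b) \<gamma>) \<and>
      skewimm \<mu> n (Suc b) \<gamma> = (\<Sum>R\<in>straight_tableaux (Suc b) \<gamma>. bern_word (map length R))"
      by (rule step.IH) (use step.prems dec in auto)
    ultimately show ?thesis by simp
  next
    case 3
    let ?S = "SIGMA \<delta>:box \<mu> n b \<gamma>. straight_tableaux (Suc b) \<delta>"
    let ?l = "\<lambda>\<delta>. int (sum \<delta> {b..n}) - int (sum \<gamma> {b..n})"
    note bij = straight_tableaux_bij[OF step.prems(2) step.prems(1) bn 3 dec]
    have IH: "finite (straight_tableaux (Suc b) \<delta>) \<and>
      skewimm \<mu> n (Suc b) \<delta> = (\<Sum>R\<in>straight_tableaux (Suc b) \<delta>. bern_word (map length R))"
      if "\<delta> \<in> box \<mu> n b \<gamma>" for \<delta>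
    proof (rule step.IH)
      show z: "\<delta> r = 0" if "n < r" for r
        using \<open>\<delta> \<in> _\<close> step.prems(2)[OF that] that by (auto simp: box_def)
      show "\<delta> (Suc i) \<le> \<delta> i" if "Suc b \<le> i" for i
      proof (cases "Suc i \<le> n")
        case True
        then have "Suc i \<in> {b<..n}" "i \<in> {b<..n}" using that by auto
        then have "\<delta> (Suc i) \<le> \<gamma> (Suc i - 1)" "\<gamma> i \<le> \<delta> i"
          using \<open>\<delta> \<in> _\<close> unfolding box_def by blast+
        then show ?thesis by simp
      qed (simp add: z)
    qed simp
    have "finite ?S" by (rule finite_SigmaI) (use IH finite_box[OF bn] in auto)
    then have fin: "finite (straight_tableaux b \<gamma>)"
      using bij_betw_finite[OF bij(1)] by simp
    have "skewimm \<mu> n b \<gamma> = (\<Sum>\<delta>\<in>box \<mu> n b \<gamma>. \<Sum>R\<in>straight_tableaux (Suc b) \<delta>.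
        bern (?l \<delta>) (bern_word (map length R)))"
      unfolding skewimm_step[OF bn]
      by (rule sum.cong[OF refl]) (simp add: IH nlin_sum[OF nlin_bern])
    also have "\<dots> = (\<Sum>(\<delta>, R)\<in>?S. bern (?l \<delta>) (bern_word (map length R)))"
      by (rule sum.Sigma) (use IH finite_box[OF bn] in auto)
    also have "\<dots> = (\<Sum>R\<in>straight_tableaux b \<gamma>. bern (?l (add_content \<gamma> (hd R))) (bern_word (map length (tl R))))"
      by (subst sum.reindex_bij_betw[OF bij(1), symmetric]) simp_all
    also have "\<dots> = (\<Sum>R\<in>straight_tableaux b \<gamma>. bern_word (map length R))"
    proof (rule sum.cong[OF refl])
      fix R assume "R \<in> straight_tableaux b \<gamma>"
      from bij(2)[OF _ _ this] show "bern (?l (add_content \<gamma> (hd R))) (bern_word (map length (tl R))) = bern_word (map length R)"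
        by (cases R) auto
    qed
    finally show ?thesis using fin by blast
  qed
qed

text \<open>A row beside \<alpha> need not exhaust any letter, hence \<open>strips\<close> in place
  of \<open>box\<close>. The range of j may stop at N, as no row is longer than the total
  content.\<close>

lemma skew_tableau_bij:
  assumes \<gamma>0: "\<And>r. n < r \<Longrightarrow> \<gamma> r = 0" and dec: "\<And>i. 1 \<le> i \<Longrightarrow> \<gamma> (Suc i) \<le> \<gamma> i"
    and N: "sum \<mu> {1..n} \<le> N"
  shows "bij_betw (\<lambda>R. (length (hd R), add_content \<gamma> (hd R), tl R)) {R. skew_tableau (a # as) \<gamma> R}
    (SIGMA j:{..N}. SIGMA \<delta>:strips n 1 \<gamma> j. {R. skew_tableau as \<delta> R})" (is "bij_betw ?f ?T ?S")
proof -
  have dest: "\<exists>r R'. R = r # R' \<and> sorted r \<and> length r \<le> N \<and> add_content \<gamma> r \<in> strips n 1 \<gamma> (length r) \<and>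
      skew_tableau as (add_content \<gamma> r) R'" if R: "R \<in> ?T" for R
  proof -
    obtain r R' where Rr: "R = r # R'" using R by (cases R) auto
    have r: "sorted r" "0 \<notin> set r" "yam_from 1 \<gamma> (rev r)" and R': "skew_tableau as (add_content \<gamma> r) R'"
      using R by (auto simp: Rr)
    let ?\<delta> = "add_content \<gamma> r"
    have le: "?\<delta> i \<le> \<mu> i" if "1 \<le> i" for i
      using skew_tableau_content[OF R' that] by (simp add: add_content_def)
    have ri: "x \<in> {1..n}" if "x \<in> set r" for x
    proof (rule ccontr)
      assume "x \<notin> {1..n}"
      then have "1 \<le> x" "\<mu> x = 0" using r(2) that supp[of x] by (cases "x = 0"; auto)+
      then have "?\<delta> x = 0" using le[of x] by simp
      then show False using that add_content_pos_iff[of x r \<gamma>] by simp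
    qed
    have sum: "sum ?\<delta> {1..n} = sum \<gamma> {1..n} + length r"
      by (rule length_eq_sum_diff) (use ri in auto)
    moreover have "sum ?\<delta> {1..n} \<le> sum \<mu> {1..n}"
      by (rule sum_mono) (use le in auto)
    ultimately have "length r \<le> N" using N by simp
    moreover have "?\<delta> \<in> strips n 1 \<gamma> (length r)"
    proof -
      have "?\<delta> i \<le> \<gamma> (i - 1)" if "i \<in> {1<..n}" for i
      proof -
        have "1 \<le> i - 1" "Suc (i - 1) = i" using that by auto
        then show ?thesis
          using r(3)[unfolded yam_from_row[OF r(1)], rule_format, of "i - 1"] by metis
      qed
      moreover have "\<gamma> i \<le> ?\<delta> i" for i by (simp add: add_content_def)
      moreover have "?\<delta> i = \<gamma> i" if "i \<notin> {1..n}" for i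
        using that ri[of i] count_list_0_iff[of r i] by (auto simp: add_content_def)
      ultimately show ?thesis using sum by (simp add: strips_def)
    qed
    ultimately show ?thesis using Rr r R' by blast
  qed
  show "bij_betw ?f ?T ?S"
    unfolding bij_betw_def
  proof
    show "inj_on ?f ?T"
    proof (rule inj_onI)
      fix R1 R2 assume 1: "R1 \<in> ?T" and 2: "R2 \<in> ?T" and eq: "?f R1 = ?f R2"
      obtain r1 S1 where R1: "R1 = r1 # S1" "sorted r1" using dest[OF 1] by blast
      obtain r2 S2 where R2: "R2 = r2 # S2" "sorted r2" using dest[OF 2] by blast
      have "count_list r1 i = count_list r2 i" for i
        using eq R1 R2 by (simp add: add_content_def fun_eq_iff)
      then have "r1 = r2" using R1 R2 by (intro sorted_eqI_count_list)
      then show "R1 = R2" using eq R1 R2 by simp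
    qed
    show "?f ` ?T = ?S"
    proof (rule equalityI; rule subsetI)
      fix x assume "x \<in> ?f ` ?T"
      then show "x \<in> ?S" using dest by fastforce
    next
      fix x assume "x \<in> ?S"
      then obtain j \<delta> R' where x: "x = (j, \<delta>, R')" and \<delta>: "\<delta> \<in> strips n 1 \<gamma> j" and R': "skew_tableau as \<delta> R'"
        by blast
      have fin: "{i. \<delta> i - \<gamma> i \<noteq> 0} \<subseteq> {1..n}"
      proof
        fix i assume "i \<in> {i. \<delta> i - \<gamma> i \<noteq> 0}"
        moreover have "i \<notin> {1..n} \<Longrightarrow> \<delta> i = \<gamma> i" using \<delta> unfolding strips_def by blast
        ultimately show "i \<in> {1..n}" by force
      qed
      then obtain r where r: "sorted r" "\<And>i. count_list r i = \<delta> i - \<gamma> i"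
        using ex_sorted_count_list[of "\<lambda>i. \<delta> i - \<gamma> i"] finite_subset[OF fin] by auto
      have "\<gamma> i \<le> \<delta> i" for i
      proof -
        consider "i \<in> {1<..n}" | "i = 1" "1 \<le> n" | "i \<notin> {1..n}" by force
        then show ?thesis
        proof cases
          case 1
          then show ?thesis using \<delta> unfolding strips_def by blast
        next
          case 2
          then show ?thesis using \<delta> by (simp add: strips_def)
        next
          case 3
          then show ?thesis using \<delta> unfolding strips_def by simp
        qed
      qed
      then have \<delta>r: "add_content \<gamma> r = \<delta>" unfolding add_content_def r by simp
      have set_r: "i \<in> {1..n}" if "i \<in> set r" for i
      proof -
        have "\<delta> i - \<gamma> i \<noteq> 0" using that r(2)[of i] count_list_0_iff[of r i] by auto
        then show ?thesis using fin by blast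
      qed
      have "\<delta> (Suc i) \<le> \<gamma> i" if "1 \<le> i" for i
      proof (cases "Suc i \<le> n")
        case True
        then have "Suc i \<in> {1<..n}" using that by auto
        then have "\<delta> (Suc i) \<le> \<gamma> (Suc i - 1)" using \<delta> unfolding strips_def by blast
        then show ?thesis by simp
      next
        case False
        then have "\<delta> (Suc i) = \<gamma> (Suc i)" using \<delta> unfolding strips_def by simp
        then show ?thesis using \<gamma>0[of "Suc i"] False by simp
      qed
      then have yr: "yam_from 1 \<gamma> (rev r)"
        using dec by (simp add: yam_from_row[OF r(1)] \<delta>r)
      have "sum \<delta> {1..n} = sum \<gamma> {1..n} + length r"
        unfolding \<delta>r[symmetric] by (rule length_eq_sum_diff) (use set_r in auto)
      then have "length r = j" using \<delta> by (simp add: strips_def)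
      moreover have "r # R' \<in> ?T"
        using r(1) yr R' set_r by (fastforce simp: \<delta>r)
      ultimately have "x = ?f (r # R')" "r # R' \<in> ?T" by (simp_all add: x \<delta>r)
      then show "x \<in> ?f ` ?T" by blast
    qed
  qed
qed

theorem bern_word_mult_skewimm:
  assumes "\<And>r. n < r \<Longrightarrow> \<gamma> r = 0" "\<And>i. 1 \<le> i \<Longrightarrow> \<gamma> (Suc i) \<le> \<gamma> i"
  shows "finite {R. skew_tableau as \<gamma> R} \<and>
    bern_word as * skewimm \<mu> n 1 \<gamma> = (\<Sum>R | skew_tableau as \<gamma> R. bern_word (outer_shape as R))"
  using assms
proof (induction as arbitrary: \<gamma>)
  case Nil
  then show ?case using skewimm_straight[of 1 \<gamma>] by simp
next
  case (Cons a as)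
  obtain N0 where N0: "deg_le N0 (skewimm \<mu> n 1 \<gamma>)" using deg_le_exists by metis
  \<comment> \<open>One summand is the degree bound for \<open>bern_mult\<close>, the other the
    bound on row lengths for \<open>skew_tableau_bij\<close>.\<close>
  define N where "N = N0 + sum \<mu> {1..n}"
  have N: "deg_le N (skewimm \<mu> n 1 \<gamma>)"
    using N0 by (rule deg_le_mono) (simp add: N_def)
  let ?S = "SIGMA j:{..N}. SIGMA \<delta>:strips n 1 \<gamma> j. {R. skew_tableau as \<delta> R}"
  have bij: "bij_betw (\<lambda>R. (length (hd R), add_content \<gamma> (hd R), tl R)) {R. skew_tableau (a # as) \<gamma> R} ?S"
    by (rule skew_tableau_bij) (use Cons.prems in \<open>auto simp: N_def\<close>)
  have IH: "finite {R. skew_tableau as \<delta> R} \<and>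
    bern_word as * skewimm \<mu> n 1 \<delta> = (\<Sum>R | skew_tableau as \<delta> R. bern_word (outer_shape as R))"
    if \<delta>: "\<delta> \<in> strips n 1 \<gamma> j" for j \<delta>
  proof (rule Cons.IH)
    show z: "\<delta> r = 0" if "n < r" for r
      using \<delta> Cons.prems(1)[OF that] that by (auto simp: strips_def)
    show "\<delta> (Suc i) \<le> \<delta> i" if "1 \<le> i" for i
    proof (cases "Suc i \<le> n")
      case True
      then have "Suc i \<in> {1<..n}" using that by auto
      then have "\<delta> (Suc i) \<le> \<gamma> (Suc i - 1)" using \<delta> unfolding strips_def by blast
      moreover have "\<gamma> i \<le> \<delta> i"
        using \<delta> True that by (cases "i = 1") (auto simp: strips_def)
      ultimately show ?thesis by simp
    qed (simp add: z)
  qed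
  have inner: "finite (SIGMA \<delta>:strips n 1 \<gamma> j. {R. skew_tableau as \<delta> R})" for j
    by (rule finite_SigmaI[OF finite_strips]) (use IH in blast)
  have "finite ?S" by (rule finite_SigmaI[OF finite_atMost inner])
  then have fin: "finite {R. skew_tableau (a # as) \<gamma> R}"
    using bij_betw_finite[OF bij] by simp
  have "bern_word (a # as) * skewimm \<mu> n 1 \<gamma> =
     (\<Sum>j\<le>N. bern (int a + int j) (bern_word as * hperp j (skewimm \<mu> n 1 \<gamma>)))"
    unfolding bern_word_Cons by (rule bern_mult[OF N])
  also have "\<dots> = (\<Sum>j\<le>N. \<Sum>\<delta>\<in>strips n 1 \<gamma> j. \<Sum>R | skew_tableau as \<delta> R. bern_word ((a + j) # outer_shape as R))"
  proof (rule sum.cong[OF refl])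
    fix j
    have "hperp j (skewimm \<mu> n 1 \<gamma>) = (\<Sum>\<delta>\<in>strips n 1 \<gamma> j. skewimm \<mu> n 1 \<delta>)"
      by (rule hperp_skewimm) (use Cons.prems in auto)
    then have "bern (int a + int j) (bern_word as * hperp j (skewimm \<mu> n 1 \<gamma>)) =
      (\<Sum>\<delta>\<in>strips n 1 \<gamma> j. bern (int a + int j) (bern_word as * skewimm \<mu> n 1 \<delta>))"
      by (simp add: sum_distrib_left nlin_sum[OF nlin_bern])
    also have "\<dots> = (\<Sum>\<delta>\<in>strips n 1 \<gamma> j. \<Sum>R | skew_tableau as \<delta> R. bern_word ((a + j) # outer_shape as R))"
    proof (rule sum.cong[OF refl])
      fix \<delta> assume "\<delta> \<in> strips n 1 \<gamma> j"
      from conjunct2[OF IH[OF this]]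
      show "bern (int a + int j) (bern_word as * skewimm \<mu> n 1 \<delta>) =
          (\<Sum>R | skew_tableau as \<delta> R. bern_word ((a + j) # outer_shape as R))"
        by (simp only: nlin_sum[OF nlin_bern] bern_word_Cons of_nat_add)
    qed
    finally show "bern (int a + int j) (bern_word as * hperp j (skewimm \<mu> n 1 \<gamma>)) = \<dots>" .
  qed
  also have "\<dots> = (\<Sum>j\<le>N. \<Sum>(\<delta>, R)\<in>(SIGMA \<delta>:strips n 1 \<gamma> j. {R. skew_tableau as \<delta> R}). bern_word ((a + j) # outer_shape as R))"
    by (intro sum.cong[OF refl] sum.Sigma) (use IH finite_strips in auto)
  also have "\<dots> = (\<Sum>(j, \<delta>, R)\<in>?S. bern_word ((a + j) # outer_shape as R))"
    by (rule sum.Sigma) (rule finite_atMost, intro ballI inner)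
  also have "\<dots> = (\<Sum>R | skew_tableau (a # as) \<gamma> R. bern_word ((a + length (hd R)) # outer_shape as (tl R)))"
    by (subst sum.reindex_bij_betw[OF bij, symmetric]) simp
  also have "\<dots> = (\<Sum>R | skew_tableau (a # as) \<gamma> R. bern_word (outer_shape (a # as) R))"
  proof (rule sum.cong[OF refl])
    fix R assume "R \<in> {R. skew_tableau (a # as) \<gamma> R}"
    then show "bern_word ((a + length (hd R)) # outer_shape as (tl R)) = bern_word (outer_shape (a # as) R)"
      by (cases R) auto
  qed
  finally show ?case using fin by blast
qed

end

end

section \<open>The operators adjoint to multiplication by elementary functions\<close>

text \<open>The one composition \<alpha> for which the monomial m occurs in M_\<alpha>; a
  quasisymmetric series is a function of it, by \<open>qsym_of_coeffs_eq\<close>.\<close>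

definition exponent_comp :: "monomial \<Rightarrow> composition" where
  "exponent_comp m = Composition (map (Poly_Mapping.lookup m) (sorted_list_of_set (Poly_Mapping.keys m)))"

lemma parts_exponent_comp: "parts (exponent_comp m) = map (Poly_Mapping.lookup m) (sorted_list_of_set (Poly_Mapping.keys m))"
  unfolding exponent_comp_def by (rule parts_Composition) (auto simp: in_keys_iff)

definition monomial_of :: "nat list \<Rightarrow> nat list \<Rightarrow> monomial" where
  "monomial_of is vs = sum_list (map2 Poly_Mapping.single is vs)"

lemma monomial_of_Nil [simp]: "monomial_of [] vs = 0" and monomial_of_Nil2 [simp]: "monomial_of is [] = 0"
  and monomial_of_Cons [simp]: "monomial_of (i # is) (v # vs) = Poly_Mapping.single i v + monomial_of is vs"
  by (simp_all add: monomial_of_def)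

lemma keys_monomial_of_subset: "Poly_Mapping.keys (monomial_of is vs) \<subseteq> set is"
proof (induction "is" vs rule: list_induct2')
  case (4 i "is" v vs)
  then show ?case
    using Poly_Mapping.keys_add[of "Poly_Mapping.single i v" "monomial_of is vs"] by (auto split: if_splits)
qed auto

lemma lookup_monomial_of_eq_0: "i \<notin> set is \<Longrightarrow> Poly_Mapping.lookup (monomial_of is vs) i = 0"
  using keys_monomial_of_subset[of "is" vs] by (auto simp: in_keys_iff)

lemma map_lookup_monomial_of:
  "length is = length vs \<Longrightarrow> distinct is \<Longrightarrow> map (Poly_Mapping.lookup (monomial_of is vs)) is = vs"
proof (induction "is" vs rule: list_induct2)
  case (Cons i "is" v vs)
  have "map (Poly_Mapping.lookup (Poly_Mapping.single i v + monomial_of is vs)) is =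
      map (Poly_Mapping.lookup (monomial_of is vs)) is"
    by (rule map_cong[OF refl]) (use Cons.prems in \<open>auto simp: lookup_add lookup_single when_def\<close>)
  also have "\<dots> = vs" using Cons by simp
  finally show ?case
    using Cons.prems by (simp add: lookup_add[of _ _ i] lookup_monomial_of_eq_0)
qed simp

lemma keys_monomial_of:
  assumes "length is = length vs" "distinct is" "\<forall>v\<in>set vs. 0 < v"
  shows "Poly_Mapping.keys (monomial_of is vs) = set is"
proof
  show "set is \<subseteq> Poly_Mapping.keys (monomial_of is vs)"
  proof
    fix i assume "i \<in> set is"
    then have "Poly_Mapping.lookup (monomial_of is vs) i \<in> set vs"
      by (subst map_lookup_monomial_of[OF assms(1,2), symmetric]) simp
    then show "i \<in> Poly_Mapping.keys (monomial_of is vs)"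
      using assms(3) by (auto simp: in_keys_iff)
  qed
qed (rule keys_monomial_of_subset)

lemma monomial_of_lookup:
  assumes "distinct is" "Poly_Mapping.keys m = set is"
  shows "monomial_of is (map (Poly_Mapping.lookup m) is) = m"
proof (rule poly_mapping_eqI)
  fix i
  show "Poly_Mapping.lookup (monomial_of is (map (Poly_Mapping.lookup m) is)) i = Poly_Mapping.lookup m i"
  proof (cases "i \<in> set is")
    case True
    then show ?thesis
      using map_lookup_monomial_of[of "is" "map (Poly_Mapping.lookup m) is"] assms(1) by (auto simp: map_eq_conv)
  next
    case False
    then show ?thesis using assms(2) lookup_monomial_of_eq_0[of i "is"] by (metis in_keys_iff)
  qed
qed

lemma sorted_list_of_set_strict:
  "sorted_wrt (<) xs \<Longrightarrow> sorted_list_of_set (set xs) = (xs :: nat list)"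
  by (metis sorted_list_of_set.idem_if_sorted_distinct strict_sorted_iff)

text \<open>As parts are positive, the index sequence has to be the support of m in increasing
  order.\<close>

lemma Mqsym_eq: "Mqsym \<alpha> m = (if exponent_comp m = \<alpha> then 1 else 0)"
proof -
  let ?S = "{is. length is = num_parts \<alpha> \<and> sorted_wrt (<) is \<and> sum_list (map2 Poly_Mapping.single is (parts \<alpha>)) = m}"
  let ?k = "sorted_list_of_set (Poly_Mapping.keys m)"
  have 1: "is = ?k \<and> exponent_comp m = \<alpha>" if "is \<in> ?S" for "is"
  proof -
    have i: "length is = length (parts \<alpha>)" "sorted_wrt (<) is" "monomial_of is (parts \<alpha>) = m"
      using that by (simp_all add: num_parts_def monomial_of_def)
    then have d: "distinct is" by (simp add: strict_sorted_iff)
    have "Poly_Mapping.keys m = set is"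
      using keys_monomial_of[OF i(1) d] parts_pos by (auto simp: i(3))
    then have k: "?k = is" using i(2) by (simp add: sorted_list_of_set_strict)
    have "parts (exponent_comp m) = parts \<alpha>"
      using map_lookup_monomial_of[OF i(1) d] by (simp add: parts_exponent_comp k i(3))
    then show ?thesis using k by (simp add: parts_inject)
  qed
  have 2: "?k \<in> ?S" if "exponent_comp m = \<alpha>"
  proof -
    have "monomial_of ?k (parts \<alpha>) = m"
      unfolding that[symmetric] parts_exponent_comp by (rule monomial_of_lookup) auto
    moreover have "length ?k = length (parts \<alpha>)"
      unfolding that[symmetric] parts_exponent_comp by simp
    ultimately show ?thesis by (simp add: num_parts_def monomial_of_def[symmetric])
  qed
  have "?S = (if exponent_comp m = \<alpha> then {?k} else {})"
    using 1 2 by auto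
  then show ?thesis unfolding Mqsym_def by simp
qed

lemma qsym_of_coeffs_eq: "qsym_of_coeffs c m = Poly_Mapping.lookup c (exponent_comp m)"
proof -
  have "qsym_of_coeffs c m = (\<Sum>\<beta>\<in>Poly_Mapping.keys c. if \<beta> = exponent_comp m then Poly_Mapping.lookup c \<beta> else 0)"
    unfolding qsym_of_coeffs_def by (rule sum.cong) (auto simp: Mqsym_eq)
  then show ?thesis by (simp add: in_keys_iff)
qed

text \<open>Placing the parts on the first variables gives such a monomial. Hence a series
  determines its coefficients in the M basis.\<close>

lemma surj_exponent_comp: "\<exists>m. exponent_comp m = \<alpha>"
proof
  let ?is = "[0..<length (parts \<alpha>)]"
  have "Poly_Mapping.keys (monomial_of ?is (parts \<alpha>)) = set ?is"
    by (rule keys_monomial_of) (auto simp: parts_pos)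
  then have "parts (exponent_comp (monomial_of ?is (parts \<alpha>))) = parts \<alpha>"
    using map_lookup_monomial_of[of ?is "parts \<alpha>"] by (simp add: parts_exponent_comp)
  then show "exponent_comp (monomial_of ?is (parts \<alpha>)) = \<alpha>" by (simp add: parts_inject)
qed

lemma M_coeffs_qsym_of_coeffs: "M_coeffs (qsym_of_coeffs c) = c"
  unfolding M_coeffs_def
proof (rule the_equality)
  fix d assume "qsym_of_coeffs d = qsym_of_coeffs c"
  then show "d = c"
    by (intro poly_mapping_eqI) (metis surj_exponent_comp qsym_of_coeffs_eq)
qed simp

section \<open>The functions \<open>Fqsym (ones i)\<close> and multiplication by them\<close>

lemma sum_list_le_length_imp_ones:
  "\<forall>x\<in>set xs. 0 < (x::nat) \<Longrightarrow> sum_list xs \<le> length xs \<Longrightarrow> xs = replicate (length xs) 1"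
proof (induction xs)
  case (Cons x xs)
  have "length xs \<le> sum_list xs" using Cons.prems(1)
    by (induction xs) (auto simp: Suc_le_eq add_pos_nonneg intro: add_mono[of 1 _ _ _, simplified])
  with Cons show ?case by auto
qed simp

lemma parts_ones: "parts (ones i) = replicate i 1"
  unfolding ones_def by (rule parts_Composition) auto

text \<open>All of \<open>{1..<i}\<close> are descents of \<open>ones i\<close>, so \<beta> has at
  least i parts; being positive with sum i, they are all 1.\<close>

lemma comp_le_ones: "comp_le \<beta> (ones i) \<longleftrightarrow> \<beta> = ones i"
proof
  assume le: "comp_le \<beta> (ones i)"
  have w: "sum_list (parts \<beta>) = i"
    using le by (simp add: comp_le_def weight_def parts_ones sum_list_replicate)
  have "i \<le> length (parts \<beta>)"
  \<comment> \<open>Kept apart because for i = 1 the comparison of cardinalities below would also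
    admit a \<beta> without parts.\<close>
  proof (cases "i \<le> 1")
    case True
    then show ?thesis using w by (cases "parts \<beta>") auto
  next
    case False
    have "{1..<i} \<subseteq> descents (ones i)"
    proof
      fix k assume "k \<in> {1..<i}"
      then show "k \<in> descents (ones i)"
        by (auto simp: descents_def parts_ones num_parts_def sum_list_replicate intro!: exI[of _ k])
    qed
    also have "\<dots> \<subseteq> descents \<beta>" using le by (simp add: comp_le_def)
    also have "\<dots> \<subseteq> (\<lambda>k. sum_list (take k (parts \<beta>))) ` {1..<length (parts \<beta>)}"
      by (auto simp: descents_def num_parts_def)
    finally have "card {1..<i} \<le> card {1..<length (parts \<beta>)}"
      by (rule surj_card_le[OF finite_atLeastLessThan])
    then show ?thesis using False by simp
  qed
  then have ones: "parts \<beta> = replicate (length (parts \<beta>)) 1"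
    unfolding w[symmetric] using parts_pos by (intro sum_list_le_length_imp_ones) blast+
  then have "sum_list (parts \<beta>) = sum_list (replicate (length (parts \<beta>)) 1)"
    by (rule arg_cong)
  then have "length (parts \<beta>) = i"
    unfolding w by (simp add: sum_list_replicate)
  then have "parts \<beta> = parts (ones i)"
    using ones unfolding parts_ones by (rule subst)
  then show "\<beta> = ones i" by (simp add: parts_inject)
qed (simp add: comp_le_def)

lemma Fqsym_ones: "Fqsym (ones i) = Mqsym (ones i)"
  by (rule ext) (simp add: Fqsym_def comp_le_ones)

text \<open>A new smallest variable contributes a new first part. That exponent 0 contributes none
  mirrors H_0 = 1.\<close>

lemma exponent_comp_single_add:
  assumes "\<And>l. l \<in> Poly_Mapping.keys m \<Longrightarrow> k < l"
  shows "exponent_comp (Poly_Mapping.single k x + m) = (if x = 0 then exponent_comp m else Composition [x] + exponent_comp m)"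
proof (cases "x = 0")
  case False
  have k: "k \<notin> Poly_Mapping.keys m" using assms by blast
  then have m0: "Poly_Mapping.lookup m k = 0" by (simp add: in_keys_iff)
  have keys: "Poly_Mapping.keys (Poly_Mapping.single k x + m) = insert k (Poly_Mapping.keys m)"
    using False m0 by (auto simp: in_keys_iff lookup_add lookup_single when_def split: if_splits)
  have "sorted_list_of_set (insert k (Poly_Mapping.keys m)) = k # sorted_list_of_set (Poly_Mapping.keys m)"
    using k assms by (simp add: sorted_list_of_set_insert_remove insort_is_Cons less_imp_le)
  moreover have "map (Poly_Mapping.lookup (Poly_Mapping.single k x + m)) (sorted_list_of_set (Poly_Mapping.keys m)) =
      map (Poly_Mapping.lookup m) (sorted_list_of_set (Poly_Mapping.keys m))"
    using k by (auto simp: lookup_add lookup_single when_def)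
  ultimately have "parts (exponent_comp (Poly_Mapping.single k x + m)) = parts (Composition [x] + exponent_comp m)"
    using False m0 by (simp add: parts_exponent_comp keys parts_Composition lookup_add)
  then have "exponent_comp (Poly_Mapping.single k x + m) = Composition [x] + exponent_comp m"
    by (rule parts_inject[THEN iffD1])
  then show ?thesis using False by simp
qed simp

definition indicator_monomial :: "nat set \<Rightarrow> monomial" where
  "indicator_monomial S = (\<Sum>k\<in>S. Poly_Mapping.single k 1)"

lemma lookup_indicator_monomial: "finite S \<Longrightarrow> Poly_Mapping.lookup (indicator_monomial S) k = (if k \<in> S then 1 else 0)"
  by (simp add: indicator_monomial_def lookup_sum lookup_single when_def)

lemma keys_indicator_monomial: "finite S \<Longrightarrow> Poly_Mapping.keys (indicator_monomial S) = S"
  by (auto simp: in_keys_iff lookup_indicator_monomial split: if_splits)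

lemma exponent_comp_eq_ones: "exponent_comp a = ones i \<longleftrightarrow> (\<exists>S. finite S \<and> card S = i \<and> a = indicator_monomial S)"
proof
  assume a: "exponent_comp a = ones i"
  let ?k = "sorted_list_of_set (Poly_Mapping.keys a)"
  have eq: "map (Poly_Mapping.lookup a) ?k = replicate i 1"
    using a by (metis parts_exponent_comp parts_ones)
  then have "length ?k = i" by (metis length_map length_replicate)
  moreover have "Poly_Mapping.lookup a l = 1" if "l \<in> Poly_Mapping.keys a" for l
  proof -
    have "Poly_Mapping.lookup a l \<in> set (map (Poly_Mapping.lookup a) ?k)" using that by simp
    then show ?thesis unfolding eq by simp
  qed
  then have "a = indicator_monomial (Poly_Mapping.keys a)"
    by (intro poly_mapping_eqI) (auto simp: lookup_indicator_monomial in_keys_iff)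
  ultimately show "\<exists>S. finite S \<and> card S = i \<and> a = indicator_monomial S"
    by (intro exI[of _ "Poly_Mapping.keys a"]) simp
next
  assume "\<exists>S. finite S \<and> card S = i \<and> a = indicator_monomial S"
  then obtain S where S: "finite S" "card S = i" "a = indicator_monomial S" by blast
  have "parts (exponent_comp a) = map (\<lambda>_. 1) (sorted_list_of_set S)"
    using S by (auto simp: parts_exponent_comp keys_indicator_monomial lookup_indicator_monomial)
  also have "\<dots> = replicate i 1" using S by (simp add: map_replicate_const)
  finally show "exponent_comp a = ones i" by (simp add: parts_inject[symmetric] parts_ones)
qed

lemma finite_monomial_splits: "finite {(a, b). a + b = (m :: monomial)}"
proof -
  let ?B = "{f. (\<forall>r\<in>Poly_Mapping.keys m. f r \<in> {..Poly_Mapping.lookup m r}) \<and>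
      (\<forall>r. r \<notin> Poly_Mapping.keys m \<longrightarrow> f r = 0)}"
  have "finite ?B"
    using finite_functions_box[of "Poly_Mapping.keys m" "\<lambda>r. {..Poly_Mapping.lookup m r}" "\<lambda>_. 0"] by simp
  moreover have "inj Poly_Mapping.lookup" by (rule injI) (rule poly_mapping_eqI, simp)
  ultimately have "finite (Poly_Mapping.lookup -` ?B)" by (rule finite_vimageI)
  moreover have "{(a, b). a + b = m} \<subseteq> (\<lambda>a. (a, m - a)) ` (Poly_Mapping.lookup -` ?B)"
  proof
    fix p assume "p \<in> {(a, b). a + b = m}"
    then obtain a b where p: "p = (a, b)" and m: "m = a + b" by auto
    have "Poly_Mapping.lookup m r = Poly_Mapping.lookup a r + Poly_Mapping.lookup b r" for r
      by (simp add: m lookup_add)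
    then have "a \<in> Poly_Mapping.lookup -` ?B" by (simp add: in_keys_iff)
    moreover have "p = (a, m - a)" by (simp add: p m)
    ultimately show "p \<in> (\<lambda>a. (a, m - a)) ` (Poly_Mapping.lookup -` ?B)" by blast
  qed
  ultimately show ?thesis by (meson finite_imageI finite_subset)
qed

text \<open>The first factor is the i-th elementary symmetric function: a term of the product
  removes one copy of each of i distinct variables dividing m.\<close>

lemma series_mult_ones:
  "series_mult (Mqsym (ones i)) G m =
    (\<Sum>S | S \<subseteq> Poly_Mapping.keys m \<and> card S = i. G (m - indicator_monomial S))"
proof -
  let ?T = "{S. S \<subseteq> Poly_Mapping.keys m \<and> card S = i}"
  have sub: "indicator_monomial S + (m - indicator_monomial S) = m" if "S \<subseteq> Poly_Mapping.keys m" for S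
  proof (rule poly_mapping_eqI)
    fix k
    have "finite S" using that by (rule finite_subset) simp
    then show "Poly_Mapping.lookup (indicator_monomial S + (m - indicator_monomial S)) k = Poly_Mapping.lookup m k"
      using that by (auto simp: lookup_add lookup_minus lookup_indicator_monomial in_keys_iff Suc_le_eq)
  qed
  have "series_mult (Mqsym (ones i)) G m =
      (\<Sum>(a, b)\<in>{(a, b). a + b = m}. if exponent_comp a = ones i then G b else 0)"
    unfolding series_mult_def by (rule sum.cong) (auto simp: Mqsym_eq)
  also have "\<dots> = (\<Sum>(a, b)\<in>{(a, b). a + b = m \<and> exponent_comp a = ones i}. G b)"
    by (rule sum.mono_neutral_cong_right) (auto simp: finite_monomial_splits split: if_splits)
  also have "\<dots> = (\<Sum>S\<in>?T. G (m - indicator_monomial S))"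
  proof (rule sum.reindex_bij_witness[of _ "\<lambda>S. (indicator_monomial S, m - indicator_monomial S)" "\<lambda>(a, b). Poly_Mapping.keys a"])
    fix p assume p: "p \<in> {(a, b). a + b = m \<and> exponent_comp a = ones i}"
    then obtain S b where S: "finite S" "card S = i" "p = (indicator_monomial S, b)" "indicator_monomial S + b = m"
      unfolding exponent_comp_eq_ones by auto
    then have "b = m - indicator_monomial S" by auto
    moreover have "S \<subseteq> Poly_Mapping.keys m"
      using S by (auto simp: in_keys_iff lookup_add lookup_indicator_monomial)
    ultimately show "(case p of (a, b) \<Rightarrow> Poly_Mapping.keys a) \<in> ?T"
      "(indicator_monomial (case p of (a, b) \<Rightarrow> Poly_Mapping.keys a), m - indicator_monomial (case p of (a, b) \<Rightarrow> Poly_Mapping.keys a)) = p"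
      "G (m - indicator_monomial (case p of (a, b) \<Rightarrow> Poly_Mapping.keys a)) = (case p of (a, b) \<Rightarrow> G b)"
      using S by (simp_all add: keys_indicator_monomial)
  next
    fix S assume S: "S \<in> ?T"
    then have "finite S" by (auto intro: finite_subset)
    then show "(case (indicator_monomial S, m - indicator_monomial S) of (a, b) \<Rightarrow> Poly_Mapping.keys a) = S"
      by (simp add: keys_indicator_monomial)
    have "exponent_comp (indicator_monomial S) = ones i" using S \<open>finite S\<close> exponent_comp_eq_ones by blast
    then show "(indicator_monomial S, m - indicator_monomial S) \<in> {(a, b). a + b = m \<and> exponent_comp a = ones i}"
      using S sub by simp
  qed
  finally show ?thesis .
qed

section \<open>Linear functionals on NSym, and adjointness of \<open>eperp\<close>\<close>

definition eval_coeffs :: "(composition \<Rightarrow> rat) \<Rightarrow> nsym \<Rightarrow> rat" where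
  "eval_coeffs g A = (\<Sum>\<alpha>\<in>Poly_Mapping.keys A. Poly_Mapping.lookup A \<alpha> * g \<alpha>)"

lemma eval_coeffs_superset:
  "finite S \<Longrightarrow> Poly_Mapping.keys A \<subseteq> S \<Longrightarrow> eval_coeffs g A = (\<Sum>\<alpha>\<in>S. Poly_Mapping.lookup A \<alpha> * g \<alpha>)"
  unfolding eval_coeffs_def by (rule sum.mono_neutral_left) (auto simp: in_keys_iff)

lemma eval_coeffs_zero [simp]: "eval_coeffs g 0 = 0"
  by (simp add: eval_coeffs_def)

lemma eval_coeffs_add: "eval_coeffs g (A + B) = eval_coeffs g A + eval_coeffs g B"
  using Poly_Mapping.keys_add[of A B]
  by (simp add: eval_coeffs_superset[of "Poly_Mapping.keys A \<union> Poly_Mapping.keys B"] lookup_add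
      distrib_right sum.distrib)

lemma eval_coeffs_nscale: "eval_coeffs g (nscale q A) = q * eval_coeffs g A"
  using keys_nscale[of q A]
  by (simp add: eval_coeffs_superset[of "Poly_Mapping.keys A"] sum_distrib_left mult.assoc)

lemma eval_coeffs_diff: "eval_coeffs g (A - B) = eval_coeffs g A - eval_coeffs g B"
  using eval_coeffs_add[of g "A - B" B] by simp

lemma eval_coeffs_sum: "eval_coeffs g (sum f S) = (\<Sum>i\<in>S. eval_coeffs g (f i))"
  by (induction S rule: infinite_finite_induct) (simp_all add: eval_coeffs_add)

lemma eval_coeffs_single [simp]: "eval_coeffs g (Poly_Mapping.single \<alpha> q) = q * g \<alpha>"
  by (simp add: eval_coeffs_def)

lemma eval_coeffs_lin: "eval_coeffs g (lin f A) = (\<Sum>\<alpha>\<in>Poly_Mapping.keys A. Poly_Mapping.lookup A \<alpha> * eval_coeffs g (f \<alpha>))"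
  by (simp add: lin_def eval_coeffs_sum eval_coeffs_nscale)

text \<open>The leading letter is absorbed into the functional; this is why \<open>g\<close> is an
  arbitrary function and is generalised in the induction below.\<close>

lemma eval_coeffs_Hgen_mult:
  "eval_coeffs g (Hgen (int y) * A) = eval_coeffs (\<lambda>\<gamma>. g (if y = 0 then \<gamma> else Composition [y] + \<gamma>)) A"
  by (induction A rule: nsym_induct) (auto simp: eval_coeffs_add distrib_left Hgen_def mult_single)

lemma pairing_eq_eval_coeffs: "pairing A G = eval_coeffs (Poly_Mapping.lookup (M_coeffs G)) A"
  by (simp add: pairing_def eval_coeffs_def)

lemma skew_word_elem_Cons:
  "skew_word elem_coeff i (x # xs) = Hgen (int x) * skew_word elem_coeff i xs -
    (if i = 0 then 0 else Hgen (int x - 1) * skew_word elem_coeff (i - 1) xs)"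
  by (simp add: sum_elem_coeff)

lemma subsets_insert_card:
  assumes "finite K" "k \<notin> K"
  shows "{S. S \<subseteq> insert k K \<and> card S = i} = {S. S \<subseteq> K \<and> card S = i} \<union>
    (if i = 0 then {} else insert k ` {S. S \<subseteq> K \<and> card S = i - 1})" (is "?l = ?r")
proof (rule equalityI; rule subsetI)
  fix S assume S: "S \<in> ?l"
  then have "finite S" using assms(1) by (auto intro: finite_subset)
  show "S \<in> ?r"
  proof (cases "k \<in> S")
    case True
    then have "S - {k} \<in> {S. S \<subseteq> K \<and> card S = i - 1}" and i: "i \<noteq> 0"
      using S \<open>finite S\<close> by (auto simp: card_gt_0_iff)
    moreover have "S = insert k (S - {k})" using True by blast
    ultimately have "S \<in> insert k ` {S. S \<subseteq> K \<and> card S = i - 1}" by (intro image_eqI)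
    then show ?thesis using i by simp
  qed (use S in blast)
next
  fix S assume "S \<in> ?r"
  then consider "S \<subseteq> K" "card S = i" | T where "i \<noteq> 0" "S = insert k T" "T \<subseteq> K" "card T = i - 1"
    by (auto split: if_splits)
  then show "S \<in> ?l"
  proof cases
    case 2
    have "finite T" "k \<notin> T" using 2 assms finite_subset by blast+
    then show ?thesis using 2 by auto
  qed auto
qed

text \<open>Induction on the variables, smallest first. If S omits the first variable its exponent x
  stays and gives H_x; if S contains it, the exponent drops to x - 1 and gives H_(x-1), with one
  change of sign. These are the two terms of \<open>skew_word_elem_Cons\<close>.\<close>

lemma sum_subsets_eq_eval_coeffs:
  "length is = length vs \<Longrightarrow> sorted_wrt (<) is \<Longrightarrow> \<forall>v\<in>set vs. 0 < v \<Longrightarrow>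
   (\<Sum>S | S \<subseteq> set is \<and> card S = i. g (exponent_comp (monomial_of is vs - indicator_monomial S))) =
     (- 1) ^ i * eval_coeffs g (skew_word elem_coeff i vs)"
proof (induction "is" vs arbitrary: i g rule: list_induct2)
  case Nil
  have "exponent_comp 0 = 0" by (rule parts_inject[THEN iffD1]) (simp add: parts_exponent_comp)
  moreover have "{S. S = {} \<and> card S = i} = (if i = 0 then {{}} else {} :: nat set set)" by auto
  ultimately show ?case using eval_coeffs_single[of g 0 1] by (simp add: indicator_monomial_def)
next
  case (Cons k "is" x vs)
  let ?M = "monomial_of is vs"
  have less: "k < l" if "l \<in> set is" for l using Cons.prems that by simp
  then have k: "k \<notin> set is" by blast
  have keys: "k < l" if "l \<in> Poly_Mapping.keys (?M - indicator_monomial S)" for l S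
  proof -
    have "Poly_Mapping.lookup ?M l \<noteq> 0" using that by (auto simp: in_keys_iff lookup_minus)
    then have "l \<in> set is" using lookup_monomial_of_eq_0[of l "is" vs] by auto
    then show ?thesis by (rule less)
  qed
  have Mk: "Poly_Mapping.lookup ?M k = 0" using k by (rule lookup_monomial_of_eq_0)
  have sub1: "exponent_comp (monomial_of (k # is) (x # vs) - indicator_monomial S) = Composition [x] + exponent_comp (?M - indicator_monomial S)"
    if "S \<subseteq> set is" for S
  proof -
    have "finite S" using that by (rule finite_subset) simp
    then have "monomial_of (k # is) (x # vs) - indicator_monomial S = Poly_Mapping.single k x + (?M - indicator_monomial S)"
      using that k by (intro poly_mapping_eqI) (auto simp: lookup_add lookup_minus lookup_indicator_monomial lookup_single when_def)
    then show ?thesis using exponent_comp_single_add[of "?M - indicator_monomial S" k x] keys Cons.prems by simp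
  qed
  have sub2: "exponent_comp (monomial_of (k # is) (x # vs) - indicator_monomial (insert k S)) =
      (if x - 1 = 0 then exponent_comp (?M - indicator_monomial S) else Composition [x - 1] + exponent_comp (?M - indicator_monomial S))"
    if "S \<subseteq> set is" for S
  proof -
    have "finite S" using that by (rule finite_subset) simp
    then have "monomial_of (k # is) (x # vs) - indicator_monomial (insert k S) = Poly_Mapping.single k (x - 1) + (?M - indicator_monomial S)"
      using that k Mk by (intro poly_mapping_eqI) (auto simp: lookup_add lookup_minus lookup_indicator_monomial lookup_single when_def)
    then show ?thesis using exponent_comp_single_add[of "?M - indicator_monomial S" k "x - 1"] keys by simp
  qed
  let ?g1 = "\<lambda>\<gamma>. g (if x = 0 then \<gamma> else Composition [x] + \<gamma>)"
  let ?g2 = "\<lambda>\<gamma>. g (if x - 1 = 0 then \<gamma> else Composition [x - 1] + \<gamma>)"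
  let ?T = "\<lambda>i. {S. S \<subseteq> set is \<and> card S = i}"
  have fin: "finite (?T i)" for i by simp
  have "(\<Sum>S\<in>?T i. g (exponent_comp (monomial_of (k # is) (x # vs) - indicator_monomial S))) = (\<Sum>S\<in>?T i. ?g1 (exponent_comp (?M - indicator_monomial S)))"
    by (rule sum.cong) (use sub1 Cons.prems in auto)
  also have "\<dots> = (- 1) ^ i * eval_coeffs ?g1 (skew_word elem_coeff i vs)"
    by (rule Cons.IH) (use Cons.prems in auto)
  finally have A: "(\<Sum>S\<in>?T i. g (exponent_comp (monomial_of (k # is) (x # vs) - indicator_monomial S))) =
     (- 1) ^ i * eval_coeffs g (Hgen (int x) * skew_word elem_coeff i vs)"
    by (simp only: eval_coeffs_Hgen_mult)
  have B: "(\<Sum>S\<in>insert k ` ?T (i - 1). g (exponent_comp (monomial_of (k # is) (x # vs) - indicator_monomial S))) =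
     (- 1) ^ (i - 1) * eval_coeffs g (Hgen (int x - 1) * skew_word elem_coeff (i - 1) vs)"
  proof -
    have "inj_on (insert k) (?T (i - 1))"
    proof (rule inj_onI)
      fix S T assume "S \<in> ?T (i - 1)" "T \<in> ?T (i - 1)" "insert k S = insert k T"
      moreover from this have "k \<notin> S" "k \<notin> T" using k by auto
      ultimately show "S = T" by (metis insert_ident)
    qed
    then have "(\<Sum>S\<in>insert k ` ?T (i - 1). g (exponent_comp (monomial_of (k # is) (x # vs) - indicator_monomial S))) =
      (\<Sum>S\<in>?T (i - 1). ?g2 (exponent_comp (?M - indicator_monomial S)))"
      unfolding sum.reindex[OF \<open>inj_on (insert k) (?T (i - 1))\<close>] o_def
      by (intro sum.cong refl arg_cong[of _ _ g] sub2) simp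
    also have "\<dots> = (- 1) ^ (i - 1) * eval_coeffs ?g2 (skew_word elem_coeff (i - 1) vs)"
      by (rule Cons.IH) (use Cons.prems in auto)
    also have "\<dots> = (- 1) ^ (i - 1) * eval_coeffs g (Hgen (int (x - 1)) * skew_word elem_coeff (i - 1) vs)"
      by (simp only: eval_coeffs_Hgen_mult)
    also have "int (x - 1) = int x - 1" using Cons.prems by (simp add: of_nat_diff Suc_le_eq)
    finally show ?thesis .
  qed
  show ?case
  proof (cases "i = 0")
    case True
    then show ?thesis
      using A subsets_insert_card[of "set is" k i] k by (simp add: skew_word_elem_Cons)
  next
    case False
    have "(\<Sum>S | S \<subseteq> set (k # is) \<and> card S = i. g (exponent_comp (monomial_of (k # is) (x # vs) - indicator_monomial S))) =
      (\<Sum>S\<in>?T i \<union> insert k ` ?T (i - 1). g (exponent_comp (monomial_of (k # is) (x # vs) - indicator_monomial S)))"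
      using subsets_insert_card[of "set is" k i] k False by simp
    also have "\<dots> = (\<Sum>S\<in>?T i. g (exponent_comp (monomial_of (k # is) (x # vs) - indicator_monomial S))) +
       (\<Sum>S\<in>insert k ` ?T (i - 1). g (exponent_comp (monomial_of (k # is) (x # vs) - indicator_monomial S)))"
      by (rule sum.union_disjoint) (use k in auto)
    also have "\<dots> = (- 1) ^ i * eval_coeffs g (skew_word elem_coeff i (x # vs))"
      unfolding A B skew_word_elem_Cons eval_coeffs_diff using False
      by (cases i) (simp_all add: algebra_simps)
    finally show ?thesis .
  qed
qed

lemma finite_weight_le: "finite {\<alpha>. weight \<alpha> \<le> N}"
proof -
  have "finite {xs. set xs \<subseteq> {..N} \<and> length xs \<le> N}"
    by (rule finite_lists_length_le) simp
  moreover have "parts ` {\<alpha>. weight \<alpha> \<le> N} \<subseteq> {xs. set xs \<subseteq> {..N} \<and> length xs \<le> N}"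
  proof clarify
    fix \<alpha> assume w: "weight \<alpha> \<le> N"
    have "length xs \<le> sum_list xs" if "\<forall>x\<in>set xs. 0 < x" for xs :: "nat list"
      using that by (induction xs) (auto simp: Suc_le_eq)
    then have "length (parts \<alpha>) \<le> N"
      using w parts_pos unfolding weight_def by (meson le_trans)
    moreover have "set (parts \<alpha>) \<subseteq> {..N}"
      using w member_le_sum_list[of _ "parts \<alpha>"] unfolding weight_def by fastforce
    ultimately show "set (parts \<alpha>) \<subseteq> {..N} \<and> length (parts \<alpha>) \<le> N" by blast
  qed
  ultimately have "finite (parts ` {\<alpha>. weight \<alpha> \<le> N})" by (rule finite_subset[rotated])
  then show ?thesis
    by (rule finite_imageD) (simp add: inj_on_def parts_inject)
qed

lemma series_mult_ones_qsym:
  assumes "\<And>\<alpha>. Poly_Mapping.lookup d \<alpha> = (- 1) ^ i * eval_coeffs (Poly_Mapping.lookup c) (skew_word elem_coeff i (parts \<alpha>))"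
  shows "series_mult (Fqsym (ones i)) (qsym_of_coeffs c) = qsym_of_coeffs d"
proof
  fix m :: monomial
  let ?is = "sorted_list_of_set (Poly_Mapping.keys m)"
  have m: "monomial_of ?is (parts (exponent_comp m)) = m"
    unfolding parts_exponent_comp by (rule monomial_of_lookup) auto
  have "series_mult (Fqsym (ones i)) (qsym_of_coeffs c) m =
     (\<Sum>S | S \<subseteq> set ?is \<and> card S = i. Poly_Mapping.lookup c (exponent_comp (monomial_of ?is (parts (exponent_comp m)) - indicator_monomial S)))"
    by (simp add: Fqsym_ones series_mult_ones qsym_of_coeffs_eq m)
  also have "\<dots> = (- 1) ^ i * eval_coeffs (Poly_Mapping.lookup c) (skew_word elem_coeff i (parts (exponent_comp m)))"
    by (rule sum_subsets_eq_eval_coeffs) (auto simp: parts_exponent_comp in_keys_iff)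
  finally show "series_mult (Fqsym (ones i)) (qsym_of_coeffs c) m = qsym_of_coeffs d m"
    by (simp add: qsym_of_coeffs_eq assms)
qed

text \<open>The description by \<open>THE\<close> is met by at most one element, because pairing
  with M_\<beta> reads off the coefficient at H_\<beta>.\<close>

lemma perp_Fqsym_ones: "perp (Fqsym (ones i)) A = nscale ((- 1) ^ i) (eperp i A)"
  unfolding perp_def
proof (rule the_equality)
  let ?B = "nscale ((- 1) ^ i) (eperp i A)"
  show *: "\<forall>G\<in>QSym. pairing ?B G = pairing A (series_mult (Fqsym (ones i)) G)"
  proof
    fix G assume "G \<in> QSym"
    then obtain c where G: "G = qsym_of_coeffs c" by (auto simp: QSym_def)
    let ?d = "\<lambda>\<alpha>. (- 1) ^ i * eval_coeffs (Poly_Mapping.lookup c) (skew_word elem_coeff i (parts \<alpha>))"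
    obtain N where N: "deg_le N c" using deg_le_exists by metis
    \<comment> \<open>\<open>skew_word\<close> lowers the weight by exactly i and c has bounded
      weight, so the product series again has finitely many M coefficients and lies in
      \<open>QSym\<close>.\<close>
    have "weight \<alpha> \<le> N + i" if nz: "?d \<alpha> \<noteq> 0" for \<alpha>
    proof -
      have "\<exists>\<gamma>\<in>Poly_Mapping.keys (skew_word elem_coeff i (parts \<alpha>)). Poly_Mapping.lookup c \<gamma> \<noteq> 0"
      proof (rule ccontr)
        assume "\<not> ?thesis"
        then have "eval_coeffs (Poly_Mapping.lookup c) (skew_word elem_coeff i (parts \<alpha>)) = 0"
          unfolding eval_coeffs_def by (intro sum.neutral) auto
        then show False using nz by simp
      qed
      then obtain \<gamma> where "\<gamma> \<in> Poly_Mapping.keys (skew_word elem_coeff i (parts \<alpha>))" "\<gamma> \<in> Poly_Mapping.keys c"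
        by (auto simp: in_keys_iff)
      then show ?thesis
        using keys_skew_word[of \<gamma>] N by (fastforce simp: deg_le_def weight_def)
    qed
    then have fin: "finite {\<alpha>. ?d \<alpha> \<noteq> 0}"
      by (intro finite_subset[OF _ finite_weight_le[of "N + i"]]) blast
    define d where "d = Abs_poly_mapping ?d"
    have d: "Poly_Mapping.lookup d \<alpha> = ?d \<alpha>" for \<alpha>
      unfolding d_def using fin by simp
    have "pairing A (series_mult (Fqsym (ones i)) G) = eval_coeffs ?d A"
      unfolding G series_mult_ones_qsym[OF d] pairing_eq_eval_coeffs M_coeffs_qsym_of_coeffs
      by (simp add: eval_coeffs_def d)
    also have "\<dots> = pairing ?B G"
      unfolding G pairing_eq_eval_coeffs M_coeffs_qsym_of_coeffs skewop_def eval_coeffs_nscale eval_coeffs_lin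
      by (simp add: eval_coeffs_def sum_distrib_left mult.left_commute)
    finally show "pairing ?B G = pairing A (series_mult (Fqsym (ones i)) G)" ..
  qed
  fix B assume B: "\<forall>G\<in>QSym. pairing B G = pairing A (series_mult (Fqsym (ones i)) G)"
  have coeff: "pairing C (qsym_of_coeffs (Poly_Mapping.single \<beta> 1)) = Poly_Mapping.lookup C \<beta>" for C \<beta>
  proof -
    have "pairing C (qsym_of_coeffs (Poly_Mapping.single \<beta> 1)) =
       (\<Sum>\<alpha>\<in>Poly_Mapping.keys C. if \<alpha> = \<beta> then Poly_Mapping.lookup C \<alpha> else 0)"
      unfolding pairing_def M_coeffs_qsym_of_coeffs
      by (rule sum.cong) (auto simp: lookup_single when_def)
    then show ?thesis by (simp add: in_keys_iff)
  qed
  show "B = ?B"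
  proof (rule poly_mapping_eqI)
    fix \<beta>
    have "qsym_of_coeffs (Poly_Mapping.single \<beta> 1) \<in> QSym" by (simp add: QSym_def)
    then show "Poly_Mapping.lookup B \<beta> = Poly_Mapping.lookup ?B \<beta>"
      using B * coeff by metis
  qed
qed

lemma creation_eq_bern: "creation m A = bern m A"
proof -
  have "(- 1) ^ i * Hgen (m + int i) * nscale ((- 1) ^ i) (eperp i A) = Hgen (m + int i) * eperp i A" for i
    by (cases "even i") (simp_all add: nscale_minus_one)
  then show ?thesis by (simp add: creation_def bern_def perp_Fqsym_ones)
qed

lemma immaculate_eq_bern_word: "immaculate \<alpha> = bern_word (parts \<alpha>)"
proof -
  have "creation = bern" by (intro ext) (rule creation_eq_bern)
  then show ?thesis by (simp add: immaculate_def bern_word_def)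
qed

section \<open>Linear independence and the tableau model\<close>

lemma skewop_0:
  assumes "c 0 = 1"
  shows "skewop c 0 A = A"
proof (rule nlin_word_eqI[where A = A])
  show "skewop c 0 (word xs) = word xs" for xs
    by (induction xs) (simp_all add: skewop_one word_Cons skewop_Hgen_mult[of c, OF assms] assms)
qed (intro nlin_skewop nlin_id)+

lemma composition_add_left_cancel: "\<gamma> + \<alpha> = \<gamma> + \<beta> \<longleftrightarrow> \<alpha> = (\<beta> :: composition)"
proof
  assume "\<gamma> + \<alpha> = \<gamma> + \<beta>"
  then have "parts (\<gamma> + \<alpha>) = parts (\<gamma> + \<beta>)" by (rule arg_cong)
  then show "\<alpha> = \<beta>" by (simp add: parts_inject)
qed simp

lemma lookup_single_mult:
  fixes A :: nsym
  shows "Poly_Mapping.lookup (Poly_Mapping.single \<gamma> 1 * A) (\<gamma> + \<beta>) = Poly_Mapping.lookup A \<beta>"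
  by (induction A rule: nsym_induct)
    (simp_all add: distrib_left lookup_add mult_single lookup_single when_def composition_add_left_cancel)

lemma keys_Hgen_mult:
  assumes "0 < y" "\<gamma> \<in> Poly_Mapping.keys (Hgen (int y) * A)"
  obtains \<beta> where "\<beta> \<in> Poly_Mapping.keys A" "parts \<gamma> = y # parts \<beta>"
proof -
  obtain \<gamma>1 \<beta> where "\<gamma> = \<gamma>1 + \<beta>" "\<gamma>1 \<in> Poly_Mapping.keys (Hgen (int y))" "\<beta> \<in> Poly_Mapping.keys A"
    using assms(2) keys_mult by blast
  then show thesis using that assms(1) by (auto simp: Hgen_def parts_Composition split: if_splits)
qed

text \<open>Lists are compared lexicographically. In \<open>bern x\<close> the term i = 0 puts H_x
  in front, and every term with i > 0 starts with the larger letter x + i.\<close>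

lemma bern_word_unitriangular:
  assumes "\<forall>x\<in>set xs. 0 < x"
  shows "(\<forall>\<gamma>\<in>Poly_Mapping.keys (bern_word xs). xs \<le> parts \<gamma>) \<and>
    Poly_Mapping.lookup (bern_word xs) (Composition xs) = 1"
  using assms
proof (induction xs)
  case Nil
  show ?case by (simp add: zero_composition_def[symmetric])
next
  case (Cons x xs)
  let ?A = "bern_word xs"
  obtain N where N: "deg_le N ?A" using deg_le_exists by metis
  let ?rest = "\<Sum>i\<in>{1..N}. Hgen (int (x + i)) * eperp i ?A"
  have "bern_word (x # xs) = (\<Sum>i\<in>insert 0 {1..N}. Hgen (int x + int i) * eperp i ?A)"
    by (simp add: bern_eq_deg[OF N] atMost_atLeast0 atLeastAtMost_insertL del: sum.insert)
  then have eq: "bern_word (x # xs) = Hgen (int x) * ?A + ?rest"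
    by (simp add: skewop_0)
  have rest: "\<exists>i\<ge>1. \<exists>\<beta>. parts \<gamma> = (x + i) # parts \<beta>" if \<gamma>: "\<gamma> \<in> Poly_Mapping.keys ?rest" for \<gamma>
  proof -
    obtain i where i: "i \<in> {1..N}" "\<gamma> \<in> Poly_Mapping.keys (Hgen (int (x + i)) * eperp i ?A)"
      using \<gamma> keys_sum_subset by fast
    then obtain \<beta> where "parts \<gamma> = (x + i) # parts \<beta>"
      using keys_Hgen_mult[of "x + i" \<gamma>] by auto
    then show ?thesis using i by auto
  qed
  have "x # xs \<le> parts \<gamma>" if \<gamma>: "\<gamma> \<in> Poly_Mapping.keys (bern_word (x # xs))" for \<gamma>
  proof -
    have "\<gamma> \<in> Poly_Mapping.keys (Hgen (int x) * ?A) \<or> \<gamma> \<in> Poly_Mapping.keys ?rest"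
      using \<gamma>[unfolded eq] Poly_Mapping.keys_add[of "Hgen (int x) * ?A" ?rest] by (rule subsetD[rotated, THEN UnE]) auto
    then show ?thesis
    proof
      assume "\<gamma> \<in> Poly_Mapping.keys (Hgen (int x) * ?A)"
      then obtain \<beta> where "\<beta> \<in> Poly_Mapping.keys ?A" "parts \<gamma> = x # parts \<beta>"
        using Cons.prems keys_Hgen_mult[of x \<gamma> ?A] by (metis list.set_intros(1))
      then show ?thesis using Cons by simp
    next
      assume "\<gamma> \<in> Poly_Mapping.keys ?rest"
      then obtain i \<beta> where "1 \<le> i" "parts \<gamma> = (x + i) # parts \<beta>" using rest by blast
      then show ?thesis by simp
    qed
  qed
  moreover have "Poly_Mapping.lookup (bern_word (x # xs)) (Composition (x # xs)) = 1"
  proof -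
    have parts: "parts (Composition (x # xs)) = x # xs"
      using Cons.prems by (intro parts_Composition) simp
    have "Composition (x # xs) \<notin> Poly_Mapping.keys ?rest"
      using rest[of "Composition (x # xs)"] parts by auto
    then have "Poly_Mapping.lookup (bern_word (x # xs)) (Composition (x # xs)) =
       Poly_Mapping.lookup (Hgen (int x) * ?A) (Composition (x # xs))"
      unfolding eq by (simp add: lookup_add in_keys_iff)
    also have "\<dots> = Poly_Mapping.lookup ?A (Composition xs)"
    proof -
      have c: "Composition (x # xs) = Composition [x] + Composition xs"
        by (rule parts_inject[THEN iffD1]) (use Cons.prems in \<open>simp add: parts_Composition\<close>)
      have h: "Hgen (int x) = Poly_Mapping.single (Composition [x]) 1"
        using Cons.prems by (simp add: Hgen_def)
      show ?thesis unfolding c h by (rule lookup_single_mult)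
    qed
    finally show ?thesis using Cons by simp
  qed
  ultimately show ?case by blast
qed

lemma immaculate_comb_eq_lin: "immaculate_comb c = lin immaculate c"
  by (simp add: immaculate_comb_def lin_def)

text \<open>For the lexicographically least \<alpha> in the support of e, no other immaculate
  function in the combination involves H_\<alpha>.\<close>

lemma lin_immaculate_eq_0:
  assumes "lin immaculate e = 0"
  shows "e = 0"
proof (rule ccontr)
  assume "e \<noteq> 0"
  then have "parts ` Poly_Mapping.keys e \<noteq> {}" by simp
  then have "Min (parts ` Poly_Mapping.keys e) \<in> parts ` Poly_Mapping.keys e"
    by (intro Min_in) auto
  then obtain \<alpha> where \<alpha>: "\<alpha> \<in> Poly_Mapping.keys e" "parts \<alpha> = Min (parts ` Poly_Mapping.keys e)"
    by auto
  have tri: "(\<forall>\<gamma>\<in>Poly_Mapping.keys (immaculate \<beta>). parts \<beta> \<le> parts \<gamma>) \<and>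
      Poly_Mapping.lookup (immaculate \<beta>) \<beta> = 1" for \<beta>
    using bern_word_unitriangular[of "parts \<beta>"] parts_pos[of _ \<beta>]
    by (simp add: immaculate_eq_bern_word parts_inverse)
  have "Poly_Mapping.lookup (lin immaculate e) \<alpha> =
    (\<Sum>\<beta>\<in>Poly_Mapping.keys e. if \<beta> = \<alpha> then Poly_Mapping.lookup e \<beta> else 0)"
    unfolding lookup_lin
  proof (rule sum.cong[OF refl])
    fix \<beta> assume \<beta>: "\<beta> \<in> Poly_Mapping.keys e"
    have "Poly_Mapping.lookup (immaculate \<beta>) \<alpha> = 0" if "\<beta> \<noteq> \<alpha>"
    proof (rule ccontr)
      assume "Poly_Mapping.lookup (immaculate \<beta>) \<alpha> \<noteq> 0"
      then have "parts \<beta> \<le> parts \<alpha>" using tri[of \<beta>] by (simp add: in_keys_iff)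
      moreover have "parts \<alpha> \<le> parts \<beta>" unfolding \<alpha>(2) using \<beta> by (intro Min_le) auto
      ultimately have "parts \<beta> = parts \<alpha>" by (rule order_antisym)
      then show False using that by (simp add: parts_inject)
    qed
    then show "Poly_Mapping.lookup e \<beta> * Poly_Mapping.lookup (immaculate \<beta>) \<alpha> =
        (if \<beta> = \<alpha> then Poly_Mapping.lookup e \<beta> else 0)"
      using tri[of \<beta>] by auto
  qed
  also have "\<dots> = Poly_Mapping.lookup e \<alpha>" using \<alpha>(1) by simp
  finally show False using \<alpha>(1) assms by (simp add: in_keys_iff)
qed

lemma immaculate_comb_inject: "immaculate_comb c = immaculate_comb d \<longleftrightarrow> c = d"
proof
  assume "immaculate_comb c = immaculate_comb d"
  moreover have "lin immaculate (c - d) + lin immaculate d = lin immaculate c"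
    by (simp add: nlin_add[OF nlin_lin, symmetric])
  ultimately have "lin immaculate (c - d) = 0" by (simp add: immaculate_comb_eq_lin)
  then show "c = d" using lin_immaculate_eq_0[of "c - d"] by simp
qed simp

section \<open>Fillings of the skew shape as lists of rows\<close>

lemma skew_tableau_iff:
  "skew_tableau \<mu> as \<gamma> R \<longleftrightarrow> length as \<le> length R \<and> (\<forall>r\<in>set R. sorted r \<and> 0 \<notin> set r) \<and>
    [] \<notin> set (drop (length as) R) \<and> sorted_wrt (<) (map hd (drop (length as) R)) \<and>
    yam_from 1 \<gamma> (reading R) \<and> (\<forall>i\<ge>1. add_content \<gamma> (reading R) i = \<mu> i)"
proof (induction as arbitrary: \<gamma> R)
  case Nil
  have "(\<forall>x\<in>set r. 1 \<le> x) \<longleftrightarrow> 0 \<notin> set r" for r :: "nat list"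
    by (metis less_one linorder_not_le)
  then show ?case by (auto simp: straight_tableaux_def)
next
  case (Cons a as)
  show ?case
    by (cases R) (auto simp: Cons.IH yam_from_append add_content_append)
qed

lemma outer_shape_eq_iff:
  "length as \<le> length R \<Longrightarrow> outer_shape as R = bs \<longleftrightarrow>
    length R = length bs \<and> (\<forall>i<length R. bs ! i = (if i < length as then as ! i else 0) + length (R ! i))"
proof (induction as arbitrary: R bs)
  case Nil
  then show ?case by (auto simp: list_eq_iff_nth_eq)
next
  case (Cons a as)
  then show ?case
    by (cases R; cases bs) (auto simp: All_less_Suc2)
qed

lemma sorted_wrt_map_upt:
  "sorted_wrt P (map f [a..<b]) \<longleftrightarrow> (\<forall>j j'. a \<le> j \<and> j < j' \<and> j' < b \<longrightarrow> P (f j) (f j'))"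
proof
  assume l: "sorted_wrt P (map f [a..<b])"
  show "\<forall>j j'. a \<le> j \<and> j < j' \<and> j' < b \<longrightarrow> P (f j) (f j')"
  proof (intro allI impI)
    fix j j' assume "a \<le> j \<and> j < j' \<and> j' < b"
    then show "P (f j) (f j')"
      using l[unfolded sorted_wrt_iff_nth_less, rule_format, of "j - a" "j' - a"] by (simp add: diff_less_mono)
  qed
qed (auto simp: sorted_wrt_iff_nth_less)

context
  fixes \<alpha> \<beta> :: composition
begin

definition row :: "(nat \<times> nat \<Rightarrow> nat) \<Rightarrow> nat \<Rightarrow> nat list" where
  "row T i = map (\<lambda>j. T (i, j)) [part \<alpha> i + 1..<part \<beta> i + 1]"

definition rows :: "(nat \<times> nat \<Rightarrow> nat) \<Rightarrow> nat list list" where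
  "rows T = map (row T) [1..<num_parts \<beta> + 1]"

lemma reading_rows: "reading_word \<beta> \<alpha> T = reading (rows T)"
  by (simp add: reading_word_def reading_def rows_def row_def rev_map o_def del: upt_Suc)

lemma part_pos: "1 \<le> i \<Longrightarrow> i \<le> num_parts \<gamma> \<Longrightarrow> 0 < part \<gamma> i"
  using parts_pos[OF nth_mem[of "i - 1" "parts \<gamma>"]] by (auto simp: Defs.part_def num_parts_def)

lemma part_beyond: "num_parts \<gamma> < i \<Longrightarrow> part \<gamma> i = 0"
  by (simp add: Defs.part_def)

lemma skew_shape_iff:
  "(i, j) \<in> skew_shape \<beta> \<alpha> \<longleftrightarrow> 1 \<le> i \<and> i \<le> num_parts \<beta> \<and> part \<alpha> i < j \<and> j \<le> part \<beta> i"
  by (auto simp: skew_shape_def part_beyond not_le)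

text \<open>The parts of \<alpha> are positive, so \<alpha> covers the first column in all of its
  rows.\<close>

lemma first_column_iff:
  "(i, 1) \<in> skew_shape \<beta> \<alpha> \<longleftrightarrow> num_parts \<alpha> < i \<and> i \<le> num_parts \<beta>"
  using part_pos[of i \<alpha>] part_pos[of i \<beta>] part_beyond[of \<alpha> i]
  by (cases "i \<le> num_parts \<alpha>") (auto simp: skew_shape_iff)

lemma length_rows [simp]: "length (rows T) = num_parts \<beta>"
  by (simp add: rows_def)

lemma rows_nth: "i < num_parts \<beta> \<Longrightarrow> rows T ! i = row T (Suc i)"
  by (simp add: rows_def del: upt_Suc)

lemma drop_rows: "drop (num_parts \<alpha>) (rows T) = map (row T) [num_parts \<alpha> + 1..<num_parts \<beta> + 1]"
  by (simp add: rows_def drop_map del: upt_Suc)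

lemma set_rows: "set (rows T) = row T ` {i. 1 \<le> i \<and> i \<le> num_parts \<beta>}"
  by (auto simp: rows_def simp del: upt_Suc)

lemma hd_row: "num_parts \<alpha> < i \<Longrightarrow> i \<le> num_parts \<beta> \<Longrightarrow> row T i \<noteq> [] \<and> hd (row T i) = T (i, 1)"
  using part_pos[of i \<beta>] part_beyond[of \<alpha> i] by (simp add: row_def upt_conv_Cons del: upt_Suc)

lemma outer_shape_rows:
  assumes "comp_contained \<alpha> \<beta>"
  shows "outer_shape (parts \<alpha>) (rows T) = parts \<beta>"
proof -
  have le: "part \<alpha> i \<le> part \<beta> i" if "i \<le> num_parts \<beta>" for i
    using assms part_beyond[of \<alpha> i] by (cases "1 \<le> i \<and> i \<le> num_parts \<alpha>") (auto simp: comp_contained_def Defs.part_def)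
  have "parts \<beta> ! i = (if i < length (parts \<alpha>) then parts \<alpha> ! i else 0) + length (rows T ! i)"
    if "i < num_parts \<beta>" for i
    using le[of "Suc i"] that by (auto simp: rows_nth row_def Defs.part_def num_parts_def)
  then show ?thesis
    using assms by (subst outer_shape_eq_iff) (auto simp: comp_contained_def num_parts_def)
qed

lemma yamanouchi_iff: "yamanouchi w \<longleftrightarrow> yam_from 1 (\<lambda>_. 0) w"
proof
  assume y: "yamanouchi w"
  show "yam_from 1 (\<lambda>_. 0) w"
    unfolding yam_from_def
  proof (intro allI impI)
    fix u v i assume "w = u @ v" "1 \<le> (i :: nat)"
    then show "add_content (\<lambda>_. 0) u (Suc i) \<le> add_content (\<lambda>_. 0) u i"
      using y[unfolded yamanouchi_def, rule_format, of "length u" i] by (simp add: add_content_def)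
  qed
next
  assume y: "yam_from 1 (\<lambda>_. 0) w"
  show "yamanouchi w"
    unfolding yamanouchi_def
  proof (intro allI impI)
    fix k i assume "1 \<le> (i :: nat)"
    then show "count_list (take k w) (i + 1) \<le> count_list (take k w) i"
      using y[unfolded yam_from_def, rule_format, of "take k w" "drop k w" i] by (simp add: add_content_def)
  qed
qed

lemma yamanouchi_tableaux_iff:
  assumes "comp_contained \<alpha> \<beta>" "T \<in> extensional (skew_shape \<beta> \<alpha>)"
  shows "T \<in> yamanouchi_tableaux \<beta> \<alpha> \<mu> \<longleftrightarrow> skew_tableau (part \<mu>) (parts \<alpha>) (\<lambda>_. 0) (rows T)"
proof -
  have "T \<in> skew_shape \<beta> \<alpha> \<rightarrow>\<^sub>E {1..} \<longleftrightarrow> (\<forall>r\<in>set (rows T). 0 \<notin> set r)"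
  proof -
    have "T \<in> skew_shape \<beta> \<alpha> \<rightarrow>\<^sub>E {1..} \<longleftrightarrow> (\<forall>i j. (i, j) \<in> skew_shape \<beta> \<alpha> \<longrightarrow> T (i, j) \<noteq> 0)"
      using assms(2) by (auto simp: PiE_def Pi_def Suc_le_eq)
    also have "\<dots> \<longleftrightarrow> (\<forall>r\<in>set (rows T). 0 \<notin> set r)"
      by (auto simp: set_rows row_def skew_shape_iff image_iff Suc_le_eq less_Suc_eq_le simp del: upt_Suc)
    finally show ?thesis .
  qed
  moreover have "(\<forall>i j j'. (i, j) \<in> skew_shape \<beta> \<alpha> \<and> (i, j') \<in> skew_shape \<beta> \<alpha> \<and> j < j' \<longrightarrow> T (i, j) \<le> T (i, j')) \<longleftrightarrow>
      (\<forall>r\<in>set (rows T). sorted r)"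
    by (auto simp: set_rows row_def sorted_wrt_map_upt skew_shape_iff Suc_le_eq less_Suc_eq_le simp del: upt_Suc)
  moreover have "(\<forall>i i'. (i, 1) \<in> skew_shape \<beta> \<alpha> \<and> (i', 1) \<in> skew_shape \<beta> \<alpha> \<and> i < i' \<longrightarrow> T (i, 1) < T (i', 1)) \<longleftrightarrow>
      sorted_wrt (<) (map hd (drop (num_parts \<alpha>) (rows T)))"
  proof -
    have "map hd (drop (num_parts \<alpha>) (rows T)) = map (\<lambda>i. T (i, 1)) [num_parts \<alpha> + 1..<num_parts \<beta> + 1]"
      unfolding drop_rows map_map o_def by (rule map_cong) (auto simp: hd_row simp del: upt_Suc)
    then show ?thesis
      unfolding first_column_iff by (auto simp: sorted_wrt_map_upt Suc_le_eq less_Suc_eq_le simp del: upt_Suc)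
  qed
  moreover have "[] \<notin> set (drop (num_parts \<alpha>) (rows T))"
  proof
    assume "[] \<in> set (drop (num_parts \<alpha>) (rows T))"
    then obtain i where "num_parts \<alpha> < i" "i \<le> num_parts \<beta>" "row T i = []"
      unfolding drop_rows by (auto simp: Suc_le_eq less_Suc_eq_le simp del: upt_Suc)
    then show False using hd_row[of i T] by simp
  qed
  moreover have "num_parts \<alpha> \<le> num_parts \<beta>"
    using assms(1) by (simp add: comp_contained_def)
  ultimately show ?thesis
    using assms(1) unfolding skew_tableau_iff yamanouchi_tableaux_def skew_immaculate_tableaux_def
    by (auto simp: num_parts_def[symmetric] yamanouchi_iff reading_rows has_content_def add_content_def)
qed

text \<open>If \<beta> does not contain \<alpha>, both sides are empty, as the condition on the
  outer shape forces containment.\<close>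

lemma bij_betw_rows:
  "bij_betw rows (yamanouchi_tableaux \<beta> \<alpha> \<mu>)
    {R. skew_tableau (part \<mu>) (parts \<alpha>) (\<lambda>_. 0) R \<and> outer_shape (parts \<alpha>) R = parts \<beta>}"
  (is "bij_betw rows ?T ?R")
  unfolding bij_betw_def
proof
  have ext: "T \<in> extensional (skew_shape \<beta> \<alpha>)" and cont: "comp_contained \<alpha> \<beta>" if "T \<in> ?T" for T
    using that by (auto simp: yamanouchi_tableaux_def skew_immaculate_tableaux_def PiE_def)
  have entry: "T (i, j) = rows T ! (i - 1) ! (j - part \<alpha> i - 1)" if "(i, j) \<in> skew_shape \<beta> \<alpha>" for T i j
    using that by (auto simp: skew_shape_iff rows_nth row_def simp del: upt_Suc)
  show "inj_on rows ?T"
  proof (rule inj_onI)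
    fix T T' assume T: "T \<in> ?T" "T' \<in> ?T" and eq: "rows T = rows T'"
    show "T = T'"
    proof (rule extensionalityI[OF ext[OF T(1)] ext[OF T(2)]])
      fix x assume "x \<in> skew_shape \<beta> \<alpha>"
      then obtain i j where x: "x = (i, j)" and ij: "(i, j) \<in> skew_shape \<beta> \<alpha>" by (cases x) auto
      show "T x = T' x" unfolding x entry[OF ij, of T] entry[OF ij, of T'] eq ..
    qed
  qed
  show "rows ` ?T = ?R"
  proof (rule equalityI; rule subsetI)
    fix R assume "R \<in> rows ` ?T"
    then obtain T where R: "R = rows T" and T: "T \<in> ?T" by blast
    show "R \<in> ?R"
      using T yamanouchi_tableaux_iff[OF cont[OF T] ext[OF T], of \<mu>] outer_shape_rows[OF cont[OF T], of T]
      unfolding R by blast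
  next
    fix R assume R: "R \<in> ?R"
    then have len: "length (parts \<alpha>) \<le> length R" by (simp add: skew_tableau_iff)
    then have sh: "length R = num_parts \<beta>"
      "\<And>i. i < length R \<Longrightarrow> parts \<beta> ! i = (if i < length (parts \<alpha>) then parts \<alpha> ! i else 0) + length (R ! i)"
      using R by (simp_all add: outer_shape_eq_iff num_parts_def)
    have cont: "comp_contained \<alpha> \<beta>"
      using len sh by (force simp: comp_contained_def num_parts_def Defs.part_def)
    \<comment> \<open>Rows and columns count from 1, list positions from 0, and the list for row i
      starts right after the \<open>part \<alpha> i\<close> cells of \<alpha>.\<close>
    let ?T = "restrict (\<lambda>(i, j). R ! (i - 1) ! (j - part \<alpha> i - 1)) (skew_shape \<beta> \<alpha>)"
    have rows: "rows ?T = R"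
    proof (rule nth_equalityI)
      fix i assume "i < length (rows ?T)"
      then have i: "i < num_parts \<beta>" by simp
      have len_i: "part \<beta> (Suc i) = part \<alpha> (Suc i) + length (R ! i)"
        using sh(2)[of i] i sh(1) by (simp add: Defs.part_def num_parts_def)
      show "rows ?T ! i = R ! i"
        unfolding rows_nth[OF i]
      proof (rule nth_equalityI)
        show "length (row ?T (Suc i)) = length (R ! i)"
          by (simp add: row_def len_i del: upt_Suc)
        fix j assume "j < length (row ?T (Suc i))"
        then have j: "j < length (R ! i)" by (simp add: row_def len_i del: upt_Suc)
        then have "(Suc i, part \<alpha> (Suc i) + 1 + j) \<in> skew_shape \<beta> \<alpha>"
          using i len_i by (simp add: skew_shape_iff)
        then show "row ?T (Suc i) ! j = R ! i ! j"
          using j by (simp add: row_def len_i del: upt_Suc)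
      qed
    qed (simp add: sh(1))
    have "skew_tableau (part \<mu>) (parts \<alpha>) (\<lambda>_. 0) (rows ?T)"
      unfolding rows using R by blast
    then have "?T \<in> yamanouchi_tableaux \<beta> \<alpha> \<mu>"
      by (rule yamanouchi_tableaux_iff[OF cont restrict_extensional, THEN iffD2])
    then have "rows ?T \<in> rows ` yamanouchi_tableaux \<beta> \<alpha> \<mu>" by (rule imageI)
    then show "R \<in> rows ` yamanouchi_tableaux \<beta> \<alpha> \<mu>" unfolding rows .
  qed
qed

end

lemma immaculate_mult:
  fixes \<alpha> :: composition
  assumes "is_partition \<mu>"
  defines "\<T> \<equiv> {R. skew_tableau (part \<mu>) (parts \<alpha>) (\<lambda>_. 0) R}"
  shows "finite \<T>" and
    "immaculate \<alpha> * immaculate \<mu> = (\<Sum>R\<in>\<T>. bern_word (outer_shape (parts \<alpha>) R))"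
proof -
  let ?n = "num_parts \<mu>"
  have mono: "part \<mu> s \<le> part \<mu> r" if "1 \<le> r" "r \<le> s" for r s
  proof (cases "s \<le> ?n \<and> r < s")
    case True
    then have "r - 1 < s - 1" "s - 1 < length (parts \<mu>)" using that by (auto simp: num_parts_def)
    then have "parts \<mu> ! (s - 1) \<le> parts \<mu> ! (r - 1)"
      using assms(1) unfolding is_partition_def sorted_wrt_iff_nth_less by blast
    then show ?thesis using that True by (simp add: Defs.part_def)
  next
    case False
    then show ?thesis using that by (cases "r = s") (auto simp: Defs.part_def)
  qed
  have supp: "part \<mu> r = 0" if "?n < r" for r
    using that by (simp add: Defs.part_def)
  have "map (part \<mu>) [1..<Suc ?n] = parts \<mu>"
    by (rule nth_equalityI) (auto simp: Defs.part_def num_parts_def simp del: upt_Suc)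
  then have "skewimm (part \<mu>) ?n 1 (\<lambda>_. 0) = immaculate \<mu>"
    using skewimm_zero[of 1 "\<lambda>_. 0" "part \<mu>" ?n] by (simp add: immaculate_eq_bern_word del: upt_Suc)
  then show "finite \<T>" "immaculate \<alpha> * immaculate \<mu> = (\<Sum>R\<in>\<T>. bern_word (outer_shape (parts \<alpha>) R))"
    using bern_word_mult_skewimm[of "part \<mu>" ?n "\<lambda>_. 0" "parts \<alpha>", OF mono supp]
    by (simp_all add: immaculate_eq_bern_word \<T>_def)
qed

text \<open>Rows beside \<alpha> have positive length already through \<alpha>, those below are
  nonempty; hence \<open>Composition\<close> loses nothing on outer shapes.\<close>

lemma outer_shape_pos:
  assumes "skew_tableau \<mu> (parts \<alpha>) \<gamma> R" "x \<in> set (outer_shape (parts \<alpha>) R)"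
  shows "0 < x"
proof -
  have "0 < x" if "skew_tableau \<mu> as \<gamma> R" "\<forall>a\<in>set as. 0 < a" "x \<in> set (outer_shape as R)" for as
    using that
  proof (induction as arbitrary: \<gamma> R)
    case (Cons a as)
    then show ?case by (cases R) auto
  qed (auto simp: straight_tableaux_def)
  then show ?thesis using assms parts_pos by blast
qed

theorem theorem3p25:
  fixes \<alpha> \<mu> :: composition
  assumes "is_partition \<mu>"
  shows "(\<exists>!c. immaculate \<alpha> * immaculate \<mu> = immaculate_comb c) \<and>
    (\<forall>c. immaculate \<alpha> * immaculate \<mu> = immaculate_comb c \<longrightarrow>
      (\<forall>\<beta>. Poly_Mapping.lookup c \<beta> \<in> \<nat> \<and>
        finite (yamanouchi_tableaux \<beta> \<alpha> \<mu>) \<and>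
        Poly_Mapping.lookup c \<beta> = of_nat (card (yamanouchi_tableaux \<beta> \<alpha> \<mu>))))"
proof -
  let ?\<T> = "{R. skew_tableau (part \<mu>) (parts \<alpha>) (\<lambda>_. 0) R}"
  let ?sh = "\<lambda>R. Composition (outer_shape (parts \<alpha>) R)"
  have fin: "finite ?\<T>" by (rule immaculate_mult(1)[OF assms])
  have sh: "parts (?sh R) = outer_shape (parts \<alpha>) R" if "R \<in> ?\<T>" for R
    by (rule parts_Composition) (use outer_shape_pos that in blast)
  \<comment> \<open>One basis element for each tableau, at its outer shape, so that a coefficient
    counts the tableaux of that shape.\<close>
  define c where "c = (\<Sum>R\<in>?\<T>. Poly_Mapping.single (?sh R) (1 :: rat))"
  have "immaculate_comb c = (\<Sum>R\<in>?\<T>. immaculate (?sh R))"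
    by (simp add: immaculate_comb_eq_lin c_def nlin_sum[OF nlin_lin] lin_single)
  also have "\<dots> = (\<Sum>R\<in>?\<T>. bern_word (outer_shape (parts \<alpha>) R))"
    by (rule sum.cong[OF refl]) (simp add: immaculate_eq_bern_word sh del: mem_Collect_eq)
  also have "\<dots> = immaculate \<alpha> * immaculate \<mu>"
    by (rule immaculate_mult(2)[OF assms, symmetric])
  finally have c: "immaculate \<alpha> * immaculate \<mu> = immaculate_comb d \<longleftrightarrow> d = c" for d
    using immaculate_comb_inject by metis
  have coeff: "finite (yamanouchi_tableaux \<beta> \<alpha> \<mu>) \<and>
      Poly_Mapping.lookup c \<beta> = of_nat (card (yamanouchi_tableaux \<beta> \<alpha> \<mu>))" for \<beta>
  proof -
    let ?R = "{R. skew_tableau (part \<mu>) (parts \<alpha>) (\<lambda>_. 0) R \<and> outer_shape (parts \<alpha>) R = parts \<beta>}"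
    have iff: "?sh R = \<beta> \<longleftrightarrow> outer_shape (parts \<alpha>) R = parts \<beta>" if "R \<in> ?\<T>" for R
      unfolding parts_inject[symmetric] sh[OF that] ..
    have "Poly_Mapping.lookup c \<beta> = (\<Sum>R\<in>?\<T>. if outer_shape (parts \<alpha>) R = parts \<beta> then 1 else 0)"
      unfolding c_def lookup_sum
      by (rule sum.cong[OF refl]) (simp add: lookup_single when_def iff del: mem_Collect_eq)
    also have "\<dots> = of_nat (card (?\<T> \<inter> {R. outer_shape (parts \<alpha>) R = parts \<beta>}))"
      using fin by (simp add: sum.If_cases)
    also have "?\<T> \<inter> {R. outer_shape (parts \<alpha>) R = parts \<beta>} = ?R" by blast
    also have "card ?R = card (yamanouchi_tableaux \<beta> \<alpha> \<mu>)"
      by (rule bij_betw_same_card[OF bij_betw_rows, symmetric])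
    finally have "Poly_Mapping.lookup c \<beta> = of_nat (card (yamanouchi_tableaux \<beta> \<alpha> \<mu>))" .
    moreover have "finite ?R" by (rule finite_subset[OF _ fin]) blast
    then have "finite (yamanouchi_tableaux \<beta> \<alpha> \<mu>)"
      using bij_betw_finite[OF bij_betw_rows] by blast
    ultimately show ?thesis by blast
  qed
  then show ?thesis
    unfolding c by auto
qed

end
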